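(* Let $d \notin \{0,1\}$ be a square-free integer, let $k = \mathbb{Q}(\sqrt{d})$ with ring of integers $\mathcal{O}_k$, and let $q_d$ be the norm form of $\mathcal{O}_k$. Then $$ \mathrm{cl}^+(\Delta(q_d)) = H^1_{\mathrm{fl}}(\mathbb{Z}, \underline{\mathbf{O}}_d^+) \cong \{\pm 1\}^{\mu(d)} \times \mathrm{Pic}^+(\mathcal{O}_k), \quad \text{where } \mu(d) = \begin{cases} 1 & d<0 \\ 0 & d > 0. \end{cases}$$
   Context: A binary integral quadratic form $q=(a,b,c)$ is $q(x,y)=ax^2+bxy+cy^2$ with $a,b,c\in\mathbb{Z}$, with discriminant $\Delta(q)=b^2-4ac$. Set $\mathrm{cl}^+(n) = \{q : \Delta(q)=n\}/\mathbf{SL}_2(\mathbb{Z})$, where matrices act by change of variables (forms need not be positive definite). The norm form is $q_d(x,y) = \mathrm{Nr}_{k/\mathbb{Q}}(x+y\omega)$, where $\omega = \frac{1+\sqrt d}{2}$ if $d \equiv 1 \pmod 4$ and $\omega = \sqrt{d}$ if $d \equiv 2,3 \pmod 4$; its discriminant is the discriminant $\Delta_k$ of $k$. $\mathrm{Pic}^+(\mathcal{O}_k)$ is the narrow ideal class group of $k$. $\underline{\mathbf{O}}_d = \underline{\mathbf{O}}_{q_d}$ is the affine $\mathbb{Z}$-group scheme $\{A \in \mathbf{GL}_2 : q_d\circ A = q_d\}$, and $\underline{\mathbf{O}}_d^+$ is the schematic closure in it of $\ker[\det: \underline{\mathbf{O}}_d\otimes\mathbb{Q} \to \mu_2]$.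 $H^1_{\mathrm{fl}}(\mathbb{Z},\cdot)$ is first flat (fppf) cohomology over $\mathrm{Spec}\,\mathbb{Z}$; $H^1_{\mathrm{fl}}(\mathbb{Z},\underline{\mathbf{O}}_d^+)$ classifies integral binary quadratic forms that are locally properly isomorphic to $q_d$ for the fppf topology, modulo proper isometries ($\mathbf{SL}_2(\mathbb{Z})$), and the equality with $\mathrm{cl}^+(\Delta(q_d))$ is understood in this sense. The symbol $\cong$ denotes a bijection. *)

theory Defs
  imports
    "HOL-Algebra.IntRing"
    "HOL-Algebra.QuotRing"
    "HOL-Library.FuncSet"
    "HOL-Library.Poly_Mapping"
    "HOL-Computational_Algebra.Computational_Algebra"
begin

section \<open>Binary quadratic forms over a commutative ring\<close>

text \<open>The triple \<open>(a, b, c)\<close> is the form \<open>a x^2 + b x y + c y^2\<close>, and \<open>(\<alpha>, \<beta>, \<gamma>, \<delta>)\<close> is the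
  matrix with rows \<open>(\<alpha>, \<beta>)\<close> and \<open>(\<gamma>, \<delta>)\<close>.\<close>

type_synonym 'a form = "'a \<times> 'a \<times> 'a"
type_synonym 'a mat2 = "'a \<times> 'a \<times> 'a \<times> 'a"

definition SL2 :: "('a, 'm) ring_scheme \<Rightarrow> 'a mat2 set" where
  "SL2 R = {(\<alpha>, \<beta>, \<gamma>, \<delta>). \<alpha> \<in> carrier R \<and> \<beta> \<in> carrier R \<and> \<gamma> \<in> carrier R \<and> \<delta> \<in> carrier R \<and>
     \<alpha> \<otimes>\<^bsub>R\<^esub> \<delta> \<ominus>\<^bsub>R\<^esub> \<beta> \<otimes>\<^bsub>R\<^esub> \<gamma> = \<one>\<^bsub>R\<^esub>}"

text \<open>Coefficients of \<open>q (\<alpha> x + \<beta> y, \<gamma> x + \<delta> y)\<close>. Over a general ring a form is not determined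
  by its values, so the change of variables is carried out on the coefficients.\<close>

fun form_subst :: "('a, 'm) ring_scheme \<Rightarrow> 'a form \<Rightarrow> 'a mat2 \<Rightarrow> 'a form" where
  "form_subst R (a, b, c) (\<alpha>, \<beta>, \<gamma>, \<delta>) =
    (a \<otimes>\<^bsub>R\<^esub> (\<alpha> \<otimes>\<^bsub>R\<^esub> \<alpha>) \<oplus>\<^bsub>R\<^esub> b \<otimes>\<^bsub>R\<^esub> (\<alpha> \<otimes>\<^bsub>R\<^esub> \<gamma>) \<oplus>\<^bsub>R\<^esub> c \<otimes>\<^bsub>R\<^esub> (\<gamma> \<otimes>\<^bsub>R\<^esub> \<gamma>),
     [(2::int)] \<cdot>\<^bsub>R\<^esub> (a \<otimes>\<^bsub>R\<^esub> (\<alpha> \<otimes>\<^bsub>R\<^esub> \<beta>)) \<oplus>\<^bsub>R\<^esub> b \<otimes>\<^bsub>R\<^esub> (\<alpha> \<otimes>\<^bsub>R\<^esub> \<delta> \<oplus>\<^bsub>R\<^esub> \<beta> \<otimes>\<^bsub>R\<^esub> \<gamma>)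
       \<oplus>\<^bsub>R\<^esub> [(2::int)] \<cdot>\<^bsub>R\<^esub> (c \<otimes>\<^bsub>R\<^esub> (\<gamma> \<otimes>\<^bsub>R\<^esub> \<delta>)),
     a \<otimes>\<^bsub>R\<^esub> (\<beta> \<otimes>\<^bsub>R\<^esub> \<beta>) \<oplus>\<^bsub>R\<^esub> b \<otimes>\<^bsub>R\<^esub> (\<beta> \<otimes>\<^bsub>R\<^esub> \<delta>) \<oplus>\<^bsub>R\<^esub> c \<otimes>\<^bsub>R\<^esub> (\<delta> \<otimes>\<^bsub>R\<^esub> \<delta>))"

definition properly_isomorphic :: "('a, 'm) ring_scheme \<Rightarrow> 'a form \<Rightarrow> 'a form \<Rightarrow> bool" where
  "properly_isomorphic R q q' \<longleftrightarrow> (\<exists>A\<in>SL2 R. form_subst R q A = q')"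

fun base_change :: "('a, 'm) ring_scheme \<Rightarrow> int form \<Rightarrow> 'a form" where
  "base_change R (a, b, c) = ([a] \<cdot>\<^bsub>R\<^esub> \<one>\<^bsub>R\<^esub>, [b] \<cdot>\<^bsub>R\<^esub> \<one>\<^bsub>R\<^esub>, [c] \<cdot>\<^bsub>R\<^esub> \<one>\<^bsub>R\<^esub>)"


section \<open>Integral forms of given discriminant modulo \<open>SL\<^sub>2\<close>\<close>

fun form_eval :: "int form \<Rightarrow> int \<Rightarrow> int \<Rightarrow> int" where
  "form_eval (a, b, c) x y = a * x\<^sup>2 + b * x * y + c * y\<^sup>2"

fun disc :: "int form \<Rightarrow> int" where
  "disc (a, b, c) = b\<^sup>2 - 4 * a * c"

definition proper_equiv :: "(int form \<times> int form) set" where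
  "proper_equiv = {(q, q'). properly_isomorphic \<Z> q q'}"

text \<open>Proper equivalence preserves the discriminant, so the classes below are whole
  \<open>SL\<^sub>2(\<int>)\<close>-orbits of forms of discriminant \<open>n\<close>.\<close>

definition cl_plus :: "int \<Rightarrow> int form set set" where
  "cl_plus n = {q. disc q = n} // proper_equiv"


section \<open>Flat coverings of the spectrum of the integers\<close>

text \<open>Polynomials in the variables \<open>x\<^sub>i\<close>, \<open>i < n\<close>, with integer coefficients: a monomial is its
  finitely supported exponent function.\<close>

type_synonym int_mpoly = "(nat \<Rightarrow>\<^sub>0 nat) \<Rightarrow>\<^sub>0 int"

definition int_mpoly_ring :: "nat \<Rightarrow> int_mpoly ring" where
  "int_mpoly_ring n =
    \<lparr>carrier = {p. \<forall>m\<in>Poly_Mapping.keys p. Poly_Mapping.keys m \<subseteq> {..<n}}, mult = (*), one = 1, zero = 0, add = (+)\<rparr>"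

definition finitely_presented :: "('a, 'm) ring_scheme \<Rightarrow> bool" where
  "finitely_presented R \<longleftrightarrow> cring R \<and>
    (\<exists>n F. finite F \<and> F \<subseteq> carrier (int_mpoly_ring n) \<and>
       (int_mpoly_ring n Quot (Idl\<^bsub>int_mpoly_ring n\<^esub> F)) \<simeq> R)"

text \<open>Flatness over \<open>\<int>\<close>, by the equational criterion: every linear relation
  \<open>\<Sum>\<^sub>i n\<^sub>i r\<^sub>i = 0\<close> with \<open>n\<^sub>i \<in> \<int>\<close> and \<open>r\<^sub>i \<in> R\<close> is a consequence of relations in \<open>\<int>\<close>.\<close>

definition flat :: "('a, 'm) ring_scheme \<Rightarrow> bool" where
  "flat R \<longleftrightarrow>
    (\<forall>k (n :: nat \<Rightarrow> int) r.
       (\<forall>i<k. r i \<in> carrier R) \<and> (\<Oplus>\<^bsub>R\<^esub>i\<in>{..<k}. [n i] \<cdot>\<^bsub>R\<^esub> r i) = \<zero>\<^bsub>R\<^esub> \<longrightarrow>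
       (\<exists>l (m :: nat \<Rightarrow> nat \<Rightarrow> int) s.
          (\<forall>j<l. s j \<in> carrier R) \<and>
          (\<forall>i<k. r i = (\<Oplus>\<^bsub>R\<^esub>j\<in>{..<l}. [m i j] \<cdot>\<^bsub>R\<^esub> s j)) \<and>
          (\<forall>j<l. (\<Sum>i<k. n i * m i j) = 0)))"

text \<open>An fppf covering of \<open>Spec \<int>\<close> by finitely many affine schemes: the rings in \<open>U\<close> are flat and
  finitely presented over \<open>\<int>\<close>, and their spectra are jointly surjective onto \<open>Spec \<int>\<close>.\<close>

definition fppf_cover :: "'a ring set \<Rightarrow> bool" where
  "fppf_cover U \<longleftrightarrow> finite U \<and> (\<forall>R\<in>U. finitely_presented R \<and> flat R) \<and>
    (\<forall>P. primeideal P \<Z> \<longrightarrow>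
      (\<exists>R\<in>U. \<exists>Q. primeideal Q R \<and> {n::int. [n] \<cdot>\<^bsub>R\<^esub> \<one>\<^bsub>R\<^esub> \<in> Q} = P))"

text \<open>Since \<open>Spec \<int>\<close> is quasi-compact, every fppf covering is refined by a finite affine one. The
  carrier type \<open>int_mpoly set\<close> is no restriction, as it contains every quotient of
  \<open>int_mpoly_ring n\<close>.\<close>

definition locally_properly_isomorphic :: "int form \<Rightarrow> int form \<Rightarrow> bool" where
  "locally_properly_isomorphic q q' \<longleftrightarrow>
    (\<exists>U :: int_mpoly set ring set. fppf_cover U \<and>
      (\<forall>R\<in>U. properly_isomorphic R (base_change R q) (base_change R q')))"


section \<open>The quadratic field and its norm form\<close>

definition quad_field :: "int \<Rightarrow> complex set" where
  "quad_field d = {of_rat a + of_rat b * csqrt (of_int d) | a b. True}"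

definition ring_of_integers :: "int \<Rightarrow> complex set" where
  "ring_of_integers d = {z \<in> quad_field d. algebraic_int z}"

definition omega :: "int \<Rightarrow> complex" where
  "omega d = (if d mod 4 = 1 then (1 + csqrt (of_int d)) / 2 else csqrt (of_int d))"

text \<open>The norm of \<open>z\<close> is the determinant of multiplication by \<open>z\<close> in the \<open>\<rat>\<close>-basis
  \<open>1, \<surd>d\<close> of the field.\<close>

definition field_norm :: "int \<Rightarrow> complex \<Rightarrow> rat" where
  "field_norm d z = (THE r. \<exists>a b a' b'.
     z = of_rat a + of_rat b * csqrt (of_int d) \<and>
     z * csqrt (of_int d) = of_rat a' + of_rat b' * csqrt (of_int d) \<and>
     r = a * b' - b * a')"

definition norm_form :: "int \<Rightarrow> int form" where
  "norm_form d = (THE q. \<forall>x y.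
     of_int (form_eval q x y) = field_norm d (of_int x + of_int y * omega d))"

text \<open>The first flat cohomology set of \<open>\<int>\<close> with coefficients in \<open>O\<^sub>d\<^sup>+\<close>, as the set of twisted
  forms: integral forms that are fppf-locally properly isomorphic to the norm form, modulo
  \<open>SL\<^sub>2(\<int>)\<close>. A flat ring \<open>R\<close> embeds in \<open>R \<otimes> \<rat>\<close>, so the \<open>R\<close>-points of the schematic
  closure \<open>O\<^sub>d\<^sup>+\<close> are exactly the isometries of the norm form over \<open>R\<close> of determinant 1; this is
  why the local isomorphisms are taken in \<open>SL\<^sub>2(R)\<close>.\<close>

definition H1_fl_O_plus :: "int \<Rightarrow> int form set set" where
  "H1_fl_O_plus d = {q. locally_properly_isomorphic q (norm_form d)} // proper_equiv"


section \<open>The narrow ideal class group\<close>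

definition fractional_ideals :: "int \<Rightarrow> complex set set" where
  "fractional_ideals d = {I. I \<subseteq> quad_field d \<and> 0 \<in> I \<and> I \<noteq> {0} \<and>
     (\<forall>x\<in>I. \<forall>y\<in>I. x + y \<in> I) \<and> (\<forall>r\<in>ring_of_integers d. \<forall>x\<in>I. r * x \<in> I) \<and>
     (\<exists>m\<in>ring_of_integers d. m \<noteq> 0 \<and> (\<forall>x\<in>I. m * x \<in> ring_of_integers d))}"

definition ideal_mult :: "complex set \<Rightarrow> complex set \<Rightarrow> complex set" where
  "ideal_mult I J = {\<Sum>i<n. f i * g i | (n::nat) f g. \<forall>i<n. f i \<in> I \<and> g i \<in> J}"

definition ideal_group :: "int \<Rightarrow> complex set monoid" where
  "ideal_group d =
    \<lparr>carrier = fractional_ideals d, mult = ideal_mult, one = ring_of_integers d\<rparr>"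

definition real_embedding :: "int \<Rightarrow> (complex \<Rightarrow> real) \<Rightarrow> bool" where
  "real_embedding d \<sigma> \<longleftrightarrow> \<sigma> 1 = 1 \<and>
     (\<forall>x\<in>quad_field d. \<forall>y\<in>quad_field d. \<sigma> (x + y) = \<sigma> x + \<sigma> y \<and> \<sigma> (x * y) = \<sigma> x * \<sigma> y)"

definition totally_positive :: "int \<Rightarrow> complex \<Rightarrow> bool" where
  "totally_positive d z \<longleftrightarrow> (\<forall>\<sigma>. real_embedding d \<sigma> \<longrightarrow> \<sigma> z > 0)"

definition narrow_principal_ideals :: "int \<Rightarrow> complex set set" where
  "narrow_principal_ideals d =
    {(\<lambda>x. z * x) ` ring_of_integers d | z. z \<in> quad_field d \<and> z \<noteq> 0 \<and> totally_positive d z}"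

definition narrow_class_group :: "int \<Rightarrow> complex set set monoid" where
  "narrow_class_group d = ideal_group d Mod narrow_principal_ideals d"


definition mu :: "int \<Rightarrow> nat" where
  "mu d = (if d < 0 then 1 else 0)"

end

theory Submission
  imports Defs "HOL-Algebra.Ring_Divisibility"
begin

text \<open>Write \<open>\<Delta>\<close> for the discriminant of the norm form \<open>q\<^sub>d = (1, t, n)\<close>, where \<open>t\<close> and \<open>n\<close> are the
  trace and the norm of \<open>\<omega>\<close>.

  The equality says that an integral form \<open>q\<close> has discriminant \<open>\<Delta>\<close> if and only if it becomes
  properly isomorphic to \<open>q\<^sub>d\<close> over some fppf covering of \<open>Spec \<int>\<close>. A change of variables of
  determinant 1 preserves the discriminant, and a ring of a covering with a prime lying over
  \<open>(0)\<close> contains \<open>\<int>\<close>; this gives one direction (\<open>disc_eq_if_locally_properly_isomorphic\<close>).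
  Conversely, a form \<open>q = (a, b, c)\<close> of discriminant \<open>\<Delta>\<close> is primitive because \<open>\<Delta>\<close> is fundamental
  (\<open>disc_D_primitive\<close>), so its values \<open>m = a, c, a + b + c\<close> have no common prime factor. In the
  ring \<open>\<int>[X]/(m X\<^sup>2 - 1)\<close> the value \<open>m\<close> acquires an inverse that is a square, hence \<open>q\<close>
  represents 1 there. A vector with value 1 extends to a basis of determinant 1 in which the form
  is \<open>(1, b', c')\<close> with \<open>b' = b\<close>, and a shear turns \<open>b'\<close> into \<open>t\<close>; equality of discriminants
  then forces \<open>c' = n\<close> (\<open>form_properly_isomorphic_monic\<close>). These rings are flat by Gauss's lemma,
  and \<open>Spec (\<int>[X]/(m X\<^sup>2 - 1))\<close> covers \<open>(0)\<close>, if \<open>m \<noteq> 0\<close>, and all primes not dividing \<open>m\<close>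
  (\<open>fppf_cover_inv_sqrt_rings\<close>).

  The bijection is the correspondence between forms and ideals, organised around
  \<open>\<theta> = 2 \<omega> - t\<close>, a square root of \<open>\<Delta>\<close>. Multiplication by \<open>\<theta>\<close> on the \<open>\<int>\<close>-span of
  \<open>\<alpha>, \<beta>\<close> has trace 0, so its matrix is the matrix of a form, namely of \<open>(a, b, c)\<close> with
  \<open>\<theta> \<alpha> = b \<alpha> - 2 a \<beta>\<close> and \<open>\<theta> \<beta> = 2 c \<alpha> - b \<beta>\<close>; up to sign this form is the norm
  of \<open>x \<alpha> + y \<beta>\<close> divided by the norm of the ideal. Fixing the sign of \<open>a Nr(\<alpha>)\<close> orients the
  basis. For \<open>d < 0\<close> this sign is that of \<open>a\<close>, so negative definite forms are reached only with
  \<open>-\<theta>\<close> in place of \<open>\<theta>\<close>; this is the sign \<open>\<epsilon>\<close>, and the origin of the factor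
  \<open>{\<plusminus>1}\<^sup>\<mu>\<close>. Every form of discriminant \<open>\<Delta>\<close> arises from some ideal
  (\<open>form_has_adapted_basis\<close>), every ideal yields a form for each admissible \<open>\<epsilon>\<close>
  (\<open>fractional_ideal_has_adapted_basis\<close>), and two forms are properly equivalent if and only if
  their signs agree and their ideals differ by an element of positive norm
  (\<open>proper_equiv_iff_narrow_class_eq\<close>). Elements of positive norm generate the same principal
  ideals as totally positive elements (\<open>narrow_principal_ideals_eq\<close>), so the latter relation is
  equality in the narrow class group.\<close>

section \<open>Homomorphisms and flatness\<close>

lemma disc_subst_identity:
  fixes a b c \<alpha> \<beta> \<gamma> \<delta> :: "'a::comm_ring_1"
  defines "u \<equiv> a * (\<alpha> * \<alpha>) + b * (\<alpha> * \<gamma>) + c * (\<gamma> * \<gamma>)"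
    and "v \<equiv> 2 * (a * (\<alpha> * \<beta>)) + b * (\<alpha> * \<delta> + \<beta> * \<gamma>) + 2 * (c * (\<gamma> * \<delta>))"
    and "w \<equiv> a * (\<beta> * \<beta>) + b * (\<beta> * \<delta>) + c * (\<delta> * \<delta>)"
  shows "(\<alpha> * \<delta> - \<beta> * \<gamma>) * (\<alpha> * \<delta> - \<beta> * \<gamma>) * (b\<^sup>2 - 4 * a * c) = v * v - 4 * (u * w)"
  unfolding u_def v_def w_def by (simp add: power2_eq_square ring_distribs mult_ac)

text \<open>A ring homomorphism \<open>h\<close> to \<open>R\<close> from a subring \<open>C\<close> of a commutative ring that is given by a type
  class. Polynomial identities needed in \<open>R\<close> are verified in the type class, where simplification
  is effective, and transported along \<open>h\<close>.\<close>

locale subring_hom = cring R for R (structure) +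
  fixes C :: "'p::comm_ring_1 set" and h :: "'p \<Rightarrow> 'a"
  assumes C_one: "1 \<in> C"
    and C_add: "\<And>x y. x \<in> C \<Longrightarrow> y \<in> C \<Longrightarrow> x + y \<in> C"
    and C_mult: "\<And>x y. x \<in> C \<Longrightarrow> y \<in> C \<Longrightarrow> x * y \<in> C"
    and C_uminus: "\<And>x. x \<in> C \<Longrightarrow> - x \<in> C"
    and h_closed: "\<And>x. x \<in> C \<Longrightarrow> h x \<in> carrier R"
    and h_one: "h 1 = \<one>"
    and h_add: "\<And>x y. x \<in> C \<Longrightarrow> y \<in> C \<Longrightarrow> h (x + y) = h x \<oplus> h y"
    and h_mult: "\<And>x y. x \<in> C \<Longrightarrow> y \<in> C \<Longrightarrow> h (x * y) = h x \<otimes> h y"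
begin

lemma C_zero: "0 \<in> C"
  using C_add[OF C_one C_uminus[OF C_one]] by simp

lemma C_diff: "x \<in> C \<Longrightarrow> y \<in> C \<Longrightarrow> x - y \<in> C"
  using C_add[of x "- y"] C_uminus[of y] by simp

lemma C_of_nat: "of_nat n \<in> C"
  by (induction n) (auto intro: C_zero C_one C_add)

lemma C_of_int: "of_int n \<in> C"
  by (cases n) (auto intro: C_of_nat C_uminus C_diff C_one simp del: of_nat_Suc)

lemma C_numeral: "numeral n \<in> C"
  using C_of_int[of "numeral n"] by simp

lemma C_sum: "(\<And>i. i \<in> A \<Longrightarrow> f i \<in> C) \<Longrightarrow> sum f A \<in> C"
  by (induction A rule: infinite_finite_induct) (auto intro: C_zero C_add)

lemmas C_intros = C_one C_zero C_add C_mult C_uminus C_diff C_of_int C_numeral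

lemma h_zero: "h 0 = \<zero>"
proof -
  have "h 0 \<oplus> h 0 = h 0"
    using h_add[OF C_zero C_zero] by simp
  then show ?thesis
    using h_closed[OF C_zero] by (metis add.r_cancel_one')
qed

lemma h_uminus: "x \<in> C \<Longrightarrow> h (- x) = \<ominus> h x"
  using h_add[of "- x" x] h_zero h_closed C_uminus by (simp add: minus_equality)

lemma h_diff: "x \<in> C \<Longrightarrow> y \<in> C \<Longrightarrow> h (x - y) = h x \<ominus> h y"
  using h_add[of x "- y"] h_uminus[of y] C_uminus by (simp add: minus_eq)

lemma h_of_nat_mult: "x \<in> C \<Longrightarrow> h (of_nat n * x) = [n] \<cdot> h x"
proof (induction n)
  case 0
  then show ?case by (simp add: h_zero)
next
  case (Suc n)
  then show ?case
    using h_closed by (simp add: distrib_right h_add C_mult C_of_nat a_comm)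
qed

lemma h_of_int_mult: "x \<in> C \<Longrightarrow> h (of_int n * x) = [n] \<cdot> h x"
proof (cases "n \<ge> 0")
  case True
  assume "x \<in> C"
  then show ?thesis
    using True h_of_nat_mult[of x "nat n"] by (simp add: add_pow_int_ge)
next
  case False
  assume x: "x \<in> C"
  have "of_int n * x = - (of_nat (nat (- n)) * x)"
    using False by simp
  also have "h \<dots> = \<ominus> h (of_nat (nat (- n)) * x)"
    by (intro h_uminus C_mult C_of_nat x)
  also have "\<dots> = \<ominus> ([nat (- n)] \<cdot> h x)"
    by (simp only: h_of_nat_mult[OF x])
  finally show ?thesis
    using False by (simp add: add_pow_int_lt)
qed

lemma h_of_int: "h (of_int n) = [n] \<cdot> \<one>"
  using h_of_int_mult[OF C_one, of n] by (simp add: h_one)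

lemma h_sum: "(\<And>i. i \<in> A \<Longrightarrow> f i \<in> C) \<Longrightarrow> h (sum f A) = (\<Oplus>i\<in>A. h (f i))"
proof (induction A rule: infinite_finite_induct)
  case (insert x F)
  then have "h (sum f (insert x F)) = h (f x) \<oplus> (\<Oplus>i\<in>F. h (f i))"
    by (simp add: h_add C_sum)
  then show ?case
    using insert by (simp add: Pi_def h_closed)
qed (auto simp: h_zero)

lemma base_change_hom: "base_change R (a, b, c) = (h (of_int a), h (of_int b), h (of_int c))"
  by (simp add: h_of_int)

lemma form_subst_hom:
  assumes "a \<in> C" "b \<in> C" "c \<in> C" "\<alpha> \<in> C" "\<beta> \<in> C" "\<gamma> \<in> C" "\<delta> \<in> C"
  shows "form_subst R (h a, h b, h c) (h \<alpha>, h \<beta>, h \<gamma>, h \<delta>) =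
    (h (a * (\<alpha> * \<alpha>) + b * (\<alpha> * \<gamma>) + c * (\<gamma> * \<gamma>)),
     h (2 * (a * (\<alpha> * \<beta>)) + b * (\<alpha> * \<delta> + \<beta> * \<gamma>) + 2 * (c * (\<gamma> * \<delta>))),
     h (a * (\<beta> * \<beta>) + b * (\<beta> * \<delta>) + c * (\<delta> * \<delta>)))"
proof -
  have "[(2::int)] \<cdot> (h x \<otimes> (h y \<otimes> h z)) = h (2 * (x * (y * z)))"
    if "x \<in> C" "y \<in> C" "z \<in> C" for x y z
    using h_of_int_mult[of "x * (y * z)" 2] that by (simp add: h_mult C_mult)
  then show ?thesis
    using assms by (simp only: form_subst.simps prod.inject h_add h_mult C_intros)
qed

lemma SL2_hom:
  assumes "\<alpha> \<in> C" "\<beta> \<in> C" "\<gamma> \<in> C" "\<delta> \<in> C"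
  shows "(h \<alpha>, h \<beta>, h \<gamma>, h \<delta>) \<in> SL2 R \<longleftrightarrow> h (\<alpha> * \<delta> - \<beta> * \<gamma>) = \<one>"
  using assms by (simp add: SL2_def h_closed h_diff h_mult C_intros)

lemma disc_properly_isomorphic:
  assumes surj: "h ` C = carrier R"
    and iso: "properly_isomorphic R (base_change R q) (base_change R q')"
  shows "[disc q] \<cdot> \<one> = [disc q'] \<cdot> \<one>"
proof -
  obtain a b c a' b' c' where q: "q = (a, b, c)" and q': "q' = (a', b', c')"
    by (metis prod_cases3)
  obtain A where A: "A \<in> SL2 R" "form_subst R (base_change R q) A = base_change R q'"
    using iso by (auto simp: properly_isomorphic_def)
  have "A \<in> carrier R \<times> carrier R \<times> carrier R \<times> carrier R"
    using A(1) by (auto simp: SL2_def)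
  then obtain \<alpha> \<beta> \<gamma> \<delta> where
    C: "\<alpha> \<in> C" "\<beta> \<in> C" "\<gamma> \<in> C" "\<delta> \<in> C" and A_eq: "A = (h \<alpha>, h \<beta>, h \<gamma>, h \<delta>)"
    unfolding surj[symmetric] by blast
  define u v w where "u = of_int a * (\<alpha> * \<alpha>) + of_int b * (\<alpha> * \<gamma>) + of_int c * (\<gamma> * \<gamma>)"
    and "v = 2 * (of_int a * (\<alpha> * \<beta>)) + of_int b * (\<alpha> * \<delta> + \<beta> * \<gamma>) + 2 * (of_int c * (\<gamma> * \<delta>))"
    and "w = of_int a * (\<beta> * \<beta>) + of_int b * (\<beta> * \<delta>) + of_int c * (\<delta> * \<delta>)"
  have uvw: "u \<in> C" "v \<in> C" "w \<in> C"
    unfolding u_def v_def w_def by (intro C_intros C)+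
  have eqs: "h u = h (of_int a')" "h v = h (of_int b')" "h w = h (of_int c')"
    using A(2) form_subst_hom[OF C_of_int C_of_int C_of_int C, of a b c]
    by (simp_all add: q q' A_eq base_change_hom u_def v_def w_def del: form_subst.simps base_change.simps)
  have det: "h (\<alpha> * \<delta> - \<beta> * \<gamma>) = \<one>"
    using A(1) SL2_hom[OF C] by (simp add: A_eq)
  have "[disc q] \<cdot> \<one> = h (of_int (disc q))"
    by (simp only: h_of_int)
  also have "\<dots> = h ((\<alpha> * \<delta> - \<beta> * \<gamma>) * (\<alpha> * \<delta> - \<beta> * \<gamma>) * of_int (disc q))"
    using det C h_closed C_of_int by (simp add: h_mult C_intros)
  also have "(\<alpha> * \<delta> - \<beta> * \<gamma>) * (\<alpha> * \<delta> - \<beta> * \<gamma>) * of_int (disc q) = v * v - 4 * (u * w)"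
    unfolding q disc.simps u_def v_def w_def of_int_diff of_int_mult of_int_power of_int_numeral
    by (rule disc_subst_identity)
  also have "h (v * v - 4 * (u * w)) = h (of_int b' * of_int b' - 4 * (of_int a' * of_int c'))"
    using uvw eqs by (simp add: h_diff h_mult C_intros)
  also have "of_int b' * of_int b' - 4 * (of_int a' * of_int c') = (of_int (disc q') :: 'p)"
    by (simp add: q' power2_eq_square)
  also have "h (of_int (disc q')) = [disc q'] \<cdot> \<one>"
    by (simp only: h_of_int)
  finally show ?thesis .
qed

end

text \<open>Bezout's identity for finitely many integers, without naming their greatest common divisor.\<close>

lemma int_bezout_family:
  fixes n :: "nat \<Rightarrow> int"
  shows "\<exists>u. \<forall>i<k. (\<Sum>j<k. u j * n j) dvd n i"
proof (induction k)
  case 0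
  then show ?case by simp
next
  case (Suc k)
  then obtain u where u: "\<And>i. i < k \<Longrightarrow> (\<Sum>j<k. u j * n j) dvd n i" by blast
  define g where "g = (\<Sum>j<k. u j * n j)"
  obtain x y where xy: "x * g + y * n k = gcd g (n k)"
    using bezout_int by blast
  define u' where "u' = (\<lambda>j. if j < k then x * u j else y)"
  have "(\<Sum>j<Suc k. u' j * n j) = x * g + y * n k"
    by (simp add: u'_def g_def sum_distrib_left mult.assoc)
  then have eq: "(\<Sum>j<Suc k. u' j * n j) = gcd g (n k)"
    by (simp only: xy)
  have "gcd g (n k) dvd n i" if "i < Suc k" for i
    using that u[of i] by (cases "i = k") (auto simp: g_def[symmetric] intro: dvd_trans)
  then show ?case unfolding eq[symmetric] by blast
qed

context subring_hom
begin

text \<open>Over \<open>\<int>\<close> torsion-free rings are flat. Let \<open>\<Sum>\<^sub>i n\<^sub>i r\<^sub>i = 0\<close>, let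
  \<open>g = \<Sum>\<^sub>i u\<^sub>i n\<^sub>i\<close> be the greatest common divisor of the coefficients and \<open>n\<^sub>i = g n'\<^sub>i\<close>. If
  \<open>g \<noteq> 0\<close>, then \<open>\<Sum>\<^sub>j n'\<^sub>j r\<^sub>j = 0\<close>, so that \<open>r\<^sub>i = \<Sum>\<^sub>j (\<delta>\<^sub>i\<^sub>j - u\<^sub>i n'\<^sub>j) r\<^sub>j\<close>, and the
  coefficients of this expression satisfy the relation that the equational criterion asks for.\<close>

lemma flatI:
  assumes surj: "h ` C = carrier R"
    and torsion_free: "\<And>k x. k \<noteq> 0 \<Longrightarrow> x \<in> C \<Longrightarrow> h (of_int k * x) = \<zero> \<Longrightarrow> h x = \<zero>"
  shows "flat R"
  unfolding flat_def
proof (intro allI impI, elim conjE)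
  fix k :: nat and n :: "nat \<Rightarrow> int" and r
  assume r: "\<forall>i<k. r i \<in> carrier R" and rel: "(\<Oplus>i\<in>{..<k}. [n i] \<cdot> r i) = \<zero>"
  have "\<forall>i<k. \<exists>x. x \<in> C \<and> r i = h x"
    using r unfolding surj[symmetric] by blast
  then obtain f where f: "\<And>i. i < k \<Longrightarrow> f i \<in> C \<and> r i = h (f i)"
    by metis
  obtain u where u: "\<And>i. i < k \<Longrightarrow> (\<Sum>j<k. u j * n j) dvd n i"
    using int_bezout_family[of k n] by blast
  define g where "g = (\<Sum>j<k. u j * n j)"
  define n' where "n' i = n i div g" for i
  have n: "n i = g * n' i" if "i < k" for i
    using u[OF that] by (simp add: n'_def g_def)
  \<comment> \<open>If \<open>g = 0\<close>, all coefficients vanish and the identity matrix serves.\<close>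
  define m where "m i j = (if i = j then 1 else 0) - (if g = 0 then 0 else u i * n' j)" for i j
  have "(\<Sum>i<k. n i * m i j) = 0" if j: "j < k" for j
  proof -
    have "(\<Sum>i<k. n i * m i j) = n j - (if g = 0 then 0 else n' j * (\<Sum>i<k. u i * n i))"
      using j by (simp add: m_def right_diff_distrib sum_subtractf if_distrib[of "\<lambda>x. _ * x"]
          sum_distrib_left algebra_simps cong: if_cong)
    then show ?thesis using n[OF j] by (simp add: g_def[symmetric])
  qed
  moreover have "r i = (\<Oplus>j\<in>{..<k}. [m i j] \<cdot> r j)" if i: "i < k" for i
  proof -
    have mem: "of_int (n' j) * f j \<in> C" if "j < k" for j
      using f[OF that] by (intro C_intros) auto
    have 0: "h (\<Sum>j<k. of_int (n' j) * f j) = \<zero>" if g: "g \<noteq> 0"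
    proof (rule torsion_free[OF g])
      have "\<zero> = (\<Oplus>i\<in>{..<k}. h (of_int (n i) * f i))"
        unfolding rel[symmetric] using f
        by (intro finsum_cong') (auto simp: h_of_int_mult h_closed)
      also have "\<dots> = h (\<Sum>j<k. of_int (n j) * f j)"
        using f by (intro h_sum[symmetric] C_intros) auto
      also have "(\<Sum>j<k. of_int (n j) * f j) = of_int g * (\<Sum>j<k. of_int (n' j) * f j)"
        by (simp add: sum_distrib_left n mult.assoc)
      finally show "h (of_int g * (\<Sum>j<k. of_int (n' j) * f j)) = \<zero>" ..
    qed (use mem in \<open>auto intro: C_sum\<close>)
    have "(\<Oplus>j\<in>{..<k}. [m i j] \<cdot> r j) = (\<Oplus>j\<in>{..<k}. h (of_int (m i j) * f j))"
      using f by (intro finsum_cong') (auto simp: h_of_int_mult h_closed)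
    also have "\<dots> = h (\<Sum>j<k. of_int (m i j) * f j)"
      using f by (intro h_sum[symmetric] C_intros) auto
    also have "(\<Sum>j<k. of_int (m i j) * f j) =
        f i - (if g = 0 then 0 else of_int (u i) * (\<Sum>j<k. of_int (n' j) * f j))"
      using i by (auto simp: m_def left_diff_distrib sum_subtractf if_distrib[of of_int]
          if_distrib[of "\<lambda>x. x * _"] sum_distrib_left mult.assoc cong: if_cong)
    also have "h \<dots> = h (f i)"
    proof (cases "g = 0")
      case False
      define S where "S = (\<Sum>j<k. of_int (n' j) * f j)"
      have S: "S \<in> C" "h S = \<zero>"
        using mem 0[OF False] by (auto simp: S_def intro: C_sum)
      have "h (of_int (u i) * S) = \<zero>"
        using S h_mult[OF C_of_int S(1)] h_closed[OF C_of_int] by simp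
      then have "h (f i - of_int (u i) * S) = h (f i)"
        using f[OF i] S h_closed by (simp add: h_diff C_mult C_of_int minus_eq)
      then show ?thesis
        using False by (simp add: S_def)
    qed simp
    finally show ?thesis using f[OF i] by simp
  qed
  ultimately have witness: "(\<forall>j<k. r j \<in> carrier R) \<and>
      (\<forall>i<k. r i = (\<Oplus>j\<in>{..<k}. [m i j] \<cdot> r j)) \<and> (\<forall>j<k. (\<Sum>i<k. n i * m i j) = 0)"
    using r by blast
  show "\<exists>l (m :: nat \<Rightarrow> nat \<Rightarrow> int) s. (\<forall>j<l. s j \<in> carrier R) \<and>
      (\<forall>i<k. r i = (\<Oplus>j\<in>{..<l}. [m i j] \<cdot> s j)) \<and> (\<forall>j<l. (\<Sum>i<k. n i * m i j) = 0)"
    by (rule exI[where x = k], rule exI[where x = m], rule exI[where x = r], rule witness)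
qed

end

lemma (in cring) ideal_subset_primeideal:
  assumes "ideal I R" "\<one> \<notin> I"
  shows "\<exists>Q. primeideal Q R \<and> I \<subseteq> Q"
proof -
  let ?A = "{J. ideal J R \<and> \<one> \<notin> J \<and> I \<subseteq> J}"
  have "\<exists>M\<in>?A. \<forall>X\<in>?A. M \<subseteq> X \<longrightarrow> X = M"
  proof (rule subset_Zorn_nonempty)
    fix K assume K: "K \<noteq> {}" "subset.chain ?A K"
    then have "subset.chain {J. ideal J R} K"
      by (auto simp: subset.chain_def)
    then have "ideal (\<Union>K) R"
      using chain_Union_is_ideal[of K] K(1) by simp
    then show "\<Union>K \<in> ?A"
      using K by (auto simp: subset.chain_def)
  qed (use assms in blast)
  then obtain M where M: "ideal M R" "\<one> \<notin> M" "I \<subseteq> M"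
    and max: "\<And>X. ideal X R \<Longrightarrow> \<one> \<notin> X \<Longrightarrow> I \<subseteq> X \<Longrightarrow> M \<subseteq> X \<Longrightarrow> X = M" by auto
  have "maximalideal M R"
  proof (rule maximalidealI)
    fix J assume J: "ideal J R" "M \<subseteq> J" "J \<subseteq> carrier R"
    then show "J = M \<or> J = carrier R"
      using max[of J] M ideal.one_imp_carrier[OF J(1)] by blast
  qed (use M in auto)
  then show ?thesis using M(3) maximalideal_prime by blast
qed

section \<open>The rings \<open>\<int>[X]/(m X\<^sup>2 - 1)\<close>\<close>

text \<open>A univariate integral polynomial, read as a polynomial in the variable \<open>x\<^sub>0\<close>. This identifies the
  ring \<^typ>\<open>int poly\<close> with \<^term>\<open>int_mpoly_ring 1\<close>.\<close>

definition mpoly_of_poly :: "int poly \<Rightarrow> int_mpoly" where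
  "mpoly_of_poly F = (\<Sum>i\<le>degree F. Poly_Mapping.single (Poly_Mapping.single 0 i) (Polynomial.coeff F i))"

lemma mpoly_of_poly_altdef:
  assumes "degree F \<le> n"
  shows "mpoly_of_poly F = (\<Sum>i\<le>n. Poly_Mapping.single (Poly_Mapping.single 0 i) (Polynomial.coeff F i))"
  unfolding mpoly_of_poly_def
  by (rule sum.mono_neutral_left) (use assms in \<open>auto simp: coeff_eq_0\<close>)

lemma lookup_of_int_poly:
  "Poly_Mapping.lookup (mpoly_of_poly F) (Poly_Mapping.single 0 i) = Polynomial.coeff F i"
proof -
  have inj: "Poly_Mapping.single 0 j = (Poly_Mapping.single 0 i :: nat \<Rightarrow>\<^sub>0 nat) \<longleftrightarrow> j = i" for j
    by (metis lookup_single_eq)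
  have "Poly_Mapping.lookup (mpoly_of_poly F) (Poly_Mapping.single 0 i) =
      (\<Sum>j\<le>degree F. if j = i then Polynomial.coeff F j else 0)"
    by (simp add: mpoly_of_poly_def lookup_sum lookup_single inj when_def)
  then show ?thesis
    by (auto simp: coeff_eq_0)
qed

lemma mpoly_of_poly_eq_iff: "mpoly_of_poly F = mpoly_of_poly G \<longleftrightarrow> F = G"
  using lookup_of_int_poly by (metis poly_eqI)

lemma mpoly_of_poly_0 [simp]: "mpoly_of_poly 0 = 0"
  by (simp add: mpoly_of_poly_def)

lemma mpoly_of_poly_1 [simp]: "mpoly_of_poly 1 = 1"
  by (simp add: mpoly_of_poly_def single_one)

lemma mpoly_of_poly_add: "mpoly_of_poly (F + G) = mpoly_of_poly F + mpoly_of_poly G"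
proof -
  define n where "n = max (degree F) (degree G)"
  have "degree F \<le> n" "degree G \<le> n" "degree (F + G) \<le> n"
    by (auto simp: n_def intro: degree_add_le)
  then show ?thesis
    by (simp add: mpoly_of_poly_altdef[of _ n] single_add sum.distrib)
qed

lemma mpoly_of_poly_smult:
  "mpoly_of_poly (Polynomial.smult c F) = Poly_Mapping.single 0 c * mpoly_of_poly F"
  by (simp add: mpoly_of_poly_altdef[of _ "degree F"] degree_smult_le sum_distrib_left mult_single)

lemma mpoly_of_poly_pCons:
  "mpoly_of_poly (pCons c F) = Poly_Mapping.single 0 c +
    Poly_Mapping.single (Poly_Mapping.single 0 1) 1 * mpoly_of_poly F"
proof -
  have "degree (pCons c F) \<le> Suc (degree F)"
    by (simp add: degree_pCons_le)
  then have "mpoly_of_poly (pCons c F) = Poly_Mapping.single 0 c +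
      (\<Sum>i\<le>degree F. Poly_Mapping.single (Poly_Mapping.single 0 (Suc i)) (Polynomial.coeff F i))"
    by (simp add: mpoly_of_poly_altdef sum.atMost_Suc_shift del: sum.atMost_Suc)
  then show ?thesis
    by (simp add: mpoly_of_poly_def sum_distrib_left mult_single flip: single_add)
qed

lemma mpoly_of_poly_mult: "mpoly_of_poly (F * G) = mpoly_of_poly F * mpoly_of_poly G"
proof (induction F)
  case (pCons c F)
  then show ?case
    by (simp add: mpoly_of_poly_add mpoly_of_poly_smult mpoly_of_poly_pCons distrib_right mult.assoc)
qed simp

lemma mpoly_of_poly_sum: "mpoly_of_poly (sum f A) = (\<Sum>i\<in>A. mpoly_of_poly (f i))"
  by (induction A rule: infinite_finite_induct) (auto simp: mpoly_of_poly_add)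

lemma mpoly_of_poly_monom:
  "mpoly_of_poly (Polynomial.monom c n) = Poly_Mapping.single (Poly_Mapping.single 0 n) c"
proof -
  have "mpoly_of_poly (Polynomial.monom c n) =
      (\<Sum>i\<le>n. if i = n then Poly_Mapping.single (Poly_Mapping.single 0 n) c else 0)"
    by (subst mpoly_of_poly_altdef[OF degree_monom_le]) (rule sum.cong; auto)
  then show ?thesis by simp
qed

lemma carrier_int_mpoly_ring_1: "carrier (int_mpoly_ring 1) = range mpoly_of_poly"
proof
  show "range mpoly_of_poly \<subseteq> carrier (int_mpoly_ring 1)"
  proof (intro subsetI)
    fix f assume "f \<in> range mpoly_of_poly"
    then obtain F where f: "f = mpoly_of_poly F" by blast
    have "Poly_Mapping.keys f \<subseteq> (\<Union>i\<le>degree F. {Poly_Mapping.single 0 i})"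
      unfolding f mpoly_of_poly_def
      by (rule order.trans[OF keys_sum]) (auto split: if_splits)
    then show "f \<in> carrier (int_mpoly_ring 1)"
      by (auto simp: int_mpoly_ring_def split: if_splits)
  qed
  show "carrier (int_mpoly_ring 1) \<subseteq> range mpoly_of_poly"
  proof
    fix f :: int_mpoly assume "f \<in> carrier (int_mpoly_ring 1)"
    then have "Poly_Mapping.keys m \<subseteq> {0}" if "m \<in> Poly_Mapping.keys f" for m
      using that by (fastforce simp: int_mpoly_ring_def)
    then have m: "Poly_Mapping.single 0 (Poly_Mapping.lookup m 0) = m"
      if "m \<in> Poly_Mapping.keys f" for m
      using that by (intro poly_mapping_eqI)
        (metis lookup_not_eq_zero_eq_in_keys lookup_single_eq lookup_single_not_eq singletonD subsetD)
    have "f = (\<Sum>m\<in>Poly_Mapping.keys f. Poly_Mapping.single m (Poly_Mapping.lookup f m))"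
    proof (rule poly_mapping_eqI)
      fix k
      show "Poly_Mapping.lookup f k =
        Poly_Mapping.lookup (\<Sum>m\<in>Poly_Mapping.keys f. Poly_Mapping.single m (Poly_Mapping.lookup f m)) k"
        by (simp add: lookup_sum lookup_single when_def sum.delta' in_keys_iff)
    qed
    also have "\<dots> = mpoly_of_poly (\<Sum>m\<in>Poly_Mapping.keys f.
        Polynomial.monom (Poly_Mapping.lookup f m) (Poly_Mapping.lookup m 0))"
      unfolding mpoly_of_poly_sum mpoly_of_poly_monom by (intro sum.cong) (simp_all add: m)
    finally show "f \<in> range mpoly_of_poly" by blast
  qed
qed

lemma mpoly_of_poly_in_carrier [simp]: "mpoly_of_poly F \<in> carrier (int_mpoly_ring (Suc 0))"
  using carrier_int_mpoly_ring_1 by auto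

lemma int_mpoly_ring_simps:
  "mult (int_mpoly_ring n) = (*)" "add (int_mpoly_ring n) = (+)"
  "one (int_mpoly_ring n) = 1" "zero (int_mpoly_ring n) = 0"
  by (simp_all add: int_mpoly_ring_def)

lemma carrier_int_mpoly_ring_closed:
  fixes p q :: int_mpoly
  assumes "p \<in> carrier (int_mpoly_ring n)" "q \<in> carrier (int_mpoly_ring n)"
  shows "p + q \<in> carrier (int_mpoly_ring n)" "p * q \<in> carrier (int_mpoly_ring n)"
    "- p \<in> carrier (int_mpoly_ring n)"
proof -
  have pq: "Poly_Mapping.keys m \<subseteq> {..<n}"
    if "m \<in> Poly_Mapping.keys p \<union> Poly_Mapping.keys q" for m
    using assms that by (auto simp: int_mpoly_ring_def)
  show "p + q \<in> carrier (int_mpoly_ring n)"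
    using pq Poly_Mapping.keys_add[of p q] by (fastforce simp: int_mpoly_ring_def)
  have "Poly_Mapping.keys (a + b) \<subseteq> {..<n}"
    if "a \<in> Poly_Mapping.keys p" "b \<in> Poly_Mapping.keys q" for a b
    using pq[of a] pq[of b] that Poly_Mapping.keys_add[of a b] by blast
  then show "p * q \<in> carrier (int_mpoly_ring n)"
    using keys_mult[of p q] by (fastforce simp: int_mpoly_ring_def)
  show "- p \<in> carrier (int_mpoly_ring n)"
    using pq by (auto simp: int_mpoly_ring_def)
qed

lemma one_in_carrier_int_mpoly_ring: "1 \<in> carrier (int_mpoly_ring n)"
  by (simp add: int_mpoly_ring_def flip: single_one)

lemma cring_int_mpoly_ring: "cring (int_mpoly_ring n)"
proof (rule cringI)
  have zero: "0 \<in> carrier (int_mpoly_ring n)"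
    by (simp add: int_mpoly_ring_def)
  show "abelian_group (int_mpoly_ring n)"
  proof (rule abelian_groupI)
    fix x assume x: "x \<in> carrier (int_mpoly_ring n)"
    show "\<exists>y\<in>carrier (int_mpoly_ring n).
        y \<oplus>\<^bsub>int_mpoly_ring n\<^esub> x = \<zero>\<^bsub>int_mpoly_ring n\<^esub>"
      by (rule bexI[of _ "- x"])
        (use x in \<open>auto simp: int_mpoly_ring_simps carrier_int_mpoly_ring_closed\<close>)
  qed (auto simp: int_mpoly_ring_simps carrier_int_mpoly_ring_closed zero)
  show "Group.comm_monoid (int_mpoly_ring n)"
    by (rule comm_monoidI)
      (use zero in \<open>auto simp: int_mpoly_ring_simps mult.assoc mult.commute
        intro: carrier_int_mpoly_ring_closed one_in_carrier_int_mpoly_ring\<close>)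
qed (auto simp: int_mpoly_ring_simps distrib_right)

text \<open>The ring \<open>\<int>[X]/(m X\<^sup>2 - 1)\<close> obtained by adjoining an inverse square root of \<open>m\<close>, and the
  projection of \<open>\<int>[X]\<close> onto it. For \<open>m = 0\<close> it is the zero ring.\<close>

definition inv_sqrt_ring :: "int \<Rightarrow> int_mpoly set ring" where
  "inv_sqrt_ring m = int_mpoly_ring 1 Quot (Idl\<^bsub>int_mpoly_ring 1\<^esub> {mpoly_of_poly [:-1, 0, m:]})"

definition inv_sqrt_hom :: "int \<Rightarrow> int poly \<Rightarrow> int_mpoly set" where
  "inv_sqrt_hom m F = (Idl\<^bsub>int_mpoly_ring 1\<^esub> {mpoly_of_poly [:-1, 0, m:]}) +>\<^bsub>int_mpoly_ring 1\<^esub> mpoly_of_poly F"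

lemma ideal_inv_sqrt_ring:
  "ideal (Idl\<^bsub>int_mpoly_ring 1\<^esub> {mpoly_of_poly [:-1, 0, m:]}) (int_mpoly_ring 1)"
  by (intro ring.genideal_ideal cring.axioms(1) cring_int_mpoly_ring)
    simp

lemma finitely_presented_inv_sqrt_ring: "finitely_presented (inv_sqrt_ring m)"
  unfolding finitely_presented_def
proof (intro conjI exI)
  show "cring (inv_sqrt_ring m)"
    unfolding inv_sqrt_ring_def
    by (rule ideal.quotient_is_cring[OF ideal_inv_sqrt_ring cring_int_mpoly_ring])
  show "(int_mpoly_ring 1 Quot (Idl\<^bsub>int_mpoly_ring 1\<^esub> {mpoly_of_poly [:-1, 0, m:]})) \<simeq> inv_sqrt_ring m"
    unfolding inv_sqrt_ring_def is_ring_iso_def using ring_iso_set_refl by blast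
qed auto

text \<open>A finite presentation of \<open>R\<close> exhibits \<open>R\<close> as the image of a subring of a type-class ring.\<close>

lemma finitely_presented_imp_subring_hom:
  assumes "finitely_presented R"
  obtains C and h :: "int_mpoly \<Rightarrow> 'a" where "subring_hom R C h" "h ` C = carrier R"
proof -
  obtain n F \<phi> where F: "F \<subseteq> carrier (int_mpoly_ring n)" and R: "cring R"
    and \<phi>: "\<phi> \<in> ring_iso (int_mpoly_ring n Quot (Idl\<^bsub>int_mpoly_ring n\<^esub> F)) R"
    using assms by (auto simp: finitely_presented_def is_ring_iso_def)
  define I where "I = Idl\<^bsub>int_mpoly_ring n\<^esub> F"
  interpret cring "int_mpoly_ring n" by (rule cring_int_mpoly_ring)
  interpret I: ideal I "int_mpoly_ring n"
    unfolding I_def by (rule genideal_ideal[OF F])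
  have hom: "(+>\<^bsub>int_mpoly_ring n\<^esub>) I \<in> ring_hom (int_mpoly_ring n) (int_mpoly_ring n Quot I)"
    by (rule I.rcos_ring_hom)
  have \<phi>': "\<phi> \<in> ring_hom (int_mpoly_ring n Quot I) R"
    and bij: "bij_betw \<phi> (carrier (int_mpoly_ring n Quot I)) (carrier R)"
    using \<phi> by (auto simp: ring_iso_def I_def)
  define h where "h = \<phi> \<circ> (+>\<^bsub>int_mpoly_ring n\<^esub>) I"
  have h: "h \<in> ring_hom (int_mpoly_ring n) R"
    unfolding h_def by (rule ring_hom_trans[OF hom \<phi>'])
  have img: "(+>\<^bsub>int_mpoly_ring n\<^esub>) I ` carrier (int_mpoly_ring n) = carrier (int_mpoly_ring n Quot I)"
    by (auto simp: FactRing_def A_RCOSETS_def RCOSETS_def a_r_coset_def)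
  show thesis
  proof
    show "subring_hom R (carrier (int_mpoly_ring n)) h"
      using R ring_hom_memE[OF h] carrier_int_mpoly_ring_closed one_in_carrier_int_mpoly_ring
      by (intro subring_hom.intro subring_hom_axioms.intro) (auto simp: int_mpoly_ring_simps)
    show "h ` carrier (int_mpoly_ring n) = carrier R"
      unfolding h_def image_comp[symmetric] img using bij by (simp add: bij_betw_def)
  qed
qed

lemma inv_sqrt_hom_surj: "range (inv_sqrt_hom m) = carrier (inv_sqrt_ring m)"
  unfolding inv_sqrt_ring_def inv_sqrt_hom_def
  by (auto simp: FactRing_def A_RCOSETS_def RCOSETS_def a_r_coset_def
      carrier_int_mpoly_ring_1[unfolded One_nat_def])

lemma subring_hom_inv_sqrt: "subring_hom (inv_sqrt_ring m) UNIV (inv_sqrt_hom m)"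
proof -
  have R: "cring (inv_sqrt_ring m)"
    using finitely_presented_inv_sqrt_ring by (auto simp: finitely_presented_def)
  have T: "mpoly_of_poly F \<in> carrier (int_mpoly_ring 1)" for F
    by simp
  note hom = ring_hom_memE[OF ideal.rcos_ring_hom[OF ideal_inv_sqrt_ring[of m]]]
  show ?thesis
    using R hom(1)[OF T] hom(2,3)[OF T T] hom(4)
    by (intro subring_hom.intro subring_hom_axioms.intro)
      (auto simp: inv_sqrt_hom_def inv_sqrt_ring_def mpoly_of_poly_add mpoly_of_poly_mult
        int_mpoly_ring_simps)
qed

lemma inv_sqrt_hom_eq_zero_iff: "inv_sqrt_hom m F = \<zero>\<^bsub>inv_sqrt_ring m\<^esub> \<longleftrightarrow> [:-1, 0, m:] dvd F"
proof -
  interpret cring "int_mpoly_ring 1" by (rule cring_int_mpoly_ring)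
  have T: "mpoly_of_poly F \<in> carrier (int_mpoly_ring 1)" for F
    by simp
  define I where "I = Idl\<^bsub>int_mpoly_ring 1\<^esub> {mpoly_of_poly [:-1, 0, m:]}"
  interpret I: ideal I "int_mpoly_ring 1" unfolding I_def by (rule ideal_inv_sqrt_ring)
  have "inv_sqrt_hom m F = I +>\<^bsub>int_mpoly_ring 1\<^esub> mpoly_of_poly F" "\<zero>\<^bsub>inv_sqrt_ring m\<^esub> = I"
    by (simp_all only: inv_sqrt_hom_def inv_sqrt_ring_def FactRing_def I_def ring.simps)
  then have "inv_sqrt_hom m F = \<zero>\<^bsub>inv_sqrt_ring m\<^esub> \<longleftrightarrow> mpoly_of_poly F \<in> I"
    using I.a_rcos_const I.a_rcos_self[OF T, of F] by metis
  also have "I = PIdl\<^bsub>int_mpoly_ring 1\<^esub> (mpoly_of_poly [:-1, 0, m:])"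
    unfolding I_def by (rule cgenideal_eq_genideal[symmetric, OF T])
  also have "mpoly_of_poly F \<in> \<dots> \<longleftrightarrow> (\<exists>G. mpoly_of_poly F = mpoly_of_poly (G * [:-1, 0, m:]))"
    by (auto simp: cgenideal_def carrier_int_mpoly_ring_1[unfolded One_nat_def]
        int_mpoly_ring_simps mpoly_of_poly_mult
        simp del: mult_pCons_right)
  also have "\<dots> \<longleftrightarrow> [:-1, 0, m:] dvd F"
    by (auto simp: mpoly_of_poly_eq_iff dvd_def mult.commute)
  finally show ?thesis .
qed

section \<open>Forms of equal discriminant over a flat covering\<close>

lemma primeideal_int_cases:
  assumes "primeideal P \<Z>"
  shows "P = {0} \<or> (\<exists>p. Factorial_Ring.prime p \<and> P = {n. p dvd n})"
proof -
  interpret primeideal P \<Z> by fact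
  have add: "a + b \<in> P" if "a \<in> P" "b \<in> P" for a b
    using a_closed[of a b] that by simp
  have mult: "a * b \<in> P" if "a \<in> P" for a b
    using I_r_closed[of a b] that by simp
  have one: "1 \<notin> P"
    using one_imp_carrier I_notcarr by auto
  have "\<exists>p. Factorial_Ring.prime p \<and> p \<in> P" if "n \<in> P" "n \<noteq> 0" for n
    using that
  proof (induction n rule: prime_divisors_induct)
    case (unit x)
    then obtain y where "x * y = 1" by (metis dvdE)
    then show ?case using mult[OF unit(2), of y] one by simp
  next
    case (factor p x)
    then have "p \<in> P \<or> x \<in> P" using I_prime[of p x] by simp
    then show ?case using factor by auto
  qed simp
  moreover have "P = {n. p dvd n}" if p: "Factorial_Ring.prime p" "p \<in> P" for p
  proof
    show "{n. p dvd n} \<subseteq> P" using mult[OF p(2)] by (auto elim!: dvdE)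
    show "P \<subseteq> {n. p dvd n}"
    proof (rule ccontr)
      assume "\<not> P \<subseteq> {n. p dvd n}"
      then obtain n where n: "n \<in> P" "\<not> p dvd n" by blast
      then have "Rings.coprime p n" using p(1) prime_imp_coprime by blast
      then obtain u v where "u * p + v * n = 1"
        using bezout_int[of p n] by auto
      then show False
        using add[OF mult[OF p(2), of u] mult[OF n(1), of v]] one by (simp add: mult.commute)
    qed
  qed
  moreover have "0 \<in> P" using additive_subgroup.zero_closed[OF additive_subgroup_axioms] by simp
  ultimately show ?thesis by blast
qed

context subring_hom
begin

text \<open>If \<open>m = q(x, y)\<close> has the inverse \<open>Z\<^sup>2\<close> in \<open>R\<close>, then \<open>v = (x Z, y Z)\<close> has value 1 under
  \<open>q = (a, b, c)\<close>. The vector \<open>v' = (- c y Z, (a x + b y) Z)\<close> completes it to a matrix of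
  determinant 1 that transforms \<open>q\<close> into \<open>(1, b, a c)\<close>. Replacing \<open>v'\<close> by \<open>v' + k v\<close> changes
  the middle coefficient to \<open>b + 2 k\<close>, and \<open>t\<close> is of this form because it has the parity of \<open>b\<close>.\<close>

lemma form_properly_isomorphic_monic:
  assumes Z: "Z \<in> C" "h (of_int (form_eval (a, b, c) x y) * (Z * Z)) = \<one>"
    and disc: "disc (a, b, c) = disc (1, t, n)"
  shows "properly_isomorphic R (base_change R (a, b, c)) (base_change R (1, t, n))"
proof -
  define m where "m = form_eval (a, b, c) x y"
  have "even (t - b)"
  proof -
    have "b\<^sup>2 - t\<^sup>2 = 2 * (2 * (a * c - n))" using disc by (simp add: algebra_simps)
    then have "even (b\<^sup>2 - t\<^sup>2)" by simp
    then show ?thesis by simp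
  qed
  then obtain k where k: "t = b + 2 * k" by (metis dvdE diff_eq_eq add.commute)
  have n: "n = a * c + k * b + k * k"
    using disc by (simp add: k power2_eq_square algebra_simps)
  define \<alpha> \<beta> \<gamma> \<delta> where "\<alpha> = of_int x * Z" and "\<beta> = of_int (k * x - c * y) * Z"
    and "\<gamma> = of_int y * Z" and "\<delta> = of_int (a * x + b * y + k * y) * Z"
  have C: "\<alpha> \<in> C" "\<beta> \<in> C" "\<gamma> \<in> C" "\<delta> \<in> C"
    unfolding \<alpha>_def \<beta>_def \<gamma>_def \<delta>_def by (intro C_intros Z)+
  \<comment> \<open>The determinant and the new coefficients below are integral multiples of \<open>m Z\<^sup>2 = 1\<close>.\<close>
  have scale: "h (of_int l * (of_int m * (Z * Z))) = h (of_int l)" for l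
    using h_mult[OF C_of_int[of l] C_mult[OF C_of_int[of m] C_mult[OF Z(1) Z(1)]]]
      Z(2) h_closed[OF C_of_int] by (simp add: m_def)
  have det: "\<alpha> * \<delta> - \<beta> * \<gamma> = of_int 1 * (of_int m * (Z * Z))"
    by (simp add: \<alpha>_def \<beta>_def \<gamma>_def \<delta>_def m_def power2_eq_square algebra_simps)
  have u: "of_int a * (\<alpha> * \<alpha>) + of_int b * (\<alpha> * \<gamma>) + of_int c * (\<gamma> * \<gamma>) =
      of_int 1 * (of_int m * (Z * Z))"
    by (simp add: \<alpha>_def \<gamma>_def m_def power2_eq_square algebra_simps)
  have v: "2 * (of_int a * (\<alpha> * \<beta>)) + of_int b * (\<alpha> * \<delta> + \<beta> * \<gamma>) + 2 * (of_int c * (\<gamma> * \<delta>)) =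
      of_int t * (of_int m * (Z * Z))"
    by (simp add: \<alpha>_def \<beta>_def \<gamma>_def \<delta>_def m_def k power2_eq_square algebra_simps)
  have w: "of_int a * (\<beta> * \<beta>) + of_int b * (\<beta> * \<delta>) + of_int c * (\<delta> * \<delta>) =
      of_int n * (of_int m * (Z * Z))"
    by (simp add: \<beta>_def \<delta>_def m_def n power2_eq_square algebra_simps)
  have "(h \<alpha>, h \<beta>, h \<gamma>, h \<delta>) \<in> SL2 R"
    unfolding SL2_hom[OF C] det scale by (simp add: h_one)
  moreover have "form_subst R (base_change R (a, b, c)) (h \<alpha>, h \<beta>, h \<gamma>, h \<delta>) = base_change R (1, t, n)"
    unfolding base_change_hom form_subst_hom[OF C_of_int C_of_int C_of_int C] u v w scale ..
  ultimately show ?thesis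
    unfolding properly_isomorphic_def by blast
qed

lemma primeideal_of_hom:
  fixes e :: "'p \<Rightarrow> 'k::idom"
  assumes UNIV: "C = UNIV" and surj: "range h = carrier R"
    and e: "e 1 = 1" "\<And>x y. e (x + y) = e x + e y" "\<And>x y. e (x * y) = e x * e y"
    and ker: "\<And>x. h x = \<zero> \<Longrightarrow> e x = 0"
  shows "primeideal (h ` {x. e x = 0}) R" "h x \<in> h ` {x. e x = 0} \<longleftrightarrow> e x = 0"
proof -
  have e0: "e 0 = 0" using e(2)[of 0 0] by (metis add.right_neutral add_left_cancel)
  have em: "e (- x) = - e x" for x using e(2)[of "- x" x] e0 by (simp add: eq_neg_iff_add_eq_0)
  have mem: "h x \<in> h ` {x. e x = 0} \<longleftrightarrow> e x = 0" for x
  proof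
    assume "h x \<in> h ` {x. e x = 0}"
    then obtain y where y: "h x = h y" "e y = 0" by blast
    have "h (x - y) = \<zero>"
      using y(1) by (simp add: h_diff UNIV h_closed)
    then have "e (x + - y) = 0" using ker by simp
    then show "e x = 0" using y(2) unfolding e(2) em by simp
  qed auto
  show "h x \<in> h ` {x. e x = 0} \<longleftrightarrow> e x = 0" by (rule mem)
  have all: "(\<forall>r\<in>carrier R. \<phi> r) \<longleftrightarrow> (\<forall>x. \<phi> (h x))" for \<phi>
    unfolding surj[symmetric] by blast
  show "primeideal (h ` {x. e x = 0}) R"
  proof (rule primeidealI)
    show "ideal (h ` {x. e x = 0}) R"
    proof (rule idealI)
      show "subgroup (h ` {x. e x = 0}) (add_monoid R)"
      proof (rule subgroup.intro)
        show "h ` {x. e x = 0} \<subseteq> carrier (add_monoid R)"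
          using surj by auto
        fix r s assume "r \<in> h ` {x. e x = 0}" "s \<in> h ` {x. e x = 0}"
        then obtain x y where xy: "r = h x" "s = h y" "e x = 0" "e y = 0" by blast
        have "e (x + y) = 0" "e (- x) = 0" using xy e(2) em by auto
        then show "r \<otimes>\<^bsub>add_monoid R\<^esub> s \<in> h ` {x. e x = 0}" "inv\<^bsub>add_monoid R\<^esub> r \<in> h ` {x. e x = 0}"
          using mem[of "x + y"] mem[of "- x"] xy(1,2) h_add[of x y] h_uminus[of x]
          by (simp_all add: UNIV a_inv_def)
      next
        show "\<one>\<^bsub>add_monoid R\<^esub> \<in> h ` {x. e x = 0}"
          using mem[of 0] e0 h_zero by simp
      qed
      fix r s assume r: "r \<in> h ` {x. e x = 0}" and s: "s \<in> carrier R"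
      then obtain x y where xy: "r = h x" "e x = 0" "s = h y" unfolding surj[symmetric] by blast
      show "s \<otimes> r \<in> h ` {x. e x = 0}" "r \<otimes> s \<in> h ` {x. e x = 0}"
        using mem[of "x * y"] mem[of "y * x"] xy e(3) h_mult[of x y] h_mult[of y x] by (simp_all add: UNIV)
    qed (rule ring_axioms)
    show "cring R" by (rule is_cring)
    have "h 1 \<notin> h ` {x. e x = 0}" using mem[of 1] e(1) by simp
    then show "carrier R \<noteq> h ` {x. e x = 0}" using h_closed[of 1] UNIV by auto
    fix r s assume "r \<in> carrier R" "s \<in> carrier R" and rs: "r \<otimes> s \<in> h ` {x. e x = 0}"
    then obtain x y where "r = h x" "s = h y" unfolding surj[symmetric] by blast
    then show "r \<in> h ` {x. e x = 0} \<or> s \<in> h ` {x. e x = 0}"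
      using rs mem[of "x * y"] mem[of x] mem[of y] e(3)[of x y] h_mult[of x y] by (simp add: UNIV)
  qed
qed

text \<open>If \<open>p\<close> is not a unit of \<open>R\<close>, it lies in a prime ideal by Zorn's lemma, and this ideal meets \<open>\<int>\<close>
  exactly in the multiples of \<open>p\<close>.\<close>

lemma primeideal_over_prime:
  assumes UNIV: "C = UNIV" and surj: "range h = carrier R" and p: "Factorial_Ring.prime (p::int)"
    and nonunit: "\<And>x. h (of_int p * x) \<noteq> \<one>"
  shows "\<exists>Q. primeideal Q R \<and> {n::int. [n] \<cdot> \<one> \<in> Q} = {n. p dvd n}"
proof -
  have P: "h (of_int p) \<in> carrier R" using h_closed UNIV by simp
  have "\<one> \<notin> PIdl (h (of_int p))"
  proof
    assume "\<one> \<in> PIdl (h (of_int p))"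
    then obtain r where "\<one> = r \<otimes> h (of_int p)" "r \<in> carrier R"
      by (auto simp: cgenideal_def)
    then obtain x where "\<one> = h x \<otimes> h (of_int p)" unfolding surj[symmetric] by blast
    then have "h (of_int p * x) = \<one>"
      using h_mult[of x "of_int p"] by (simp add: UNIV mult.commute)
    then show False using nonunit by blast
  qed
  then obtain Q where Q: "primeideal Q R" "PIdl (h (of_int p)) \<subseteq> Q"
    using ideal_subset_primeideal[OF cgenideal_ideal[OF P]] by blast
  interpret Q: primeideal Q R by fact
  have one: "\<one> \<notin> Q" using Q.one_imp_carrier Q.I_notcarr by blast
  have pQ: "h (of_int (p * l)) \<in> Q" for l
    using Q(2) cgenideal_self[OF P] Q.I_r_closed[of "h (of_int p)" "h (of_int l)"]
      h_mult[of "of_int p" "of_int l"] h_closed[of "of_int l"] by (auto simp: UNIV)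
  have "p dvd n" if n: "h (of_int n) \<in> Q" for n
  proof (rule ccontr)
    assume "\<not> p dvd n"
    then have "Rings.coprime p n" using p prime_imp_coprime by blast
    then obtain u v where uv: "u * p + v * n = 1"
      using bezout_int[of p n] by auto
    have "h (of_int (v * n)) \<in> Q"
      using Q.I_l_closed[OF n, of "h (of_int v)"] h_mult[of "of_int v" "of_int n"]
        h_closed[of "of_int v"] by (simp add: UNIV)
    then have "h (of_int (u * p + v * n)) \<in> Q"
      using Q.a_closed[OF pQ[of u], of "h (of_int (v * n))"]
        h_add[of "of_int (p * u)" "of_int (v * n)"]
      by (simp add: UNIV mult.commute)
    then show False using one by (simp add: uv h_one)
  qed
  then have "{n::int. [n] \<cdot> \<one> \<in> Q} = {n. p dvd n}"
    using pQ by (auto simp: h_of_int[symmetric] elim!: dvdE)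
  then show ?thesis using Q(1) by blast
qed

end

lemma poly_of_int_add:
  "poly (map_poly of_int (F + G)) w = poly (map_poly of_int F) w + poly (map_poly of_int G) (w :: 'a::comm_ring_1)"
  by (induction F G rule: poly_induct2) (simp_all add: map_poly_pCons algebra_simps)

lemma poly_of_int_smult:
  "poly (map_poly of_int (Polynomial.smult c F)) w = of_int c * poly (map_poly of_int F) (w :: 'a::comm_ring_1)"
  by (induction F) (simp_all add: map_poly_pCons algebra_simps)

lemma poly_of_int_mult:
  "poly (map_poly of_int (F * G)) w = poly (map_poly of_int F) w * poly (map_poly of_int G) (w :: 'a::comm_ring_1)"
  by (induction F) (simp_all add: map_poly_pCons algebra_simps poly_of_int_add poly_of_int_smult)

text \<open>By Gauss's lemma \<open>\<int>[X]/(m X\<^sup>2 - 1)\<close> has no \<open>\<int>\<close>-torsion: the polynomial \<open>m X\<^sup>2 - 1\<close> is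
  primitive.\<close>

lemma inv_sqrt_poly_dvd_cancel_int:
  assumes "k \<noteq> 0" "[:-1, 0, m:] dvd of_int k * F"
  shows "[:-1, 0, m:] dvd (F :: int poly)"
proof -
  obtain G where G: "of_int k * F = [:-1, 0, m:] * G" using assms(2) by (elim dvdE)
  have "content [:-1, 0, m:] dvd Polynomial.coeff [:-1, 0, m:] 0" by (rule content_dvd_coeff)
  then have "is_unit (content [:-1, 0, m:])" by simp
  then have cont: "content [:-1, 0, m:] = 1"
    by (metis is_unit_normalize normalize_content)
  have k: "of_int k = [:k:]" by (simp add: of_int_poly)
  have "[:k:] dvd [:-1, 0, m:] * G" unfolding G[symmetric] k by (rule dvd_triv_left)
  then have "k dvd content ([:-1, 0, m:] * G)" by (simp only: const_poly_dvd_iff_dvd_content)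
  then have "[:k:] dvd G" by (simp only: content_mult cont const_poly_dvd_iff_dvd_content mult_1)
  then obtain H where "G = [:k:] * H" by (elim dvdE)
  then have "[:k:] * F = [:k:] * ([:-1, 0, m:] * H)"
    using G unfolding k by (simp only: mult.left_commute)
  then show ?thesis using assms(1) by (simp del: mult_pCons_left)
qed

lemma flat_inv_sqrt_ring: "flat (inv_sqrt_ring m)"
proof -
  interpret subring_hom "inv_sqrt_ring m" UNIV "inv_sqrt_hom m" by (rule subring_hom_inv_sqrt)
  show ?thesis
    by (rule flatI) (use inv_sqrt_hom_surj in \<open>auto simp: inv_sqrt_hom_eq_zero_iff intro: inv_sqrt_poly_dvd_cancel_int\<close>)
qed

text \<open>The kernel of the evaluation at a complex number \<open>w\<close> with \<open>m w\<^sup>2 = 1\<close> is a prime ideal that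
  lies over \<open>(0)\<close>.\<close>

lemma primeideal_inv_sqrt_ring_over_zero:
  assumes "m \<noteq> 0"
  shows "\<exists>Q. primeideal Q (inv_sqrt_ring m) \<and>
    {n::int. [n] \<cdot>\<^bsub>inv_sqrt_ring m\<^esub> \<one>\<^bsub>inv_sqrt_ring m\<^esub> \<in> Q} = {0}"
proof -
  interpret subring_hom "inv_sqrt_ring m" UNIV "inv_sqrt_hom m" by (rule subring_hom_inv_sqrt)
  define w where "w = 1 / csqrt (of_int m)"
  define e where "e F = poly (map_poly of_int F) w" for F :: "int poly"
  have w: "of_int m * w\<^sup>2 = 1" using assms by (simp add: w_def power_divide)
  have e: "e 1 = 1" "e (F + G) = e F + e G" "e (F * G) = e F * e G" for F G
    by (simp_all add: e_def poly_of_int_add poly_of_int_mult)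
  have ker: "e F = 0" if "inv_sqrt_hom m F = \<zero>\<^bsub>inv_sqrt_ring m\<^esub>" for F
  proof -
    have "e [:-1, 0, m:] = 0"
      using w by (simp add: e_def map_poly_pCons power2_eq_square algebra_simps)
    then show ?thesis using that by (auto simp: inv_sqrt_hom_eq_zero_iff e(3) elim!: dvdE simp del: mult_pCons_left)
  qed
  note Q = primeideal_of_hom[OF refl inv_sqrt_hom_surj, of e, OF e ker]
  have "e (of_int n) = of_int n" for n
    by (simp add: e_def of_int_poly map_poly_pCons)
  then show ?thesis
    using Q by (intro exI[of _ "inv_sqrt_hom m ` {F. e F = 0}"]) (simp add: h_of_int[symmetric])
qed

lemma primeideal_inv_sqrt_ring_over_prime:
  assumes p: "Factorial_Ring.prime p" "\<not> p dvd m"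
  shows "\<exists>Q. primeideal Q (inv_sqrt_ring m) \<and>
    {n::int. [n] \<cdot>\<^bsub>inv_sqrt_ring m\<^esub> \<one>\<^bsub>inv_sqrt_ring m\<^esub> \<in> Q} = {n. p dvd n}"
proof -
  interpret subring_hom "inv_sqrt_ring m" UNIV "inv_sqrt_hom m" by (rule subring_hom_inv_sqrt)
  show ?thesis
  proof (rule primeideal_over_prime[OF refl inv_sqrt_hom_surj p(1)])
    fix F :: "int poly"
    show "inv_sqrt_hom m (of_int p * F) \<noteq> \<one>\<^bsub>inv_sqrt_ring m\<^esub>"
    proof
      assume "inv_sqrt_hom m (of_int p * F) = \<one>\<^bsub>inv_sqrt_ring m\<^esub>"
      then have "inv_sqrt_hom m (of_int p * F - 1) = \<zero>\<^bsub>inv_sqrt_ring m\<^esub>"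
        by (simp add: h_diff h_one)
      then obtain G where "of_int p * F - 1 = [:-1, 0, m:] * G"
        by (auto simp: inv_sqrt_hom_eq_zero_iff elim!: dvdE)
      then have G: "Polynomial.smult p F = 1 - G + pCons 0 (pCons 0 (Polynomial.smult m G))"
        by (simp add: of_int_poly algebra_simps)
      \<comment> \<open>Modulo \<open>p\<close> the polynomial \<open>G\<close> would be the inverse \<open>\<Sum>\<^sub>k m\<^sup>k X\<^bsup>2k\<^esup>\<close> of \<open>1 - m X\<^sup>2\<close>.\<close>
      have "p dvd Polynomial.coeff G (2 * k) - m ^ k" for k
      proof (induction k)
        case 0
        have "p * Polynomial.coeff F 0 = 1 - Polynomial.coeff G 0"
          using arg_cong[OF G, of "\<lambda>H. Polynomial.coeff H 0"] by simp
        then show ?case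
          by (metis dvd_triv_left dvd_minus_iff minus_diff_eq mult_0_right power_0)
      next
        case (Suc k)
        have "p * Polynomial.coeff F (2 * Suc k) =
            m * Polynomial.coeff G (2 * k) - Polynomial.coeff G (2 * Suc k)"
          using arg_cong[OF G, of "\<lambda>H. Polynomial.coeff H (2 * Suc k)"]
          by (simp add: coeff_pCons)
        then have "Polynomial.coeff G (2 * Suc k) - m ^ Suc k =
            m * (Polynomial.coeff G (2 * k) - m ^ k) - p * Polynomial.coeff F (2 * Suc k)"
          by (simp add: algebra_simps)
        then show ?case
          using Suc by (metis dvd_diff dvd_mult dvd_triv_left)
      qed
      from this[of "Suc (Polynomial.degree G)"] have "p dvd m ^ Suc (Polynomial.degree G)"
        by (simp add: coeff_eq_0)
      then show False
        using p prime_dvd_power by blast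
    qed
  qed
qed

lemma inv_sqrt_hom_root: "inv_sqrt_hom m (of_int m * ([:0, 1:] * [:0, 1:])) = \<one>\<^bsub>inv_sqrt_ring m\<^esub>"
proof -
  interpret subring_hom "inv_sqrt_ring m" UNIV "inv_sqrt_hom m" by (rule subring_hom_inv_sqrt)
  have "inv_sqrt_hom m (of_int m * ([:0, 1:] * [:0, 1:]) - 1) = \<zero>\<^bsub>inv_sqrt_ring m\<^esub>"
    unfolding inv_sqrt_hom_eq_zero_iff by (simp add: of_int_poly one_pCons)
  then show ?thesis
    by (simp add: h_diff h_one h_closed)
qed

lemma fppf_cover_inv_sqrt_rings:
  assumes "\<And>p. Factorial_Ring.prime p \<Longrightarrow> \<exists>m\<in>M. \<not> p dvd m" and "finite M"
  shows "fppf_cover (inv_sqrt_ring ` M)"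
  unfolding fppf_cover_def
proof (intro conjI allI impI ballI)
  fix P :: "int set" assume "primeideal P \<Z>"
  then consider "P = {0}" | p where "Factorial_Ring.prime p" "P = {n. p dvd n}"
    using primeideal_int_cases by blast
  then show "\<exists>R\<in>inv_sqrt_ring ` M. \<exists>Q. primeideal Q R \<and> {n::int. [n] \<cdot>\<^bsub>R\<^esub> \<one>\<^bsub>R\<^esub> \<in> Q} = P"
  proof cases
    case 1
    obtain m where "m \<in> M" "\<not> 2 dvd m" using assms(1)[of 2] by auto
    then show ?thesis using primeideal_inv_sqrt_ring_over_zero[of m] 1 by force
  next
    case (2 p)
    then obtain m where "m \<in> M" "\<not> p dvd m" using assms(1)[of p] by auto
    then show ?thesis using primeideal_inv_sqrt_ring_over_prime[of p m] 2 by blast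
  qed
qed (use assms(2) finitely_presented_inv_sqrt_ring flat_inv_sqrt_ring in auto)

lemma locally_properly_isomorphic_if_disc_eq:
  assumes primitive: "\<And>p. Factorial_Ring.prime p \<Longrightarrow> \<not> (p dvd a \<and> p dvd b \<and> p dvd c)"
    and disc: "disc (a, b, c) = disc (1, t, n)"
  shows "locally_properly_isomorphic (a, b, c) (1, t, n)"
  unfolding locally_properly_isomorphic_def
proof (intro exI conjI ballI)
  define M where "M = {form_eval (a, b, c) 1 0, form_eval (a, b, c) 0 1, form_eval (a, b, c) 1 1}"
  have "\<exists>m\<in>M. \<not> p dvd m" if p: "Factorial_Ring.prime p" for p
  proof (rule ccontr)
    assume "\<not> (\<exists>m\<in>M. \<not> p dvd m)"
    then have "p dvd a" "p dvd c" "p dvd a + b + c" by (auto simp: M_def)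
    then show False
      using primitive[OF p] by (metis dvd_add_left_iff dvd_add_right_iff)
  qed
  then show "fppf_cover (inv_sqrt_ring ` M)"
    by (rule fppf_cover_inv_sqrt_rings) (simp_all add: M_def)
  fix R assume "R \<in> inv_sqrt_ring ` M"
  then obtain x y where R: "R = inv_sqrt_ring (form_eval (a, b, c) x y)" unfolding M_def by blast
  interpret subring_hom R UNIV "inv_sqrt_hom (form_eval (a, b, c) x y)"
    unfolding R by (rule subring_hom_inv_sqrt)
  show "properly_isomorphic R (base_change R (a, b, c)) (base_change R (1, t, n))"
    using form_properly_isomorphic_monic[of "[:0, 1:]" a b c x y] inv_sqrt_hom_root disc R by blast
qed

text \<open>Some ring of the covering has a prime lying over \<open>(0)\<close>; in it integers are determined by their
  images, so equality of the discriminants there is equality in \<open>\<int>\<close>.\<close>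

lemma disc_eq_if_locally_properly_isomorphic:
  assumes "locally_properly_isomorphic q q'"
  shows "disc q = disc q'"
proof -
  obtain U :: "int_mpoly set ring set" where U: "fppf_cover U"
    "\<And>R. R \<in> U \<Longrightarrow> properly_isomorphic R (base_change R q) (base_change R q')"
    using assms by (auto simp: locally_properly_isomorphic_def)
  have "primeideal {0} \<Z>"
    using int.zeroprimeideal by simp
  then obtain R Q where R: "R \<in> U" and Q: "primeideal Q R"
    and inj: "{n::int. [n] \<cdot>\<^bsub>R\<^esub> \<one>\<^bsub>R\<^esub> \<in> Q} = {0}"
    using U(1) unfolding fppf_cover_def by blast
  have "finitely_presented R" using U(1) R by (simp add: fppf_cover_def)
  then obtain C h where h: "subring_hom R C (h :: int_mpoly \<Rightarrow> _)" "h ` C = carrier R"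
    by (rule finitely_presented_imp_subring_hom)
  interpret subring_hom R C h by fact
  interpret Q: primeideal Q R by fact
  have "h (of_int (disc q)) = h (of_int (disc q'))"
    using disc_properly_isomorphic[OF h(2) U(2)[OF R]] by (simp only: h_of_int)
  then have "h (of_int (disc q - disc q')) = \<zero>\<^bsub>R\<^esub>"
    by (simp add: h_diff C_of_int h_closed)
  then have "[(disc q - disc q')] \<cdot>\<^bsub>R\<^esub> \<one>\<^bsub>R\<^esub> \<in> Q"
    by (simp only: h_of_int Q.zero_closed)
  then have "disc q - disc q' \<in> {n::int. [n] \<cdot>\<^bsub>R\<^esub> \<one>\<^bsub>R\<^esub> \<in> Q}"
    by (simp only: mem_Collect_eq)
  then show ?thesis unfolding inj by simp
qed

section \<open>Proper equivalence of integral forms\<close>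

lemma add_pow_int: "[(k::int)] \<cdot>\<^bsub>\<Z>\<^esub> x = k * x"
proof -
  have nat: "[(i::nat)] \<cdot>\<^bsub>\<Z>\<^esub> x = int i * x" for i x
    by (induction i) (simp_all add: add_pow_def nat_pow_def algebra_simps)
  show ?thesis
  proof (cases "k \<ge> 0")
    case False
    then show ?thesis by (simp add: add_pow_int_lt nat int_a_inv_eq)
  qed (simp add: add_pow_int_ge nat)
qed

lemma form_subst_int:
  "form_subst \<Z> (a, b, c) (x, y, z, u) =
    (a * (x * x) + b * (x * z) + c * (z * z),
     2 * (a * (x * y)) + b * (x * u + y * z) + 2 * (c * (z * u)),
     a * (y * y) + b * (y * u) + c * (u * u))"
  by (simp add: add_pow_int)

lemma SL2_int: "(x, y, z, u) \<in> SL2 \<Z> \<longleftrightarrow> x * u - y * z = 1"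
  by (simp add: SL2_def int_a_minus_eq)

lemma proper_equiv_iff:
  "(q, q') \<in> proper_equiv \<longleftrightarrow> (\<exists>x y z u. x * u - y * z = 1 \<and> form_subst \<Z> q (x, y, z, u) = q')"
  by (simp only: proper_equiv_def properly_isomorphic_def Bex_def split_paired_Ex SL2_int
      mem_Collect_eq split_conv)

lemma proper_equivI: "x * u - y * z = 1 \<Longrightarrow> form_subst \<Z> q (x, y, z, u) = q' \<Longrightarrow> (q, q') \<in> proper_equiv"
  unfolding proper_equiv_iff by blast

lemma equiv_proper_equiv: "equiv UNIV proper_equiv"
proof (rule equivI)
  show "refl proper_equiv"
  proof (rule refl_onI)
    fix q :: "int form"
    obtain a b c where "q = (a, b, c)" by (metis prod_cases3)
    then show "(q, q) \<in> proper_equiv"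
      by (intro proper_equivI[of 1 1 0 0]) (simp_all only: form_subst_int, simp_all)
  qed
  show "sym proper_equiv"
  proof (rule symI)
    fix q q' :: "int form" assume "(q, q') \<in> proper_equiv"
    then obtain x y z u where det: "x * u - y * z = 1" and q': "form_subst \<Z> q (x, y, z, u) = q'"
      unfolding proper_equiv_iff by blast
    obtain a b c where q: "q = (a, b, c)" by (metis prod_cases3)
    have "form_subst \<Z> q' (u, - y, - z, x) =
      (a * (x * u - y * z)\<^sup>2, b * (x * u - y * z)\<^sup>2, c * (x * u - y * z)\<^sup>2)"
      unfolding q'[symmetric] q form_subst_int prod.inject
      by (intro conjI; simp add: power2_eq_square algebra_simps)
    then show "(q', q) \<in> proper_equiv"
      by (intro proper_equivI[of u x "- y" "- z"]) (use det q in \<open>simp_all add: algebra_simps\<close>)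
  qed
  show "proper_equiv \<subseteq> UNIV \<times> UNIV" by simp
  show "trans proper_equiv"
  proof (rule transI)
    fix q q' q'' :: "int form" assume "(q, q') \<in> proper_equiv" "(q', q'') \<in> proper_equiv"
    then obtain x y z u x' y' z' u' where det: "x * u - y * z = 1" "x' * u' - y' * z' = 1"
      and q': "form_subst \<Z> q (x, y, z, u) = q'" "form_subst \<Z> q' (x', y', z', u') = q''"
      unfolding proper_equiv_iff by metis
    obtain a b c where q: "q = (a, b, c)" by (metis prod_cases3)
    have "(x * x' + y * z') * (z * y' + u * u') - (x * y' + y * u') * (z * x' + u * z') =
        (x * u - y * z) * (x' * u' - y' * z')" by (simp add: algebra_simps)
    then have det': "(x * x' + y * z') * (z * y' + u * u') - (x * y' + y * u') * (z * x' + u * z') = 1"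
      unfolding det by simp
    show "(q, q'') \<in> proper_equiv"
      by (rule proper_equivI[OF det'], unfold q'(2)[symmetric] q'(1)[symmetric] q form_subst_int prod.inject)
        (intro conjI; simp add: algebra_simps)
  qed
qed

section \<open>The quadratic field and its ring of integers\<close>

lemma square_mod_4: "(x * x) mod 4 \<in> {0, 1 :: int}"
proof (cases "even x")
  case True
  then show ?thesis by (auto elim!: evenE)
next
  case False
  then obtain j where "x = 2 * j + 1" by (elim oddE)
  then have "x * x = 1 + 4 * (j * j + j)" by (simp add: algebra_simps)
  then have "(x * x) mod 4 = 1 mod 4" by (simp only: mod_mult_self2)
  then show ?thesis by simp
qed

text \<open>The setting of the theorem: \<open>k = \<rat>(\<surd>d)\<close> for a square-free integer \<open>d\<close> other than 0 and 1.\<close>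

locale squarefree_radicand =
  fixes d :: int
  assumes d_not_01: "d \<notin> {0, 1}" and squarefree_d: "squarefree d"
begin

text \<open>The square root of \<open>d\<close> that is used in the definition of the field.\<close>

definition s :: complex where "s = csqrt (of_int d)"

lemma s_square: "s * s = of_int d"
  unfolding s_def by (metis power2_csqrt power2_eq_square)

lemma s_not_rat: "s \<notin> \<rat>"
proof
  assume "s \<in> \<rat>"
  moreover have "algebraic_int s"
    unfolding s_def by (intro algebraic_int_csqrt int_imp_algebraic_int) simp
  ultimately obtain k where k: "s = of_int k"
    using rational_algebraic_int_is_int by (metis Ints_cases)
  then have "(of_int d :: complex) = of_int (k * k)"
    using s_square by simp
  then have dk: "d = k * k" by (simp only: of_int_eq_iff)
  then have "k\<^sup>2 dvd d" by (simp add: power2_eq_square)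
  then have "is_unit k" using squarefree_d by (simp add: squarefree_def)
  then have "k = 1 \<or> k = -1" by auto
  then have "d = 1" using dk by auto
  then show False using d_not_01 by simp
qed

lemma coords_zero_iff: "of_rat a + of_rat b * s = 0 \<longleftrightarrow> a = 0 \<and> b = 0"
proof
  assume eq: "of_rat a + of_rat b * s = 0"
  have "b = 0"
  proof (rule ccontr)
    assume "b \<noteq> 0"
    then have "s = of_rat (- a / b)"
      using eq by (simp add: of_rat_divide of_rat_minus field_simps eq_neg_iff_add_eq_0)
    then show False using s_not_rat by (metis Rats_of_rat)
  qed
  then show "a = 0 \<and> b = 0" using eq by simp
qed simp

lemma coords_eq_iff:
  "of_rat a + of_rat b * s = of_rat a' + of_rat b' * s \<longleftrightarrow> a = a' \<and> b = b'"
  using coords_zero_iff[of "a - a'" "b - b'"]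
  by (auto simp: of_rat_diff algebra_simps)

abbreviation K :: "complex set" where "K \<equiv> quad_field d"

lemma K_def: "K = {of_rat a + of_rat b * s | a b. True}"
  by (simp add: quad_field_def s_def)

lemma K_I: "of_rat a + of_rat b * s \<in> K"
  unfolding K_def by blast

lemma K_E:
  assumes "z \<in> K"
  obtains a b where "z = of_rat a + of_rat b * s"
  using assms unfolding K_def by blast

lemma K_of_rat: "of_rat a \<in> K"
  using K_I[of a 0] by simp

lemma K_of_int: "of_int k \<in> K"
  using K_of_rat[of "of_int k"] by simp

lemma K_s: "s \<in> K"
  using K_I[of 0 1] by simp

lemma coords_mult:
  "(of_rat a + of_rat b * s) * (of_rat a' + of_rat b' * s) =
    of_rat (a * a' + of_int d * (b * b')) + of_rat (a * b' + b * a') * s"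
proof -
  have "(of_rat a + of_rat b * s) * (of_rat a' + of_rat b' * s) =
      of_rat a * of_rat a' + of_rat b * of_rat b' * (s * s) + (of_rat a * of_rat b' + of_rat b * of_rat a') * s"
    by (simp add: algebra_simps)
  then show ?thesis unfolding s_square by (simp add: of_rat_add of_rat_mult algebra_simps)
qed

lemma K_add: "x \<in> K \<Longrightarrow> y \<in> K \<Longrightarrow> x + y \<in> K"
proof (elim K_E)
  fix a b a' b' assume "x = of_rat a + of_rat b * s" "y = of_rat a' + of_rat b' * s"
  then have "x + y = of_rat (a + a') + of_rat (b + b') * s"
    by (simp add: of_rat_add algebra_simps)
  then show ?thesis using K_I by simp
qed

lemma K_mult: "x \<in> K \<Longrightarrow> y \<in> K \<Longrightarrow> x * y \<in> K"
  by (elim K_E) (simp only: coords_mult K_I)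

lemma K_uminus: "x \<in> K \<Longrightarrow> - x \<in> K"
  using K_mult[of "of_int (-1)" x] K_of_int[of "-1"] by simp

lemma K_diff: "x \<in> K \<Longrightarrow> y \<in> K \<Longrightarrow> x - y \<in> K"
  using K_add[of x "- y"] K_uminus[of y] by simp

text \<open>The norm of the quadratic field.\<close>

definition nrm :: "complex \<Rightarrow> rat" where "nrm z = field_norm d z"

lemma nrm_coords: "nrm (of_rat a + of_rat b * s) = a * a - of_int d * (b * b)"
proof -
  have uniq: "r = a * a - of_int d * (b * b)"
    if "of_rat a + of_rat b * s = of_rat a1 + of_rat b1 * s"
      "(of_rat a + of_rat b * s) * s = of_rat a' + of_rat b' * s" "r = a1 * b' - b1 * a'"
    for r a1 b1 a' b'
  proof -
    have "of_rat (of_int d * b) + of_rat a * s = of_rat a' + of_rat b' * s"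
      using that(2) coords_mult[of a b 0 1] by simp
    then show ?thesis using that(1,3) unfolding coords_eq_iff by simp
  qed
  show ?thesis
    unfolding nrm_def field_norm_def s_def[symmetric]
  proof (rule the_equality)
    show "\<exists>a1 b1 a' b'. of_rat a + of_rat b * s = of_rat a1 + of_rat b1 * s \<and>
       (of_rat a + of_rat b * s) * s = of_rat a' + of_rat b' * s \<and>
       a * a - of_int d * (b * b) = a1 * b' - b1 * a'"
      by (rule exI[of _ a], rule exI[of _ b], rule exI[of _ "of_int d * b"], rule exI[of _ a])
        (use coords_mult[of a b 0 1] in simp)
  qed (use uniq in blast)
qed

lemma nrm_mult: "x \<in> K \<Longrightarrow> y \<in> K \<Longrightarrow> nrm (x * y) = nrm x * nrm y"
  by (elim K_E) (simp only: coords_mult nrm_coords, simp add: algebra_simps)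

lemma nrm_of_rat: "nrm (of_rat a) = a * a"
  using nrm_coords[of a 0] by simp

lemma nrm_of_int: "nrm (of_int a) = of_int a * of_int a"
  using nrm_of_rat[of "of_int a"] by simp

lemma nrm_zero_iff: "z \<in> K \<Longrightarrow> nrm z = 0 \<longleftrightarrow> z = 0"
proof (elim K_E)
  fix a b assume z: "z = of_rat a + of_rat b * s"
  have "(of_rat (nrm z) :: complex) = (of_rat a + of_rat b * s) * (of_rat a + of_rat (- b) * s)"
    unfolding coords_mult z nrm_coords by (simp add: algebra_simps)
  then have "nrm z = 0 \<longleftrightarrow> (of_rat a + of_rat b * s) = 0 \<or> (of_rat a + of_rat (- b) * s) = 0"
    by (metis mult_eq_0_iff of_rat_eq_0_iff)
  then show ?thesis unfolding z coords_zero_iff by simp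
qed

lemma nrm_nonneg: "d < 0 \<Longrightarrow> z \<in> K \<Longrightarrow> nrm z \<ge> 0"
proof (elim K_E)
  fix a b assume d: "d < 0" and z: "z = of_rat a + of_rat b * s"
  have "of_int d * (b * b) \<le> 0"
    using d by (intro mult_nonpos_nonneg) auto
  then show ?thesis unfolding z nrm_coords using zero_le_square[of a] by linarith
qed

lemma K_inverse: "z \<in> K \<Longrightarrow> inverse z \<in> K"
proof (cases "z = 0")
  case False
  assume z: "z \<in> K"
  then obtain a b where ab: "z = of_rat a + of_rat b * s" by (rule K_E)
  define y where "y = of_rat (a / nrm z) + of_rat (- b / nrm z) * s"
  have nz: "nrm z \<noteq> 0" using z False nrm_zero_iff by simp
  have "a * (a / nrm z) + of_int d * (b * (- b / nrm z)) = (a * a - of_int d * (b * b)) / nrm z"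
    by (simp add: diff_divide_distrib)
  also have "\<dots> = 1" using nz unfolding ab nrm_coords by simp
  finally have "z * y = of_rat 1 + of_rat 0 * s"
    unfolding y_def by (subst (1) ab) (simp add: coords_mult coords_eq_iff)
  then have "z * y = 1" by simp
  then have "inverse z = y" by (rule inverse_unique)
  then show ?thesis using y_def K_I by metis
qed simp

lemma K_divide: "x \<in> K \<Longrightarrow> y \<in> K \<Longrightarrow> x / y \<in> K"
  unfolding divide_inverse by (intro K_mult K_inverse)

lemma d_mod_4: "d mod 4 \<in> {1, 2, 3}"
proof -
  have "\<not> 2\<^sup>2 dvd d"
    using squarefree_d by (auto simp: squarefree_def dest: spec[of _ 2])
  then have "d mod 4 \<noteq> 0" by (simp add: dvd_eq_mod_eq_0)
  moreover have "0 \<le> d mod 4" "d mod 4 < 4" by simp_all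
  ultimately show ?thesis by auto
qed

text \<open>The trace and the norm of \<open>\<omega>\<close>, the discriminant \<open>D\<close> of the field, the generator \<open>\<omega>\<close> of its
  ring of integers, and the square root \<open>\<theta>\<close> of \<open>D\<close> with \<open>\<omega> = (tr + \<theta>) / 2\<close>. In terms of
  \<open>\<theta>\<close> the cases \<open>d \<equiv> 1\<close> and \<open>d \<equiv> 2, 3\<close> modulo 4 need not be distinguished.\<close>

definition tr :: int where "tr = (if d mod 4 = 1 then 1 else 0)"
definition nm :: int where "nm = (if d mod 4 = 1 then (1 - d) div 4 else - d)"
definition D :: int where "D = tr * tr - 4 * nm"
definition \<omega> :: complex where "\<omega> = omega d"
definition \<theta> :: complex where "\<theta> = 2 * \<omega> - of_int tr"

lemma nm_eq: "d mod 4 = 1 \<Longrightarrow> 4 * nm = 1 - d"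
proof -
  assume "d mod 4 = 1"
  moreover from this have "4 dvd 1 - d" by presburger
  ultimately show ?thesis by (simp add: nm_def)
qed

lemma D_eq: "D = (if d mod 4 = 1 then d else 4 * d)"
  using nm_eq by (auto simp: D_def tr_def nm_def)

lemma theta_eq: "\<theta> = (if d mod 4 = 1 then s else 2 * s)"
  by (simp add: \<theta>_def \<omega>_def omega_def tr_def s_def field_simps)

lemma theta_square: "\<theta> * \<theta> = of_int D"
  using s_square by (simp add: theta_eq D_eq)

lemma w_eq: "\<omega> = (of_int tr + \<theta>) / 2"
  by (simp add: \<theta>_def)

lemma w_square: "\<omega> * \<omega> = of_int tr * \<omega> - of_int nm"
proof -
  have "4 * (\<omega> * \<omega>) = of_int tr * of_int tr + 2 * of_int tr * \<theta> + \<theta> * \<theta>"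
    by (simp add: w_eq algebra_simps)
  also have "\<dots> = 4 * (of_int tr * \<omega> - of_int nm)"
    unfolding theta_square by (simp add: D_def w_eq algebra_simps)
  finally show ?thesis by (simp only: mult_cancel_left) simp
qed

lemma K_theta: "\<theta> \<in> K"
  using K_mult[OF K_of_int[of 2] K_s] K_s by (simp add: theta_eq)

lemma K_w: "\<omega> \<in> K"
  using K_divide[OF K_add[OF K_of_int K_theta] K_of_int[of 2]] by (simp add: w_eq)

lemma theta_zero_iff: "of_rat a + of_rat b * \<theta> = 0 \<longleftrightarrow> a = 0 \<and> b = 0"
proof (cases "d mod 4 = 1")
  case False
  have eq: "of_rat a + of_rat b * \<theta> = of_rat a + of_rat (b * 2) * s"
    using False by (simp add: theta_eq of_rat_mult)
  show ?thesis unfolding eq coords_zero_iff by simp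
qed (simp add: theta_eq coords_zero_iff)

lemma nrm_theta: "nrm (of_rat a + of_rat b * \<theta>) = a * a - of_int D * (b * b)"
proof (cases "d mod 4 = 1")
  case False
  have eq: "of_rat a + of_rat b * \<theta> = of_rat a + of_rat (b * 2) * s"
    using False by (simp add: theta_eq of_rat_mult)
  show ?thesis unfolding eq nrm_coords using False by (simp add: D_eq)
qed (simp add: theta_eq nrm_coords D_eq)

lemma of_int_theta_zero_iff: "of_int a + of_int b * \<theta> = 0 \<longleftrightarrow> a = 0 \<and> b = 0"
  using theta_zero_iff[of "of_int a" "of_int b"] by simp

lemma of_int_w_zero_iff: "of_int a + of_int b * \<omega> = 0 \<longleftrightarrow> a = 0 \<and> b = 0"
proof -
  have "of_int a + of_int b * \<omega> = (of_int (2 * a + b * tr) + of_int b * \<theta>) / 2"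
    by (simp add: w_eq field_simps)
  then have "of_int a + of_int b * \<omega> = 0 \<longleftrightarrow> of_int (2 * a + b * tr) + of_int b * \<theta> = 0"
    by (simp only: divide_eq_0_iff) simp
  then show ?thesis unfolding of_int_theta_zero_iff by auto
qed

lemma nrm_w: "nrm (of_int x + of_int y * \<omega>) = of_int (x * x + tr * (x * y) + nm * (y * y))"
proof -
  have eq: "of_int x + of_int y * \<omega> = of_rat (of_int (2 * x + y * tr) / 2) + of_rat (of_int y / 2) * \<theta>"
    by (simp add: w_eq of_rat_divide of_rat_add of_rat_mult field_simps)
  show ?thesis unfolding eq nrm_theta by (simp add: D_def field_simps)
qed

lemma norm_form_eq: "norm_form d = (1, tr, nm)"
  unfolding norm_form_def
proof (rule the_equality)
  show "\<forall>x y. rat_of_int (form_eval (1, tr, nm) x y) = field_norm d (of_int x + of_int y * omega d)"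
    unfolding nrm_def[symmetric] \<omega>_def[symmetric] nrm_w by (simp add: power2_eq_square mult.assoc)
next
  fix q :: "int form"
  assume "\<forall>x y. rat_of_int (form_eval q x y) = field_norm d (of_int x + of_int y * omega d)"
  then have q: "form_eval q x y = x * x + tr * (x * y) + nm * (y * y)" for x y
    unfolding nrm_def[symmetric] \<omega>_def[symmetric] nrm_w of_int_eq_iff by blast
  obtain a b c where "q = (a, b, c)" by (metis prod_cases3)
  then show "q = (1, tr, nm)"
    using q[of 1 0] q[of 0 1] q[of 1 1] by simp
qed

lemma disc_norm_form: "disc (norm_form d) = D"
  by (simp add: norm_form_eq D_def power2_eq_square)

abbreviation OK :: "complex set" where "OK \<equiv> ring_of_integers d"

lemma algebraic_int_quadratic:
  assumes "z * z = of_int u * z - of_int v"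
  shows "algebraic_int (z :: complex)"
proof (rule algebraic_int.intros)
  show "poly [:of_int v, - of_int u, 1:] z = 0"
    using assms by (simp add: algebra_simps)
qed (auto simp: coeff_pCons split: nat.splits)

lemma w_integral: "of_int x + of_int y * \<omega> \<in> OK"
proof -
  let ?z = "of_int x + of_int y * \<omega>"
  have "?z * ?z = of_int x * of_int x + 2 * of_int x * of_int y * \<omega> + of_int y * of_int y * (\<omega> * \<omega>)"
    by (simp add: algebra_simps)
  also have "\<dots> = of_int (2 * x + tr * y) * ?z - of_int (x * x + tr * (x * y) + nm * (y * y))"
    unfolding w_square by (simp add: algebra_simps)
  finally have "algebraic_int ?z" by (rule algebraic_int_quadratic)
  moreover have "?z \<in> K" by (intro K_add K_mult K_of_int K_w)
  ultimately show ?thesis by (simp add: ring_of_integers_def)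
qed

text \<open>The polynomial \<open>X\<^sup>2 - 2 a X + (a\<^sup>2 - d b\<^sup>2)\<close> of the irrational element \<open>a + b \<surd>d\<close>, made
  primitive over \<open>\<int>\<close>, divides every integral polynomial that vanishes at this element, by Gauss's
  lemma. If the multiple is monic, so is the divisor up to sign, and its coefficients are integral.\<close>

lemma coords_integral_trace_norm:
  assumes "algebraic_int (of_rat a + of_rat b * s)" "b \<noteq> 0"
  shows "2 * a \<in> \<int> \<and> a * a - of_int d * (b * b) \<in> \<int>"
proof -
  define z where "z = of_rat a + of_rat b * s"
  obtain p :: "int poly" where p: "poly (map_poly of_int p) z = 0" "lead_coeff p = 1"
    using assms(1) unfolding z_def[symmetric] algebraic_int_altdef_ipoly by blast
  obtain k1 l1 where 1: "2 * a = of_int k1 / of_int l1" "l1 \<noteq> 0"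
    by (metis Fract_of_int_quotient Rat_cases less_irrefl)
  obtain k2 l2 where 2: "a * a - of_int d * (b * b) = of_int k2 / of_int l2" "l2 \<noteq> 0"
    by (metis Fract_of_int_quotient Rat_cases less_irrefl)
  define F0 where "F0 = [:k2 * l1, - k1 * l2, l1 * l2:]"
  have F0: "poly (map_poly of_int F0) z = 0"
  proof -
    have "z * z = of_rat (2 * a) * z - of_rat (a * a - of_int d * (b * b))"
    proof -
      have "z * z = of_rat a * of_rat a + 2 * of_rat a * of_rat b * s + of_rat b * of_rat b * (s * s)"
        by (simp add: z_def algebra_simps)
      then show ?thesis unfolding s_square
        by (simp add: z_def of_rat_add of_rat_diff of_rat_mult algebra_simps)
    qed
    then show ?thesis unfolding 1 2 using 1(2) 2(2)
      by (simp add: F0_def map_poly_pCons of_rat_divide field_simps)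
  qed
  have F0_nz: "F0 \<noteq> 0" using 1(2) 2(2) by (simp add: F0_def)
  define F where "F = primitive_part F0"
  have F0_eq: "F0 = Polynomial.smult (content F0) F" by (simp add: F_def)
  have cont: "content F = 1" using F0_nz by (simp add: F_def)
  have deg: "Polynomial.degree F = 2"
    using 1(2) 2(2) by (simp add: F_def F0_def)
  have Fz: "poly (map_poly of_int F) z = 0"
  proof -
    have "poly (map_poly of_int F0) z = of_int (content F0) * poly (map_poly of_int F) z"
      by (subst F0_eq) (simp add: poly_altdef coeff_map_poly degree_map_poly F0_nz sum_distrib_left mult.assoc)
    then show ?thesis using F0 F0_nz by simp
  qed
  have F_nz: "F \<noteq> 0" using deg by auto
  obtain k Q where kQ: "k \<noteq> 0" "Polynomial.smult k p = F * Q + pseudo_mod p F"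
    using pseudo_mod(1)[OF F_nz, of p] by blast
  \<comment> \<open>The remainder has degree at most 1 and vanishes at an irrational number, so it is 0.\<close>
  define R where "R = pseudo_mod p F"
  have degR: "R = 0 \<or> Polynomial.degree R < 2"
    using pseudo_mod(2)[OF F_nz, of p] deg by (simp add: R_def)
  have "poly (map_poly of_int R) z = 0"
    using arg_cong[OF kQ(2), of "\<lambda>G. poly (map_poly of_int G) z"] p(1) Fz
    by (simp add: poly_of_int_add poly_of_int_smult poly_of_int_mult R_def)
  moreover obtain r0 r1 where R: "R = [:r0, r1:]"
  proof -
    have "R = [:Polynomial.coeff R 0, Polynomial.coeff R 1:]"
      using degR by (intro poly_eqI) (auto simp: coeff_pCons coeff_eq_0 split: nat.splits)
    then show thesis using that by blast
  qed
  ultimately have "of_int r0 + of_int r1 * z = 0"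
    by (simp add: map_poly_pCons mult.commute)
  then have "of_rat (of_int r0 + of_int r1 * a) + of_rat (of_int r1 * b) * s = 0"
    by (simp add: z_def of_rat_add of_rat_mult algebra_simps)
  then have R0: "R = 0" using assms(2) unfolding coords_zero_iff R by auto
  have eq: "Polynomial.smult k p = F * Q" using kQ(2) R0 by (simp add: R_def)
  have "[:k:] dvd F * Q" unfolding eq[symmetric] by (simp add: smult_dvd_iff dvdI[of _ _ p])
  then have "[:k:] dvd Q" by (simp add: const_poly_dvd_iff_dvd_content content_mult cont)
  then obtain Q' where "Q = [:k:] * Q'" by (elim dvdE)
  then have "Polynomial.smult k p = Polynomial.smult k (F * Q')" using eq by simp
  then have "p = F * Q'" using kQ(1) by (metis smult_cancel)
  then have unit: "lead_coeff F * lead_coeff Q' = 1" using p(2) by (simp add: lead_coeff_mult)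
  define A B C where "A = Polynomial.coeff F 0" and "B = Polynomial.coeff F 1" and "C = Polynomial.coeff F 2"
  have F_eq: "F = [:A, B, C:]"
    using deg by (intro poly_eqI)
      (auto simp: A_def B_def C_def coeff_pCons coeff_eq_0 numeral_2_eq_2 split: nat.splits)
  have "is_unit C" using unit deg by (metis C_def dvd_triv_left)
  then have C: "C = 1 \<or> C = - 1" by auto
  have "of_int A + of_int B * z + of_int C * (z * z) = 0"
    using Fz by (simp add: F_eq map_poly_pCons algebra_simps)
  then have "of_rat (of_int A + of_int B * a + of_int C * (a * a + of_int d * (b * b))) +
      of_rat (of_int B * b + of_int C * (a * b + b * a)) * s = 0"
    unfolding z_def coords_mult by (simp add: of_rat_add of_rat_mult algebra_simps)
  then have AB: "of_int A + of_int B * a + of_int C * (a * a + of_int d * (b * b)) = 0"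
    "(of_int B + of_int C * (2 * a)) * b = 0"
    unfolding coords_zero_iff by (simp_all add: algebra_simps)
  from AB(2) have B: "of_int B = - (of_int C * (2 * a))" using assms(2) by (simp add: eq_neg_iff_add_eq_0)
  have "2 * a = of_int (- B * C)" using C B by auto
  moreover have "a * a - of_int d * (b * b) = of_int (A * C)"
    using C AB(1) unfolding B by (auto simp: algebra_simps)
  ultimately show ?thesis by (metis Ints_of_int)
qed

lemma rat_square_times_d_integral:
  assumes "of_int d * (r * r) \<in> \<int>"
  shows "(r :: rat) \<in> \<int>"
proof -
  obtain k where k: "of_int d * (r * r) = of_int k" using assms by (auto elim: Ints_cases)
  obtain u v where uv: "r = of_int u / of_int v" "v > 0" "Rings.coprime u v"
    by (metis Fract_of_int_quotient Rat_cases)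
  have "of_int (d * (u * u)) = (of_int (k * (v * v)) :: rat)"
    using k uv(2) by (simp add: uv(1) field_simps)
  then have "d * (u * u) = k * (v * v)" by (simp only: of_int_eq_iff)
  then have "v\<^sup>2 dvd d * u\<^sup>2" by (simp add: power2_eq_square)
  moreover have "Rings.coprime (v\<^sup>2) (u\<^sup>2)" using uv(3) by (simp add: coprime_commute)
  ultimately have "v\<^sup>2 dvd d" using coprime_dvd_mult_left_iff by blast
  then have "is_unit v" using squarefree_d by (simp add: squarefree_def)
  then have "v = 1" using uv(2) by simp
  then show ?thesis using uv(1) by simp
qed

lemma ring_of_integers_eq: "OK = {of_int x + of_int y * \<omega> | x y. True}"
proof
  show "{of_int x + of_int y * \<omega> | x y. True} \<subseteq> OK" using w_integral by blast
  show "OK \<subseteq> {of_int x + of_int y * \<omega> | x y. True}"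
  proof
    fix z assume "z \<in> OK"
    then have z: "z \<in> K" "algebraic_int z" by (simp_all add: ring_of_integers_def)
    from z(1) obtain a b where ab: "z = of_rat a + of_rat b * s" by (rule K_E)
    show "z \<in> {of_int x + of_int y * \<omega> | x y. True}"
    proof (cases "b = 0")
      case True
      then have "z \<in> \<rat>" using ab by simp
      then have "z \<in> \<int>" using z(2) rational_algebraic_int_is_int by blast
      then obtain x where "z = of_int x + of_int 0 * \<omega>" by (auto elim: Ints_cases)
      then show ?thesis by blast
    next
      case False
      then have int: "2 * a \<in> \<int>" "a * a - of_int d * (b * b) \<in> \<int>"
        using coords_integral_trace_norm z(2) ab by auto
      then obtain P M where P: "2 * a = of_int P" and M: "a * a - of_int d * (b * b) = of_int M"
        by (auto elim!: Ints_cases)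
      have "of_int d * ((2 * b) * (2 * b)) = (2 * a) * (2 * a) - 4 * of_int M"
        unfolding M[symmetric] by (simp add: algebra_simps)
      then have eq: "of_int d * ((2 * b) * (2 * b)) = of_int (P * P - 4 * M)"
        unfolding P by (simp only: of_int_diff of_int_mult of_int_numeral)
      then have "2 * b \<in> \<int>" by (metis rat_square_times_d_integral Ints_of_int)
      then obtain B where B: "2 * b = of_int B" by (auto elim: Ints_cases)
      have "of_int (d * (B * B)) = (of_int (P * P - 4 * M) :: rat)"
        using eq unfolding B by (simp only: of_int_mult)
      then have dB: "d * (B * B) = P * P - 4 * M" by (simp only: of_int_eq_iff)
      have aP: "a = of_int P / 2" "b = of_int B / 2" using P B by simp_all
      show ?thesis
      proof (cases "d mod 4 = 1")
        case True
        then have "4 dvd d - 1" by presburger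
        then obtain e where "d - 1 = 4 * e" by (elim dvdE)
        then have e: "d = 1 + 4 * e" by simp
        have "P * P = B * B + 2 * (2 * (e * (B * B) + M))" using dB e by (simp add: algebra_simps)
        then have "even (P * P) \<longleftrightarrow> even (B * B)" by simp
        then have "even (P - B)" by auto
        then obtain x where "P = B + 2 * x" by (metis dvdE diff_eq_eq add.commute)
        then have "z = of_int x + of_int B * \<omega>"
          using True by (simp add: ab aP w_eq theta_eq tr_def of_rat_divide of_rat_add of_rat_mult field_simps)
        then show ?thesis by blast
      next
        case False
        have "even B"
        proof (rule ccontr)
          assume "odd B"
          then obtain i where i: "B = 2 * i + 1" by (elim oddE)
          have "P * P = d + 4 * (d * (i * i + i) + M)" using dB unfolding i by (simp add: algebra_simps)
          then have "(P * P) mod 4 = d mod 4" by (simp only: mod_mult_self2)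
          then show False using square_mod_4[of P] d_mod_4 False by auto
        qed
        then obtain y where y: "B = 2 * y" by (elim evenE)
        have "P * P = 2 * (2 * (d * (y * y) + M))" using dB unfolding y by (simp add: algebra_simps)
        then have "even (P * P)" by simp
        then obtain x where "P = 2 * x" by auto
        then have "z = of_int x + of_int y * \<omega>"
          using False by (simp add: ab aP y w_eq theta_eq tr_def)
        then show ?thesis by blast
      qed
    qed
  qed
qed

end

section \<open>Bases adapted to a form\<close>

context squarefree_radicand
begin

text \<open>Multiplication by \<open>\<epsilon> \<theta>\<close> acts on \<open>\<alpha>, \<beta>\<close> through the integral matrix of trace 0 attached to the
  form \<open>(a, b, c)\<close>.\<close>

definition equivariant :: "int \<Rightarrow> int form \<Rightarrow> complex \<Rightarrow> complex \<Rightarrow> bool" where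
  "equivariant \<epsilon> q \<alpha> \<beta> \<longleftrightarrow> (case q of (a, b, c) \<Rightarrow>
     of_int \<epsilon> * \<theta> * \<alpha> = of_int b * \<alpha> - 2 * of_int a * \<beta> \<and>
     of_int \<epsilon> * \<theta> * \<beta> = 2 * of_int c * \<alpha> - of_int b * \<beta>)"

text \<open>A basis \<open>\<alpha>, \<beta>\<close> adapted to the form \<open>q = (a, b, c)\<close> with sign \<open>\<epsilon>\<close>. The condition on the sign
  of \<open>\<epsilon> a Nr(\<alpha>)\<close> is the orientation. With the relations it
  implies that \<open>a\<close>, \<open>\<alpha>\<close> and \<open>\<beta>\<close> are nonzero and that
  \<open>q\<close> is \<open>\<epsilon>\<close> times the norm of \<open>x \<alpha> + y \<beta>\<close> up to a positive rational factor.\<close>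

definition adapted :: "int \<Rightarrow> int form \<Rightarrow> complex \<Rightarrow> complex \<Rightarrow> bool" where
  "adapted \<epsilon> q \<alpha> \<beta> \<longleftrightarrow> \<epsilon> \<in> {1, -1} \<and> \<alpha> \<in> K \<and> \<beta> \<in> K \<and> equivariant \<epsilon> q \<alpha> \<beta> \<and>
     0 < of_int (\<epsilon> * fst q) * nrm \<alpha>"

text \<open>The \<open>\<int>\<close>-span of two complex numbers.\<close>

definition zspan :: "complex \<Rightarrow> complex \<Rightarrow> complex set" where
  "zspan \<alpha> \<beta> = {of_int x * \<alpha> + of_int y * \<beta> | x y. True}"

lemma theta_combination_zero:
  assumes "(of_int u + of_int v * \<theta>) * \<alpha> = 0" "\<alpha> \<noteq> 0"
  shows "u = 0" "v = 0"
proof -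
  have "of_int u + of_int v * \<theta> = 0" using assms by (simp only: mult_eq_0_iff simp_thms)
  then show "u = 0" "v = 0" unfolding of_int_theta_zero_iff by blast+
qed

lemma equivariant_independent:
  assumes eq: "equivariant \<epsilon> (a, b, c) \<alpha> \<beta>" and "\<epsilon> \<noteq> 0" "\<alpha> \<noteq> 0"
    and zero: "of_int x * \<alpha> + of_int y * \<beta> = 0"
  shows "x = 0 \<and> y = 0"
proof -
  have *: "2 * of_int a * \<beta> = (of_int b - of_int \<epsilon> * \<theta>) * \<alpha>"
    using eq by (simp add: equivariant_def algebra_simps)
  have "a \<noteq> 0"
  proof
    assume "a = 0"
    then have "(of_int b - of_int \<epsilon> * \<theta>) * \<alpha> = 0"
      using *[symmetric] by (simp only: of_int_0 mult_zero_right mult_zero_left)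
    then have "(of_int b + of_int (- \<epsilon>) * \<theta>) * \<alpha> = 0"
      by (simp only: of_int_minus mult_minus_left diff_conv_add_uminus)
    from theta_combination_zero(2)[OF this assms(3)] show False using assms(2) by simp
  qed
  have "0 = 2 * of_int a * (of_int x * \<alpha> + of_int y * \<beta>)"
    unfolding zero by simp
  also have "\<dots> = 2 * of_int a * of_int x * \<alpha> + of_int y * (2 * of_int a * \<beta>)"
    by (simp add: algebra_simps)
  also have "\<dots> = (of_int (2 * a * x + y * b) + of_int (- y * \<epsilon>) * \<theta>) * \<alpha>"
    unfolding * by (simp add: algebra_simps)
  finally have *: "(of_int (2 * a * x + y * b) + of_int (- y * \<epsilon>) * \<theta>) * \<alpha> = 0"
    by (rule sym)
  have "y = 0" using theta_combination_zero(2)[OF * assms(3)] assms(2) by simp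
  moreover from this have "x = 0"
    using theta_combination_zero(1)[OF * assms(3)] \<open>a \<noteq> 0\<close> by simp
  ultimately show ?thesis by simp
qed

lemma equivariant_unique:
  assumes "equivariant \<epsilon> (a, b, c) \<alpha> \<beta>" "equivariant \<epsilon> (a', b', c') \<alpha> \<beta>" "\<epsilon> \<noteq> 0" "\<alpha> \<noteq> 0"
  shows "a = a' \<and> b = b' \<and> c = c'"
proof -
  have eq: "of_int b * \<alpha> - 2 * of_int a * \<beta> = of_int b' * \<alpha> - 2 * of_int a' * \<beta>"
    "2 * of_int c * \<alpha> - of_int b * \<beta> = 2 * of_int c' * \<alpha> - of_int b' * \<beta>"
    using assms(1,2) by (simp_all add: equivariant_def)
  have "of_int (b - b') * \<alpha> + of_int (2 * (a' - a)) * \<beta> =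
      (of_int b * \<alpha> - 2 * of_int a * \<beta>) - (of_int b' * \<alpha> - 2 * of_int a' * \<beta>)"
    "of_int (2 * (c - c')) * \<alpha> + of_int (b' - b) * \<beta> =
      (2 * of_int c * \<alpha> - of_int b * \<beta>) - (2 * of_int c' * \<alpha> - of_int b' * \<beta>)"
    by (simp_all add: algebra_simps)
  then have "of_int (b - b') * \<alpha> + of_int (2 * (a' - a)) * \<beta> = 0"
    "of_int (2 * (c - c')) * \<alpha> + of_int (b' - b) * \<beta> = 0"
    unfolding eq by simp_all
  then have "b - b' = 0 \<and> 2 * (a' - a) = 0" "2 * (c - c') = 0 \<and> b' - b = 0"
    using equivariant_independent[OF assms(1,3,4)] by blast+
  then show ?thesis by simp
qed

lemma adapted_nonzero:
  assumes "adapted \<epsilon> (a, b, c) \<alpha> \<beta>"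
  shows "\<epsilon> \<noteq> 0" "a \<noteq> 0" "\<alpha> \<noteq> 0" "\<beta> \<noteq> 0"
proof -
  show e: "\<epsilon> \<noteq> 0" using assms by (auto simp: adapted_def)
  show "a \<noteq> 0" using assms by (auto simp: adapted_def)
  show a: "\<alpha> \<noteq> 0" using assms nrm_zero_iff[of \<alpha>] by (auto simp: adapted_def)
  have "equivariant \<epsilon> (a, b, c) \<alpha> \<beta>" using assms by (simp add: adapted_def)
  from equivariant_independent[OF this e a, of 0 1] show "\<beta> \<noteq> 0" by auto
qed

lemma adapted_disc:
  assumes "adapted \<epsilon> (a, b, c) \<alpha> \<beta>"
  shows "disc (a, b, c) = D"
proof -
  note nz = adapted_nonzero[OF assms]
  have e: "of_int \<epsilon> * of_int \<epsilon> = (1 :: complex)" using assms by (auto simp: adapted_def)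
  have 1: "(of_int \<epsilon> * \<theta> - of_int b) * \<alpha> = - 2 * of_int a * \<beta>"
    and 2: "(of_int \<epsilon> * \<theta> + of_int b) * \<beta> = 2 * of_int c * \<alpha>"
    using assms by (simp_all add: adapted_def equivariant_def algebra_simps)
  have "(of_int \<epsilon> * of_int \<epsilon> * (\<theta> * \<theta>) - of_int b * of_int b) * (\<alpha> * \<beta>) =
      ((of_int \<epsilon> * \<theta> - of_int b) * \<alpha>) * ((of_int \<epsilon> * \<theta> + of_int b) * \<beta>)"
    by (simp add: algebra_simps)
  also have "\<dots> = - 4 * of_int a * of_int c * (\<alpha> * \<beta>)"
    unfolding 1 2 by simp
  finally have "of_int D - of_int b * of_int b = (- 4 * of_int a * of_int c :: complex)"
    unfolding e theta_square mult_cancel_right using nz by simp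
  then have "of_int D = (of_int (b * b - 4 * a * c) :: complex)" by (simp add: algebra_simps)
  then show ?thesis by (simp only: of_int_eq_iff disc.simps power2_eq_square)
qed

lemma adapted_scale:
  assumes "adapted \<epsilon> q \<alpha> \<beta>" "z \<in> K" "nrm z > 0"
  shows "adapted \<epsilon> q (z * \<alpha>) (z * \<beta>)"
proof -
  obtain a b c where q: "q = (a, b, c)" by (metis prod_cases3)
  have eq: "of_int \<epsilon> * \<theta> * \<alpha> = of_int b * \<alpha> - 2 * of_int a * \<beta>"
    "of_int \<epsilon> * \<theta> * \<beta> = 2 * of_int c * \<alpha> - of_int b * \<beta>"
    using assms(1) by (simp_all add: adapted_def equivariant_def q)
  have "of_int \<epsilon> * \<theta> * (z * \<alpha>) = z * (of_int \<epsilon> * \<theta> * \<alpha>)"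
    "of_int \<epsilon> * \<theta> * (z * \<beta>) = z * (of_int \<epsilon> * \<theta> * \<beta>)" by simp_all
  then have "equivariant \<epsilon> q (z * \<alpha>) (z * \<beta>)"
    unfolding eq by (simp add: equivariant_def q algebra_simps)
  moreover have "0 < (of_int (\<epsilon> * a) * nrm \<alpha>) * nrm z"
    using assms by (intro mult_pos_pos[OF _ assms(3)]) (simp add: adapted_def q)
  ultimately show ?thesis
    using assms by (simp add: adapted_def q K_mult nrm_mult mult_ac)
qed

lemma zspan_scale: "zspan (z * \<alpha>) (z * \<beta>) = (\<lambda>x. z * x) ` zspan \<alpha> \<beta>"
proof -
  have "of_int x * (z * \<alpha>) + of_int y * (z * \<beta>) = z * (of_int x * \<alpha> + of_int y * \<beta>)" for x y
    by (simp add: algebra_simps)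
  then show ?thesis by (auto simp: zspan_def)
qed

text \<open>Passing to another basis of the span, by a matrix of determinant \<open>\<delta> = \<plusminus>1\<close>, replaces the form by
  \<open>\<delta>\<close> times the transformed form. The sign of \<open>a' Nr(\<alpha>')\<close> does not see \<open>\<delta>\<close>, since
  \<open>a Nr(\<alpha>') = a' Nr(\<alpha>)\<close>; hence only \<open>\<delta> = 1\<close> preserves the orientation.\<close>

lemma equivariant_base_change:
  fixes x y z u \<delta> :: int
  defines "\<delta> \<equiv> x * u - y * z"
  assumes ad: "adapted \<epsilon> (a, b, c) \<alpha> \<beta>" and det: "\<delta> = 1 \<or> \<delta> = -1"
    and sub: "form_subst \<Z> (a, b, c) (x, y, z, u) = (a', b', c')"
  defines "\<alpha>' \<equiv> of_int x * \<alpha> + of_int z * \<beta>" and "\<beta>' \<equiv> of_int y * \<alpha> + of_int u * \<beta>"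
  shows "equivariant \<epsilon> (\<delta> * a', \<delta> * b', \<delta> * c') \<alpha>' \<beta>'"
    and "0 < of_int (\<epsilon> * a') * nrm \<alpha>'"
proof -
  note nz = adapted_nonzero[OF ad]
  have eq: "of_int \<epsilon> * \<theta> * \<alpha> = of_int b * \<alpha> - 2 * of_int a * \<beta>"
    "of_int \<epsilon> * \<theta> * \<beta> = 2 * of_int c * \<alpha> - of_int b * \<beta>"
    using ad by (simp_all add: adapted_def equivariant_def)
  have s: "a' = a * (x * x) + b * (x * z) + c * (z * z)"
    "b' = 2 * (a * (x * y)) + b * (x * u + y * z) + 2 * (c * (z * u))"
    "c' = a * (y * y) + b * (y * u) + c * (u * u)"
    using sub unfolding form_subst_int by simp_all
  have dd: "\<delta> * \<delta> = 1" using det by auto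
  have l1: "of_int \<epsilon> * \<theta> * \<alpha>' = of_int (b * x + 2 * c * z) * \<alpha> + of_int (- 2 * a * x - b * z) * \<beta>"
  proof -
    have "of_int \<epsilon> * \<theta> * \<alpha>' = of_int x * (of_int \<epsilon> * \<theta> * \<alpha>) + of_int z * (of_int \<epsilon> * \<theta> * \<beta>)"
      by (simp add: \<alpha>'_def algebra_simps)
    then show ?thesis unfolding eq by (simp add: algebra_simps)
  qed
  have l2: "of_int \<epsilon> * \<theta> * \<beta>' = of_int (b * y + 2 * c * u) * \<alpha> + of_int (- 2 * a * y - b * u) * \<beta>"
  proof -
    have "of_int \<epsilon> * \<theta> * \<beta>' = of_int y * (of_int \<epsilon> * \<theta> * \<alpha>) + of_int u * (of_int \<epsilon> * \<theta> * \<beta>)"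
      by (simp add: \<beta>'_def algebra_simps)
    then show ?thesis unfolding eq by (simp add: algebra_simps)
  qed
  have r: "of_int k * \<alpha>' - of_int l * \<beta>' = of_int (k * x - l * y) * \<alpha> + of_int (k * z - l * u) * \<beta>" for k l
    by (simp add: \<alpha>'_def \<beta>'_def algebra_simps)
  have i1: "\<delta> * b' * x - 2 * (\<delta> * a') * y = \<delta> * \<delta> * (b * x + 2 * c * z)"
    and i2: "\<delta> * b' * z - 2 * (\<delta> * a') * u = \<delta> * \<delta> * (- 2 * a * x - b * z)"
    and i3: "2 * (\<delta> * c') * x - \<delta> * b' * y = \<delta> * \<delta> * (b * y + 2 * c * u)"
    and i4: "2 * (\<delta> * c') * z - \<delta> * b' * u = \<delta> * \<delta> * (- 2 * a * y - b * u)"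
    unfolding s \<delta>_def by (simp_all add: algebra_simps)
  have "of_int \<epsilon> * \<theta> * \<alpha>' = of_int (\<delta> * b') * \<alpha>' - of_int (2 * (\<delta> * a')) * \<beta>'"
    "of_int \<epsilon> * \<theta> * \<beta>' = of_int (2 * (\<delta> * c')) * \<alpha>' - of_int (\<delta> * b') * \<beta>'"
    unfolding r i1 i2 i3 i4 dd l1 l2 by simp_all
  then show "equivariant \<epsilon> (\<delta> * a', \<delta> * b', \<delta> * c') \<alpha>' \<beta>'"
    by (simp add: equivariant_def)
  have K: "\<alpha> \<in> K" "\<beta> \<in> K" "\<alpha>' \<in> K"
    using ad by (auto simp: adapted_def \<alpha>'_def intro: K_add K_mult K_of_int)
  have b2: "2 * of_int a * \<beta> = (of_int b - of_int \<epsilon> * \<theta>) * \<alpha>"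
    using eq(1) by (simp add: algebra_simps)
  \<comment> \<open>The norm of \<open>2 a \<alpha>' = (2 a x + b z - \<epsilon> z \<theta>) \<alpha>\<close> is \<open>4 a a' Nr(\<alpha>)\<close>.\<close>
  have "of_int (2 * a) * \<alpha>' = 2 * of_int a * of_int x * \<alpha> + of_int z * (2 * of_int a * \<beta>)"
    by (simp add: \<alpha>'_def algebra_simps)
  also have "\<dots> = (of_rat (of_int (2 * a * x + b * z)) + of_rat (of_int (- z * \<epsilon>)) * \<theta>) * \<alpha>"
    unfolding b2 of_rat_of_int_eq by (simp add: algebra_simps)
  finally have "nrm (of_int (2 * a) * \<alpha>') = nrm (of_rat (of_int (2 * a * x + b * z)) + of_rat (of_int (- z * \<epsilon>)) * \<theta>) * nrm \<alpha>"
    using K K_add[OF K_of_rat K_mult[OF K_of_rat K_theta]] by (simp add: nrm_mult del: of_int_mult of_int_add of_rat_of_int_eq)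
  also have "nrm (of_rat (of_int (2 * a * x + b * z)) + of_rat (of_int (- z * \<epsilon>)) * \<theta>) =
      of_int ((2 * a * x + b * z) * (2 * a * x + b * z) - D * (z * z * (\<epsilon> * \<epsilon>)))"
    unfolding nrm_theta by simp
  also have "(2 * a * x + b * z) * (2 * a * x + b * z) - D * (z * z * (\<epsilon> * \<epsilon>)) = 4 * a * a'"
  proof -
    have "\<epsilon> * \<epsilon> = 1" using ad by (auto simp: adapted_def)
    then show ?thesis
      unfolding adapted_disc[OF ad, symmetric] s by (simp add: power2_eq_square algebra_simps)
  qed
  finally have "of_int (2 * a) * of_int (2 * a) * nrm \<alpha>' = of_int (4 * a * a') * nrm \<alpha>"
    using K by (simp only: nrm_mult[OF K_of_int] nrm_of_int)
  then have N: "of_int a * nrm \<alpha>' = of_int a' * nrm \<alpha>" using nz(2) by simp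
  have "\<not> (x = 0 \<and> z = 0)" using dd by (auto simp: \<delta>_def)
  then have "\<alpha>' \<noteq> 0"
    using equivariant_independent[of \<epsilon> a b c \<alpha> \<beta> x z] ad nz by (auto simp: adapted_def \<alpha>'_def)
  then have "nrm \<alpha>' \<noteq> 0" using K nrm_zero_iff by simp
  then have "a' \<noteq> 0" using N nz by auto
  have "(of_int (\<epsilon> * a') * nrm \<alpha>') * (of_int a * of_int a) = (of_int (\<epsilon> * a) * nrm \<alpha>) * (of_int a' * of_int a')"
    using N by (simp add: algebra_simps)
  also have "\<dots> > 0"
  proof (rule mult_pos_pos)
    show "0 < of_int (\<epsilon> * a) * nrm \<alpha>" using ad by (simp add: adapted_def)
    show "0 < rat_of_int a' * of_int a'"
      using \<open>a' \<noteq> 0\<close> by (simp add: zero_less_mult_iff linorder_neq_iff disj_commute)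
  qed
  finally show "0 < of_int (\<epsilon> * a') * nrm \<alpha>'"
    by (rule zero_less_mult_pos2) (use nz(2) in \<open>auto simp: zero_less_mult_iff\<close>)
qed

lemma zspan_base_change:
  assumes "x * u - y * z = (1::int)"
  shows "zspan (of_int x * \<alpha> + of_int z * \<beta>) (of_int y * \<alpha> + of_int u * \<beta>) = zspan \<alpha> \<beta>"
proof -
  have 1: "of_int k * (of_int x * \<alpha> + of_int z * \<beta>) + of_int l * (of_int y * \<alpha> + of_int u * \<beta>) =
      of_int (k * x + l * y) * \<alpha> + of_int (k * z + l * u) * \<beta>" for k l
    by (simp add: algebra_simps)
  have 2: "of_int k * \<alpha> + of_int l * \<beta> =
      of_int (k * u - l * y) * (of_int x * \<alpha> + of_int z * \<beta>) +
      of_int (l * x - k * z) * (of_int y * \<alpha> + of_int u * \<beta>)" for k l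
  proof -
    have "(k * u - l * y) * x + (l * x - k * z) * y = k * (x * u - y * z)"
      "(k * u - l * y) * z + (l * x - k * z) * u = l * (x * u - y * z)"
      by (simp_all add: algebra_simps)
    then show ?thesis unfolding 1 assms by simp
  qed
  show ?thesis unfolding zspan_def using 1 2 by blast
qed

lemma adapted_properly_equivalent:
  assumes "adapted \<epsilon> q \<alpha> \<beta>" "(q, q') \<in> proper_equiv"
  shows "\<exists>\<alpha>' \<beta>'. adapted \<epsilon> q' \<alpha>' \<beta>' \<and> zspan \<alpha>' \<beta>' = zspan \<alpha> \<beta>"
proof -
  obtain x y z u where det: "x * u - y * z = 1" and sub: "form_subst \<Z> q (x, y, z, u) = q'"
    using assms(2) unfolding proper_equiv_iff by blast
  obtain a b c a' b' c' where q: "q = (a, b, c)" "q' = (a', b', c')" by (metis prod_cases3)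
  have ad: "adapted \<epsilon> (a, b, c) \<alpha> \<beta>" using assms(1) by (simp only: q)
  note bc = equivariant_base_change[OF ad, of x u y z a' b' c', unfolded det sub[unfolded q]]
  have "of_int i * \<alpha> + of_int j * \<beta> \<in> K" for i j
    using ad by (auto simp: adapted_def intro: K_add K_mult K_of_int)
  then have "adapted \<epsilon> q' (of_int x * \<alpha> + of_int z * \<beta>) (of_int y * \<alpha> + of_int u * \<beta>)"
    using bc ad by (simp add: adapted_def q)
  then show ?thesis using zspan_base_change[OF det] by blast
qed

lemma zspan_basis: "\<alpha> \<in> zspan \<alpha> \<beta>" "\<beta> \<in> zspan \<alpha> \<beta>"
proof -
  have "\<alpha> = of_int 1 * \<alpha> + of_int 0 * \<beta>" "\<beta> = of_int 0 * \<alpha> + of_int 1 * \<beta>" by simp_all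
  then show "\<alpha> \<in> zspan \<alpha> \<beta>" "\<beta> \<in> zspan \<alpha> \<beta>" unfolding zspan_def by blast+
qed

lemma properly_equivalent_if_same_zspan:
  assumes ad: "adapted \<epsilon> q \<alpha> \<beta>" and ad': "adapted \<epsilon> q' \<alpha>' \<beta>'"
    and lat: "zspan \<alpha> \<beta> = zspan \<alpha>' \<beta>'"
  shows "(q, q') \<in> proper_equiv"
proof -
  obtain a b c a' b' c' where q: "q = (a, b, c)" "q' = (a', b', c')" by (metis prod_cases3)
  note nz = adapted_nonzero[OF ad[unfolded q]] and nz' = adapted_nonzero[OF ad'[unfolded q]]
  have eqv: "equivariant \<epsilon> (a, b, c) \<alpha> \<beta>" using ad by (simp add: adapted_def q)
  have "\<alpha>' \<in> zspan \<alpha> \<beta>" "\<beta>' \<in> zspan \<alpha> \<beta>" unfolding lat by (rule zspan_basis)+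
  then obtain x y z u where ab': "\<alpha>' = of_int x * \<alpha> + of_int z * \<beta>" "\<beta>' = of_int y * \<alpha> + of_int u * \<beta>"
    unfolding zspan_def by blast
  have "\<alpha> \<in> zspan \<alpha>' \<beta>'" "\<beta> \<in> zspan \<alpha>' \<beta>'" unfolding lat[symmetric] by (rule zspan_basis)+
  then obtain x' y' z' u' where ab: "\<alpha> = of_int x' * \<alpha>' + of_int z' * \<beta>'" "\<beta> = of_int y' * \<alpha>' + of_int u' * \<beta>'"
    unfolding zspan_def by blast
  have "of_int (x' * x + z' * y - 1) * \<alpha> + of_int (x' * z + z' * u) * \<beta> = 0"
    "of_int (y' * x + u' * y) * \<alpha> + of_int (y' * z + u' * u - 1) * \<beta> = 0"
    using ab unfolding ab' by (simp_all add: algebra_simps)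
  then have "x' * x + z' * y - 1 = 0 \<and> x' * z + z' * u = 0" "y' * x + u' * y = 0 \<and> y' * z + u' * u - 1 = 0"
    using equivariant_independent[OF eqv nz(1,3)] by blast+
  then have "x' * x + z' * y = 1" "x' * z + z' * u = 0" "y' * x + u' * y = 0" "y' * z + u' * u = 1"
    by auto
  moreover have "(x * u - y * z) * (x' * u' - y' * z') =
      (x' * x + z' * y) * (y' * z + u' * u) - (x' * z + z' * u) * (y' * x + u' * y)"
    by (simp add: algebra_simps)
  ultimately have "(x * u - y * z) * (x' * u' - y' * z') = 1" by simp
  then have det: "x * u - y * z = 1 \<or> x * u - y * z = -1"
    using zmult_eq_1_iff by blast
  obtain a1 b1 c1 where sub: "form_subst \<Z> (a, b, c) (x, y, z, u) = (a1, b1, c1)" by (metis prod_cases3)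
  note bc = equivariant_base_change[OF ad[unfolded q] det sub, folded ab']
  have e': "equivariant \<epsilon> (a', b', c') \<alpha>' \<beta>'" "0 < of_int (\<epsilon> * a') * nrm \<alpha>'"
    using ad' by (simp_all add: adapted_def q)
  define \<delta> where "\<delta> = x * u - y * z"
  have eqs: "\<delta> * a1 = a'" "\<delta> * b1 = b'" "\<delta> * c1 = c'"
    using equivariant_unique[OF bc(1) e'(1) nz'(1,3)] by (simp_all add: \<delta>_def)
  have "\<delta> = 1"
  proof (rule ccontr)
    assume "\<delta> \<noteq> 1"
    then have "a' = - a1" using det eqs(1) by (simp add: \<delta>_def)
    then show False using bc(2) e'(2) by simp
  qed
  then show ?thesis
    using eqs sub unfolding q \<delta>_def by (intro proper_equivI[of x u y z]) simp_all
qed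

text \<open>Since \<open>\<beta> / \<alpha> = (b - \<epsilon> \<theta>) / (2 a)\<close> is determined by the form and the sign, any two bases adapted
  to them differ by a scalar factor, and the orientations make its norm positive.\<close>

lemma adapted_same_form:
  assumes ad: "adapted \<epsilon> q \<alpha> \<beta>" and ad': "adapted \<epsilon> q \<alpha>' \<beta>'"
  shows "\<exists>z\<in>K. nrm z > 0 \<and> zspan \<alpha>' \<beta>' = (\<lambda>x. z * x) ` zspan \<alpha> \<beta>"
proof -
  obtain a b c where q: "q = (a, b, c)" by (metis prod_cases3)
  note nz = adapted_nonzero[OF ad[unfolded q]] and nz' = adapted_nonzero[OF ad'[unfolded q]]
  define z where "z = \<alpha>' / \<alpha>"
  have K: "\<alpha> \<in> K" "\<alpha>' \<in> K" using ad ad' by (auto simp: adapted_def)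
  have z: "z \<in> K" unfolding z_def using K by (rule K_divide[rotated])
  have a: "\<alpha>' = z * \<alpha>" using nz by (simp add: z_def)
  have b: "2 * of_int a * \<beta> = (of_int b - of_int \<epsilon> * \<theta>) * \<alpha>"
    "2 * of_int a * \<beta>' = (of_int b - of_int \<epsilon> * \<theta>) * \<alpha>'"
    using ad ad' by (simp_all add: adapted_def equivariant_def q algebra_simps)
  have "2 * of_int a * (z * \<beta>) = z * (2 * of_int a * \<beta>)" by simp
  also have "\<dots> = 2 * of_int a * \<beta>'" unfolding b a by simp
  finally have "2 * of_int a * \<beta>' = 2 * of_int a * (z * \<beta>)" ..
  then have b': "\<beta>' = z * \<beta>" using nz(2) by simp
  have "0 < of_int (\<epsilon> * a) * nrm \<alpha>" "0 < of_int (\<epsilon> * a) * nrm \<alpha> * nrm z"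
    using ad ad' K z by (simp_all add: adapted_def q a nrm_mult mult_ac)
  then have "nrm z > 0" by (rule zero_less_mult_pos[rotated])
  then show ?thesis using z zspan_scale[of z \<alpha> \<beta>] unfolding a b' by (intro bexI[of _ z] conjI)
qed

end

section \<open>Forms and fractional ideals\<close>

lemma int_subgroup_cyclic:
  fixes V :: "int set"
  assumes diff: "\<And>x y. x \<in> V \<Longrightarrow> y \<in> V \<Longrightarrow> x - y \<in> V"
    and mult: "\<And>k x. x \<in> V \<Longrightarrow> k * x \<in> V" and v: "v \<in> V" "v \<noteq> 0"
  obtains g where "g \<in> V" "g > 0" "\<And>x. x \<in> V \<Longrightarrow> g dvd x"
proof -
  let ?P = "\<lambda>i. i > 0 \<and> int i \<in> V"
  have "?P (nat \<bar>v\<bar>)" using v mult[of v "-1"] by (auto simp: abs_if)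
  then have least: "?P (LEAST i. ?P i)" by (rule LeastI)
  define g where "g = int (LEAST i. ?P i)"
  have "g dvd x" if x: "x \<in> V" for x
  proof -
    have "x mod g = x - (x div g) * g" by (simp add: minus_div_mult_eq_mod)
    then have "x mod g \<in> V" using diff[OF x mult] least by (simp add: g_def)
    moreover have "0 \<le> x mod g" "x mod g < g" using least by (simp_all add: g_def)
    ultimately have "\<not> x mod g > 0"
      using not_less_Least[of "nat (x mod g)" ?P] by (auto simp: g_def)
    then show ?thesis using \<open>0 \<le> x mod g\<close> by (auto simp: dvd_eq_mod_eq_0)
  qed
  then show thesis using least by (intro that[of g]) (simp_all add: g_def)
qed

context squarefree_radicand
begin

text \<open>The admissible values of \<open>\<epsilon>\<close>: for \<open>d < 0\<close> the sign distinguishes positive from negative definite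
  forms, for \<open>d > 0\<close> there is no choice.\<close>

definition signs :: "int set" where
  "signs = (if d < 0 then {1, -1} else {1})"

lemma signs_cases: "\<epsilon> \<in> signs \<Longrightarrow> \<epsilon> = 1 \<or> \<epsilon> = -1"
  by (auto simp: signs_def split: if_splits)

lemma even_disc_D:
  assumes "disc (a, b, c) = D"
  shows "even (tr - b)"
proof -
  have "b * b = tr * tr + 2 * (2 * (a * c - nm))"
    using assms by (simp add: D_def power2_eq_square algebra_simps)
  then have "even (b * b) \<longleftrightarrow> even (tr * tr)" by simp
  then show ?thesis by auto
qed

text \<open>\<open>D\<close> is a fundamental discriminant: a common prime factor \<open>p\<close> of the coefficients would give
  \<open>p\<^sup>2\<close> dividing \<open>d\<close>, or, for \<open>p = 2\<close> and \<open>D = 4 d\<close>, a form of discriminant \<open>d\<close>, which is not a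
  square modulo 4.\<close>

lemma disc_D_primitive:
  assumes "disc (a, b, c) = D" "Factorial_Ring.prime p"
  shows "\<not> (p dvd a \<and> p dvd b \<and> p dvd c)"
proof
  assume "p dvd a \<and> p dvd b \<and> p dvd c"
  then obtain a' b' c' where abc: "a = p * a'" "b = p * b'" "c = p * c'" by (auto elim!: dvdE)
  have D: "D = p\<^sup>2 * (b' * b' - 4 * a' * c')"
    using assms(1) by (simp add: abc power2_eq_square algebra_simps)
  have not_dvd: "\<not> p\<^sup>2 dvd d"
    using squarefree_d assms(2) not_prime_unit by (auto simp: squarefree_def)
  show False
  proof (cases "d mod 4 = 1")
    case True
    then show False using D not_dvd by (simp add: D_eq)
  next
    case False
    then have D4: "4 * d = p\<^sup>2 * (b' * b' - 4 * a' * c')" using D by (simp add: D_eq)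
    show False
    proof (cases "p = 2")
      case True
      then have d: "d = b' * b' - 4 * a' * c'" using D4 by simp
      have "b' * b' = d + 4 * (a' * c')" using d by simp
      then have "(b' * b') mod 4 = d mod 4" by (simp only: mod_mult_self2)
      then show False using square_mod_4[of b'] d_mod_4 False by auto
    next
      case False
      have "\<not> p dvd 2"
        using zdvd_imp_le[of p 2] prime_ge_2_int[OF assms(2)] False by auto
      then have "Rings.coprime p 2" by (rule prime_imp_coprime[OF assms(2)])
      then have "Rings.coprime (p\<^sup>2) (2\<^sup>2)"
        unfolding power2_eq_square coprime_mult_left_iff coprime_mult_right_iff by blast
      moreover have "2\<^sup>2 * d = p\<^sup>2 * (b' * b' - 4 * a' * c')" using D4 by simp
      then have "p\<^sup>2 dvd 2\<^sup>2 * d" by (rule dvdI)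
      ultimately show False using not_dvd coprime_dvd_mult_right_iff by blast
    qed
  qed
qed

text \<open>The basis \<open>2 a, b - \<epsilon> \<theta>\<close> satisfies the required relations; it is multiplied by a factor \<open>z\<close>
  that corrects the orientation. For \<open>d < 0\<close> the norm is positive and \<open>\<epsilon>\<close> has to be the sign of
  \<open>a\<close>, for \<open>d > 0\<close> the factor \<open>\<surd>d\<close> of negative norm is available.\<close>

lemma form_has_adapted_basis:
  assumes disc: "disc (a, b, c) = D"
  shows "\<exists>\<epsilon>\<in>signs. \<exists>\<alpha> \<beta>. adapted \<epsilon> (a, b, c) \<alpha> \<beta>"
proof -
  have a: "a \<noteq> 0"
  proof
    assume "a = 0"
    then have "D = b * b" using disc by (simp add: power2_eq_square)
    then have "(of_int (- b) + of_int 1 * \<theta>) * (of_int b + of_int 1 * \<theta>) = 0"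
      using theta_square by (simp add: algebra_simps)
    then show False unfolding mult_eq_0_iff of_int_theta_zero_iff by simp
  qed
  obtain \<epsilon> z where \<epsilon>: "\<epsilon> \<in> signs" and z: "z \<in> K" "0 < of_int (\<epsilon> * a) * nrm z"
  proof (cases "d < 0")
    case True
    have "0 < sgn a * a" using a by (simp add: sgn_if)
    then have "0 < of_int (sgn a * a) * nrm 1" using nrm_of_int[of 1] by (simp del: of_int_mult)
    then show thesis
      using a True K_of_int[of 1] by (intro that[of "sgn a" 1]) (auto simp: signs_def sgn_if)
  next
    case False
    then have d: "d > 0" using d_not_01 by auto
    show thesis
    proof (cases "a > 0")
      case True
      then show thesis
        using False K_of_int[of 1] nrm_of_int[of 1] by (intro that[of 1 1]) (auto simp: signs_def)
    next
      case a': False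
      have "nrm s = - of_int d" using nrm_coords[of 0 1] by simp
      then show thesis
        using False d a a' K_s by (intro that[of 1 s]) (auto simp: signs_def mult_neg_pos)
    qed
  qed
  define \<alpha> \<beta> where "\<alpha> = of_int (2 * a) * z" and "\<beta> = (of_int b - of_int \<epsilon> * \<theta>) * z"
  have e: "of_int \<epsilon> * of_int \<epsilon> = (1 :: complex)" using signs_cases[OF \<epsilon>] by auto
  have "of_int \<epsilon> * \<theta> * \<beta> = (of_int b * (of_int \<epsilon> * \<theta>) - of_int \<epsilon> * of_int \<epsilon> * (\<theta> * \<theta>)) * z"
    by (simp add: \<beta>_def algebra_simps)
  also have "\<dots> = 2 * of_int c * \<alpha> - of_int b * \<beta>"
    unfolding e theta_square disc[symmetric] by (simp add: \<alpha>_def \<beta>_def power2_eq_square algebra_simps)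
  finally have "equivariant \<epsilon> (a, b, c) \<alpha> \<beta>"
    by (simp add: equivariant_def \<alpha>_def \<beta>_def algebra_simps)
  moreover have "\<alpha> \<in> K" "\<beta> \<in> K"
    unfolding \<alpha>_def \<beta>_def by (intro K_mult K_diff K_of_int K_theta z(1))+
  moreover have "0 < of_int (\<epsilon> * a) * nrm \<alpha>"
  proof -
    have "0 < (of_int (2 * a) * of_int (2 * a)) * (of_int (\<epsilon> * a) * nrm z)"
      using a by (intro mult_pos_pos[OF _ z(2)]) (auto simp: zero_less_mult_iff)
    also have "\<dots> = of_int (\<epsilon> * a) * nrm \<alpha>"
      unfolding \<alpha>_def nrm_mult[OF K_of_int z(1)] nrm_of_int by (simp only: mult_ac)
    finally show ?thesis .
  qed
  ultimately have "adapted \<epsilon> (a, b, c) \<alpha> \<beta>"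
    using signs_cases[OF \<epsilon>] by (simp add: adapted_def)
  then show ?thesis using \<epsilon> by blast
qed

lemma OK_iff: "z \<in> OK \<longleftrightarrow> (\<exists>x y. z = of_int x + of_int y * \<omega>)"
  unfolding ring_of_integers_eq by blast

lemma OK_w: "\<omega> \<in> OK"
  unfolding OK_iff by (intro exI[of _ 0] exI[of _ 1]) simp

lemma OK_of_int: "of_int k \<in> OK"
  unfolding OK_iff by (intro exI[of _ k] exI[of _ 0]) simp

lemma OK_add: "x \<in> OK \<Longrightarrow> y \<in> OK \<Longrightarrow> x + y \<in> OK"
proof -
  assume "x \<in> OK" "y \<in> OK"
  then obtain a b a' b' where "x = of_int a + of_int b * \<omega>" "y = of_int a' + of_int b' * \<omega>"
    unfolding OK_iff by blast
  then have "x + y = of_int (a + a') + of_int (b + b') * \<omega>" by (simp add: algebra_simps)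
  then show "x + y \<in> OK" unfolding OK_iff by blast
qed

lemma OK_mult: "x \<in> OK \<Longrightarrow> y \<in> OK \<Longrightarrow> x * y \<in> OK"
proof -
  assume "x \<in> OK" "y \<in> OK"
  then obtain a b a' b' where xy: "x = of_int a + of_int b * \<omega>" "y = of_int a' + of_int b' * \<omega>"
    unfolding OK_iff by blast
  have "x * y = of_int (a * a') + of_int (a * b' + b * a') * \<omega> + of_int (b * b') * (\<omega> * \<omega>)"
    unfolding xy by (simp add: algebra_simps)
  also have "\<dots> = of_int (a * a' - b * b' * nm) + of_int (a * b' + b * a' + b * b' * tr) * \<omega>"
    unfolding w_square by (simp add: algebra_simps)
  finally show "x * y \<in> OK" unfolding OK_iff by blast
qed

lemma OK_subset_K: "OK \<subseteq> K"
  by (auto simp: ring_of_integers_def)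

lemma s_in_OK: "s \<in> OK"
proof (cases "d mod 4 = 1")
  case True
  then have "s = of_int (-1) + of_int 2 * \<omega>" by (simp add: w_eq theta_eq tr_def field_simps)
  then show ?thesis unfolding OK_iff by blast
next
  case False
  then have "s = \<omega>" by (simp add: w_eq theta_eq tr_def)
  then show ?thesis using OK_w by simp
qed

lemma K_denominator:
  assumes "z \<in> K"
  obtains k :: int where "k \<noteq> 0" "of_int k * z \<in> OK"
proof -
  obtain a b where z: "z = of_rat a + of_rat b * s" using assms by (rule K_E)
  obtain p q where a: "a = of_int p / of_int q" "q > 0" by (metis Fract_of_int_quotient Rat_cases)
  obtain p' q' where b: "b = of_int p' / of_int q'" "q' > 0" by (metis Fract_of_int_quotient Rat_cases)
  have "of_int (q * q') * z = of_int (p * q') + of_int (p' * q) * s"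
  proof -
    have "q \<noteq> 0" "q' \<noteq> 0" using a(2) b(2) by simp_all
    then show ?thesis by (simp add: z a(1) b(1) of_rat_divide field_simps)
  qed
  also have "\<dots> \<in> OK" by (intro OK_add OK_mult OK_of_int s_in_OK)
  finally show thesis using a(2) b(2) by (intro that[of "q * q'"]) auto
qed

lemma zspan_add: "x \<in> zspan \<alpha> \<beta> \<Longrightarrow> y \<in> zspan \<alpha> \<beta> \<Longrightarrow> x + y \<in> zspan \<alpha> \<beta>"
proof -
  assume "x \<in> zspan \<alpha> \<beta>" "y \<in> zspan \<alpha> \<beta>"
  then obtain a b a' b' where "x = of_int a * \<alpha> + of_int b * \<beta>" "y = of_int a' * \<alpha> + of_int b' * \<beta>"
    unfolding zspan_def by blast
  then have "x + y = of_int (a + a') * \<alpha> + of_int (b + b') * \<beta>" by (simp add: algebra_simps)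
  then show "x + y \<in> zspan \<alpha> \<beta>" unfolding zspan_def by blast
qed

lemma zspan_of_int_mult: "x \<in> zspan \<alpha> \<beta> \<Longrightarrow> of_int k * x \<in> zspan \<alpha> \<beta>"
proof -
  assume "x \<in> zspan \<alpha> \<beta>"
  then obtain a b where "x = of_int a * \<alpha> + of_int b * \<beta>" unfolding zspan_def by blast
  then have "of_int k * x = of_int (k * a) * \<alpha> + of_int (k * b) * \<beta>" by (simp add: algebra_simps)
  then show "of_int k * x \<in> zspan \<alpha> \<beta>" unfolding zspan_def by blast
qed

lemma zspan_fractional_ideal:
  assumes ad: "adapted \<epsilon> q \<alpha> \<beta>"
  shows "zspan \<alpha> \<beta> \<in> fractional_ideals d"
proof -
  obtain a b c where q: "q = (a, b, c)" by (metis prod_cases3)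
  note nz = adapted_nonzero[OF ad[unfolded q]]
  have \<epsilon>: "\<epsilon> = 1 \<or> \<epsilon> = -1" and K: "\<alpha> \<in> K" "\<beta> \<in> K" using ad by (auto simp: adapted_def)
  have "even (tr - b)" using even_disc_D adapted_disc[OF ad[unfolded q]] by blast
  then have "even (tr + \<epsilon> * b)" using \<epsilon> by auto
  then obtain h where h: "tr + \<epsilon> * b = 2 * h" by (elim evenE)
  have ee: "of_int \<epsilon> * of_int \<epsilon> = (1 :: complex)" using \<epsilon> by auto
  have eq: "of_int \<epsilon> * \<theta> * \<alpha> = of_int b * \<alpha> - 2 * of_int a * \<beta>"
    "of_int \<epsilon> * \<theta> * \<beta> = 2 * of_int c * \<alpha> - of_int b * \<beta>"
    using ad by (simp_all add: adapted_def equivariant_def q)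
  have b: "of_int \<epsilon> * of_int b = (2 * of_int h - of_int tr :: complex)"
    using arg_cong[OF h, of "of_int :: int \<Rightarrow> complex"] by (simp add: algebra_simps)
  have w2: "2 * (\<omega> * x) = of_int tr * x + of_int \<epsilon> * (of_int \<epsilon> * \<theta> * x)" for x
  proof -
    have "2 * (\<omega> * x) = of_int tr * x + of_int \<epsilon> * of_int \<epsilon> * (\<theta> * x)"
      unfolding ee by (simp add: w_eq algebra_simps)
    then show ?thesis by (simp add: mult.assoc)
  qed
  have "2 * (\<omega> * \<alpha>) = of_int tr * \<alpha> + (of_int \<epsilon> * of_int b) * \<alpha> - 2 * (of_int \<epsilon> * of_int a * \<beta>)"
    unfolding w2 eq by (simp add: algebra_simps)
  also have "\<dots> = 2 * (of_int h * \<alpha> + of_int (- \<epsilon> * a) * \<beta>)"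
    unfolding b by (simp add: algebra_simps)
  finally have \<omega>\<alpha>: "\<omega> * \<alpha> = of_int h * \<alpha> + of_int (- \<epsilon> * a) * \<beta>"
    by (simp only: mult_cancel_left) simp
  have "2 * (\<omega> * \<beta>) = of_int tr * \<beta> - (of_int \<epsilon> * of_int b) * \<beta> + 2 * (of_int \<epsilon> * of_int c * \<alpha>)"
    unfolding w2 eq by (simp add: algebra_simps)
  also have "\<dots> = 2 * (of_int (\<epsilon> * c) * \<alpha> + of_int (tr - h) * \<beta>)"
    unfolding b by (simp add: algebra_simps)
  finally have \<omega>\<beta>: "\<omega> * \<beta> = of_int (\<epsilon> * c) * \<alpha> + of_int (tr - h) * \<beta>"
    by (simp only: mult_cancel_left) simp
  have \<omega>: "\<omega> * \<alpha> \<in> zspan \<alpha> \<beta>" "\<omega> * \<beta> \<in> zspan \<alpha> \<beta>"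
    unfolding \<omega>\<alpha> \<omega>\<beta> zspan_def by blast+
  have w_lat: "\<omega> * x \<in> zspan \<alpha> \<beta>" if x: "x \<in> zspan \<alpha> \<beta>" for x
  proof -
    obtain i j where "x = of_int i * \<alpha> + of_int j * \<beta>" using x unfolding zspan_def by blast
    then have "\<omega> * x = of_int i * (\<omega> * \<alpha>) + of_int j * (\<omega> * \<beta>)" by (simp add: algebra_simps)
    then show ?thesis using \<omega> by (simp add: zspan_add zspan_of_int_mult)
  qed
  have "r * x \<in> zspan \<alpha> \<beta>" if r: "r \<in> OK" and x: "x \<in> zspan \<alpha> \<beta>" for r x
  proof -
    obtain i j where "r = of_int i + of_int j * \<omega>" using r unfolding OK_iff by blast
    then have "r * x = of_int i * x + of_int j * (\<omega> * x)" by (simp add: algebra_simps)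
    then show ?thesis
      using x w_lat by (simp add: zspan_add zspan_of_int_mult)
  qed
  moreover have "zspan \<alpha> \<beta> \<subseteq> K" unfolding zspan_def using K by (auto intro: K_add K_mult K_of_int)
  moreover have "0 \<in> zspan \<alpha> \<beta>" using zspan_of_int_mult[OF zspan_basis(1), of 0] by simp
  moreover have "zspan \<alpha> \<beta> \<noteq> {0}" using zspan_basis(1)[of \<alpha> \<beta>] nz(3) by auto
  moreover have "\<exists>m\<in>OK. m \<noteq> 0 \<and> (\<forall>x\<in>zspan \<alpha> \<beta>. m * x \<in> OK)"
  proof -
    obtain k where k: "k \<noteq> 0" "of_int k * \<alpha> \<in> OK" using K(1) by (rule K_denominator)
    obtain l where l: "l \<noteq> 0" "of_int l * \<beta> \<in> OK" using K(2) by (rule K_denominator)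
    have "of_int (k * l) * x \<in> OK" if x: "x \<in> zspan \<alpha> \<beta>" for x
    proof -
      obtain i j where "x = of_int i * \<alpha> + of_int j * \<beta>" using x unfolding zspan_def by blast
      then have "of_int (k * l) * x = of_int (l * i) * (of_int k * \<alpha>) + of_int (k * j) * (of_int l * \<beta>)"
        by (simp add: algebra_simps)
      also have "\<dots> \<in> OK" by (intro OK_add OK_mult[OF OK_of_int] k(2) l(2))
      finally show ?thesis .
    qed
    then show ?thesis
      using k(1) l(1) by (intro bexI[of _ "of_int (k * l)"] conjI OK_of_int ballI) simp_all
  qed
  ultimately show ?thesis
    unfolding fractional_ideals_def using zspan_add by blast
qed

lemma fractional_idealD:
  assumes "I \<in> fractional_ideals d"
  shows "I \<subseteq> K" "0 \<in> I" "I \<noteq> {0}" "\<And>x y. x \<in> I \<Longrightarrow> y \<in> I \<Longrightarrow> x + y \<in> I"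
    "\<And>r x. r \<in> OK \<Longrightarrow> x \<in> I \<Longrightarrow> r * x \<in> I"
    "\<exists>m\<in>OK. m \<noteq> 0 \<and> (\<forall>x\<in>I. m * x \<in> OK)"
  using assms unfolding fractional_ideals_def by blast+

text \<open>After multiplication by a denominator \<open>m\<close> the ideal is a subgroup \<open>J\<close> of \<open>\<int> + \<int> \<omega>\<close>. A basis
  of \<open>J\<close> is given by a generator \<open>g\<close> of \<open>J \<inter> \<int>\<close> and an element of \<open>J\<close> whose coefficient
  \<open>l\<close> at \<open>\<omega>\<close> generates the group of all such coefficients.\<close>

lemma fractional_ideal_basis:
  assumes I: "I \<in> fractional_ideals d"
  obtains \<alpha> \<beta> where "I = zspan \<alpha> \<beta>" "\<alpha> \<noteq> 0" "\<beta> \<noteq> 0"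
proof -
  note ID = fractional_idealD[OF I]
  obtain m where m: "m \<noteq> 0" "\<And>x. x \<in> I \<Longrightarrow> m * x \<in> OK" using ID(6) by blast
  define J where "J = (\<lambda>x. m * x) ` I"
  have J_OK: "J \<subseteq> OK" using m(2) by (auto simp: J_def)
  have J_add: "x + y \<in> J" if xy: "x \<in> J" "y \<in> J" for x y
  proof -
    obtain x' y' where "x = m * x'" "y = m * y'" "x' \<in> I" "y' \<in> I" using xy by (auto simp: J_def)
    then have "x + y = m * (x' + y')" "x' + y' \<in> I" using ID(4) by (simp_all add: distrib_left)
    then show ?thesis by (auto simp: J_def)
  qed
  have J_mult: "r * x \<in> J" if rx: "r \<in> OK" "x \<in> J" for r x
  proof -
    obtain x' where "x = m * x'" "x' \<in> I" using rx by (auto simp: J_def)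
    then have "r * x = m * (r * x')" "r * x' \<in> I" using ID(5) rx by simp_all
    then show ?thesis by (auto simp: J_def)
  qed
  have J_diff: "x - y \<in> J" if "x \<in> J" "y \<in> J" for x y
    using J_add[OF that(1) J_mult[OF OK_of_int[of "-1"] that(2)]] by simp
  obtain i where i: "i \<in> I" "i \<noteq> 0" using ID(2,3) by blast
  then obtain j where j: "j \<in> J" "j \<noteq> 0" using m(1) by (intro that[of "m * i"]) (auto simp: J_def)
  obtain x y where xy: "j = of_int x + of_int y * \<omega>" using j(1) J_OK OK_iff by blast
  define U where "U = {u. of_int u \<in> J}"
  define V where "V = {v. \<exists>u. of_int u + of_int v * \<omega> \<in> J}"
  \<comment> \<open>\<open>J \<inter> \<int>\<close> contains the norm of \<open>j\<close>, the product of \<open>j\<close> with its conjugate.\<close>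
  have "x * x + tr * (x * y) + nm * (y * y) \<in> U"
  proof -
    have "(of_int (x + y * tr) + of_int (- y) * \<omega>) * j \<in> J"
      by (intro J_mult[OF _ j(1)] w_integral)
    also have "(of_int (x + y * tr) + of_int (- y) * \<omega>) * j =
        of_int (x * (x + y * tr)) + of_int (y * y * tr) * \<omega> - of_int (y * y) * (\<omega> * \<omega>)"
      unfolding xy by (simp add: algebra_simps)
    also have "\<dots> = of_int (x * x + tr * (x * y) + nm * (y * y))"
      unfolding w_square by (simp add: algebra_simps)
    finally show ?thesis unfolding U_def by blast
  qed
  moreover have "x * x + tr * (x * y) + nm * (y * y) \<noteq> 0"
  proof -
    have "nrm j \<noteq> 0" using j J_OK OK_subset_K nrm_zero_iff by blast
    then show ?thesis unfolding xy nrm_w by (simp only: of_int_eq_0_iff not_False_eq_True)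
  qed
  moreover have "u - u' \<in> U" if "u \<in> U" "u' \<in> U" for u u'
    using J_diff that by (simp add: U_def)
  moreover have "k * u \<in> U" if "u \<in> U" for k u
    using J_mult[OF OK_of_int] that by (simp add: U_def)
  ultimately obtain g where g: "g \<in> U" "g > 0" "\<And>u. u \<in> U \<Longrightarrow> g dvd u"
    by (metis int_subgroup_cyclic)
  have V_diff: "v - v' \<in> V" if v: "v \<in> V" "v' \<in> V" for v v'
  proof -
    obtain u u' where "of_int u + of_int v * \<omega> \<in> J" "of_int u' + of_int v' * \<omega> \<in> J"
      using v unfolding V_def by blast
    then have "(of_int u + of_int v * \<omega>) - (of_int u' + of_int v' * \<omega>) \<in> J" by (rule J_diff)
    also have "(of_int u + of_int v * \<omega>) - (of_int u' + of_int v' * \<omega>) = of_int (u - u') + of_int (v - v') * \<omega>"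
      by (simp add: algebra_simps)
    finally show ?thesis unfolding V_def by blast
  qed
  have V_mult: "k * v \<in> V" if v: "v \<in> V" for k v
  proof -
    obtain u where "of_int u + of_int v * \<omega> \<in> J" using v unfolding V_def by blast
    then have "of_int k * (of_int u + of_int v * \<omega>) \<in> J" by (rule J_mult[OF OK_of_int])
    also have "of_int k * (of_int u + of_int v * \<omega>) = of_int (k * u) + of_int (k * v) * \<omega>"
      by (simp add: algebra_simps)
    finally show ?thesis unfolding V_def by blast
  qed
  have "g \<in> V"
  proof -
    have "\<omega> * of_int g \<in> J" using g(1) by (intro J_mult OK_w) (simp add: U_def)
    then have "of_int 0 + of_int g * \<omega> \<in> J" by (simp add: mult.commute)
    then show ?thesis unfolding V_def by blast
  qed
  then obtain l where l: "l \<in> V" "l > 0" "\<And>v. v \<in> V \<Longrightarrow> l dvd v"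
    using int_subgroup_cyclic[of V g] V_diff V_mult g(2) by (metis less_irrefl)
  obtain x0 where x0: "of_int x0 + of_int l * \<omega> \<in> J" using l(1) unfolding V_def by blast
  have J_eq: "J = zspan (of_int g) (of_int x0 + of_int l * \<omega>)"
  proof
    show "J \<subseteq> zspan (of_int g) (of_int x0 + of_int l * \<omega>)"
    proof
      fix i assume i: "i \<in> J"
      then obtain u v where uv: "i = of_int u + of_int v * \<omega>" using J_OK OK_iff by blast
      then have "v \<in> V" using i unfolding V_def by blast
      then have "l dvd v" by (rule l(3))
      then obtain k where k: "v = l * k" by (elim dvdE)
      have "i - of_int k * (of_int x0 + of_int l * \<omega>) \<in> J"
        by (intro J_diff i J_mult OK_of_int x0)
      also have "i - of_int k * (of_int x0 + of_int l * \<omega>) = of_int (u - k * x0)"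
        unfolding uv k by (simp add: algebra_simps)
      finally have "u - k * x0 \<in> U" unfolding U_def by blast
      then have "g dvd u - k * x0" by (rule g(3))
      then obtain k' where k': "u - k * x0 = g * k'" by (elim dvdE)
      have "i = of_int k' * of_int g + of_int k * (of_int x0 + of_int l * \<omega>)"
        using arg_cong[OF k', of "of_int :: int \<Rightarrow> complex"] unfolding uv k by (simp add: algebra_simps)
      then show "i \<in> zspan (of_int g) (of_int x0 + of_int l * \<omega>)" unfolding zspan_def by blast
    qed
    show "zspan (of_int g) (of_int x0 + of_int l * \<omega>) \<subseteq> J"
    proof
      fix i assume "i \<in> zspan (of_int g) (of_int x0 + of_int l * \<omega>)"
      then obtain k k' where "i = of_int k * of_int g + of_int k' * (of_int x0 + of_int l * \<omega>)"
        unfolding zspan_def by blast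
      moreover have "of_int g \<in> J" using g(1) by (simp add: U_def)
      ultimately show "i \<in> J"
        using J_add[OF J_mult[OF OK_of_int] J_mult[OF OK_of_int x0]] by simp
    qed
  qed
  have "I = (\<lambda>x. inverse m * x) ` J"
    using m(1) by (simp add: J_def image_image flip: mult.assoc)
  also have "\<dots> = zspan (inverse m * of_int g) (inverse m * (of_int x0 + of_int l * \<omega>))"
    unfolding J_eq zspan_scale ..
  finally show thesis
    using m(1) g(2) l(2) of_int_w_zero_iff[of x0 l]
    by (intro that[of "inverse m * of_int g" "inverse m * (of_int x0 + of_int l * \<omega>)"]) auto
qed

lemma zspan_uminus: "zspan \<alpha> (- \<beta>) = zspan \<alpha> \<beta>"
proof -
  have "of_int x * \<alpha> + of_int y * (- \<beta>) = of_int x * \<alpha> + of_int (- y) * \<beta>"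
    "of_int x * \<alpha> + of_int y * \<beta> = of_int x * \<alpha> + of_int (- y) * (- \<beta>)" for x y by simp_all
  then show ?thesis unfolding zspan_def by blast
qed

text \<open>Multiplication by \<open>\<omega>\<close> in a basis of the ideal is an integral matrix with the trace of \<open>\<omega>\<close>, so
  \<open>\<epsilon> \<theta> = \<epsilon> (2 \<omega> - tr)\<close> acts through the matrix of a form. If the orientation is wrong, \<open>\<beta>\<close> is
  replaced by \<open>-\<beta>\<close>, which changes the sign of the outer coefficients.\<close>

lemma fractional_ideal_has_adapted_basis:
  assumes I: "I \<in> fractional_ideals d" and \<epsilon>: "\<epsilon> \<in> signs"
  shows "\<exists>q \<alpha> \<beta>. adapted \<epsilon> q \<alpha> \<beta> \<and> zspan \<alpha> \<beta> = I"
proof -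
  obtain \<alpha> \<beta> where lat: "I = zspan \<alpha> \<beta>" and nz: "\<alpha> \<noteq> 0" "\<beta> \<noteq> 0"
    using I by (rule fractional_ideal_basis)
  note ID = fractional_idealD[OF I]
  have mem: "\<alpha> \<in> I" "\<beta> \<in> I" unfolding lat by (rule zspan_basis)+
  then have K: "\<alpha> \<in> K" "\<beta> \<in> K" using ID(1) by blast+
  have "\<omega> * \<alpha> \<in> zspan \<alpha> \<beta>" "\<omega> * \<beta> \<in> zspan \<alpha> \<beta>"
    using ID(5)[OF OK_w] mem unfolding lat by blast+
  then obtain p q r u where \<omega>\<alpha>: "\<omega> * \<alpha> = of_int p * \<alpha> + of_int q * \<beta>"
    and \<omega>\<beta>: "\<omega> * \<beta> = of_int r * \<alpha> + of_int u * \<beta>"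
    unfolding zspan_def by blast
  have q: "q \<noteq> 0"
  proof
    assume "q = 0"
    then have "of_int (- p) + of_int 1 * \<omega> = 0" using \<omega>\<alpha> nz(1) by simp
    then show False unfolding of_int_w_zero_iff by simp
  qed
  have "(\<omega> * \<alpha> - of_int p * \<alpha>) * (\<omega> * \<beta> - of_int u * \<beta>) = of_int (q * r) * (\<alpha> * \<beta>)"
    unfolding \<omega>\<alpha> \<omega>\<beta> by (simp add: algebra_simps)
  moreover have "(\<omega> * \<alpha> - of_int p * \<alpha>) * (\<omega> * \<beta> - of_int u * \<beta>) =
      (\<omega> * \<omega> - of_int (p + u) * \<omega> + of_int (p * u)) * (\<alpha> * \<beta>)"
    by (simp add: algebra_simps)
  ultimately have "\<omega> * \<omega> - of_int (p + u) * \<omega> + of_int (p * u) = of_int (q * r)"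
    using nz by (simp del: of_int_add of_int_mult)
  then have "of_int (p * u - q * r - nm) + of_int (tr - (p + u)) * \<omega> = 0"
    unfolding w_square by (simp add: algebra_simps)
  then have u: "u = tr - p" unfolding of_int_w_zero_iff by simp
  have \<theta>\<alpha>: "of_int \<epsilon> * \<theta> * \<alpha> = of_int (\<epsilon> * (2 * p - tr)) * \<alpha> + of_int (2 * \<epsilon> * q) * \<beta>"
  proof -
    have "of_int \<epsilon> * \<theta> * \<alpha> = of_int \<epsilon> * (2 * (\<omega> * \<alpha>) - of_int tr * \<alpha>)" by (simp add: \<theta>_def algebra_simps)
    then show ?thesis unfolding \<omega>\<alpha> by (simp add: algebra_simps)
  qed
  have \<theta>\<beta>: "of_int \<epsilon> * \<theta> * \<beta> = of_int (2 * \<epsilon> * r) * \<alpha> - of_int (\<epsilon> * (2 * p - tr)) * \<beta>"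
  proof -
    have "of_int \<epsilon> * \<theta> * \<beta> = of_int \<epsilon> * (2 * (\<omega> * \<beta>) - of_int tr * \<beta>)" by (simp add: \<theta>_def algebra_simps)
    then show ?thesis unfolding \<omega>\<beta> u by (simp add: algebra_simps)
  qed
  have e: "\<epsilon> = 1 \<or> \<epsilon> = -1" using signs_cases[OF \<epsilon>] .
  have "of_int q * nrm \<alpha> \<noteq> 0" using q nz(1) nrm_zero_iff[OF K(1)] by simp
  then consider "of_int q * nrm \<alpha> < 0" | "of_int q * nrm \<alpha> > 0" by linarith
  then show ?thesis
  proof cases
    case 1
    have "equivariant \<epsilon> (- \<epsilon> * q, \<epsilon> * (2 * p - tr), \<epsilon> * r) \<alpha> \<beta>"
      unfolding equivariant_def split_conv \<theta>\<alpha> \<theta>\<beta> by (simp add: mult.assoc)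
    moreover have "0 < of_int (\<epsilon> * (- \<epsilon> * q)) * nrm \<alpha>" using 1 e by auto
    ultimately have "adapted \<epsilon> (- \<epsilon> * q, \<epsilon> * (2 * p - tr), \<epsilon> * r) \<alpha> \<beta>"
      using e K by (simp add: adapted_def)
    then show ?thesis using lat by blast
  next
    case 2
    have "of_int \<epsilon> * \<theta> * (- \<beta>) = - (of_int \<epsilon> * \<theta> * \<beta>)" by simp
    then have "equivariant \<epsilon> (\<epsilon> * q, \<epsilon> * (2 * p - tr), - \<epsilon> * r) \<alpha> (- \<beta>)"
      unfolding equivariant_def split_conv \<theta>\<alpha> \<theta>\<beta> by (simp add: mult.assoc)
    moreover have "0 < of_int (\<epsilon> * (\<epsilon> * q)) * nrm \<alpha>" using 2 e by auto
    ultimately have "adapted \<epsilon> (\<epsilon> * q, \<epsilon> * (2 * p - tr), - \<epsilon> * r) \<alpha> (- \<beta>)"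
      using e K by (simp add: adapted_def K_uminus)
    then show ?thesis using lat zspan_uminus by blast
  qed
qed

end

section \<open>Narrow ideal classes\<close>

text \<open>A relation that is total on both sides, and that matches the equivalence \<open>r\<close> with equality of
  \<open>\<kappa>\<close>-values, induces a bijection from the classes of \<open>r\<close> to the values of \<open>\<kappa>\<close>.\<close>

lemma bij_betw_quotient:
  assumes r: "equiv UNIV r"
    and total: "\<And>q. q \<in> X \<Longrightarrow> \<exists>y\<in>Y. rel q y"
    and onto: "\<And>y. y \<in> Y \<Longrightarrow> \<exists>q\<in>X. rel q y"
    and compat: "\<And>q q' y y'. q \<in> X \<Longrightarrow> q' \<in> X \<Longrightarrow> y \<in> Y \<Longrightarrow> y' \<in> Y \<Longrightarrow> rel q y \<Longrightarrow> rel q' y' \<Longrightarrow>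
      (q, q') \<in> r \<longleftrightarrow> \<kappa> y = \<kappa> y'"
  shows "\<exists>f. bij_betw f (X // r) (\<kappa> ` Y)"
proof -
  define P where "P C y \<longleftrightarrow> y \<in> Y \<and> (\<exists>q\<in>C \<inter> X. rel q y)" for C y
  define f where "f C = \<kappa> (SOME y. P C y)" for C
  have f: "f (r `` {q}) = \<kappa> y" if q: "q \<in> X" "y \<in> Y" "rel q y" for q y
  proof -
    have "q \<in> r `` {q}" using equiv_class_self[OF r] by simp
    then have "P (r `` {q}) y" using q by (auto simp: P_def)
    then have "P (r `` {q}) (SOME y. P (r `` {q}) y)" by (rule someI)
    then obtain q' where q': "(q, q') \<in> r" "q' \<in> X" "rel q' (SOME y. P (r `` {q}) y)"
      and Y: "(SOME y. P (r `` {q}) y) \<in> Y"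
      by (auto simp: P_def)
    show ?thesis using compat[OF q(1) q'(2) q(2) Y q(3) q'(3)] q'(1) by (simp add: f_def)
  qed
  have "bij_betw f (X // r) (\<kappa> ` Y)"
    unfolding bij_betw_def
  proof
    show "inj_on f (X // r)"
    proof (rule inj_onI)
      fix C C' assume "C \<in> X // r" "C' \<in> X // r" and eq: "f C = f C'"
      then obtain q q' where q: "q \<in> X" "C = r `` {q}" "q' \<in> X" "C' = r `` {q'}"
        by (elim quotientE) blast
      obtain y y' where y: "y \<in> Y" "rel q y" "y' \<in> Y" "rel q' y'" using total q by metis
      have "(q, q') \<in> r" using compat[OF q(1,3) y(1,3,2,4)] eq f q y by simp
      then show "C = C'" unfolding q by (rule equiv_class_eq[OF r])
    qed
    show "f ` (X // r) = \<kappa> ` Y"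
    proof
      show "f ` (X // r) \<subseteq> \<kappa> ` Y"
      proof
        fix c assume "c \<in> f ` (X // r)"
        then obtain q where q: "q \<in> X" "c = f (r `` {q})" by (auto elim!: quotientE)
        then obtain y where "y \<in> Y" "rel q y" using total by blast
        then show "c \<in> \<kappa> ` Y" using f[OF q(1)] q(2) by blast
      qed
      show "\<kappa> ` Y \<subseteq> f ` (X // r)"
      proof
        fix c assume "c \<in> \<kappa> ` Y"
        then obtain y where y: "y \<in> Y" "c = \<kappa> y" by blast
        then obtain q where q: "q \<in> X" "rel q y" using onto by blast
        then have "c = f (r `` {q})" using f y by simp
        then show "c \<in> f ` (X // r)" using quotientI[OF q(1)] by blast
      qed
    qed
  qed
  then show ?thesis by blast
qed

context squarefree_radicand
begin

lemma real_embedding_coords: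
  assumes "real_embedding d \<sigma>"
  shows "\<sigma> (of_rat a + of_rat b * s) = of_rat a + of_rat b * \<sigma> s"
    and "\<sigma> s * \<sigma> s = of_int d"
proof -
  have one: "\<sigma> 1 = 1" and add: "\<And>x y. x \<in> K \<Longrightarrow> y \<in> K \<Longrightarrow> \<sigma> (x + y) = \<sigma> x + \<sigma> y"
    and mult: "\<And>x y. x \<in> K \<Longrightarrow> y \<in> K \<Longrightarrow> \<sigma> (x * y) = \<sigma> x * \<sigma> y"
    using assms by (simp_all add: real_embedding_def)
  have zero: "\<sigma> 0 = 0" using add[OF K_of_int[of 0] K_of_int[of 0]] by simp
  have nat: "\<sigma> (of_nat k) = of_nat k" for k
  proof (induction k)
    case (Suc k)
    then show ?case using add[OF K_of_int[of 1] K_of_int[of "int k"]] one by simp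
  qed (simp add: zero)
  have int: "\<sigma> (of_int k) = of_int k" for k
  proof (cases k)
    case (nonneg m)
    then show ?thesis using nat[of m] by simp
  next
    case (neg m)
    have "\<sigma> (of_int k) + \<sigma> (of_nat (Suc m)) = 0"
      using add[OF K_of_int[of k] K_of_int[of "int (Suc m)"]] zero neg by simp
    then show ?thesis unfolding nat using neg by simp
  qed
  have rat: "\<sigma> (of_rat r) = of_rat r" for r
  proof -
    obtain p q where r: "r = of_int p / of_int q" "q > 0" by (metis Fract_of_int_quotient Rat_cases)
    have "\<sigma> (of_int q * of_rat r) = of_int q * \<sigma> (of_rat r)"
      using mult[OF K_of_int K_of_rat] int by simp
    moreover have "of_int q * of_rat r = (of_int p :: complex)" using r by (simp add: of_rat_divide)
    ultimately have "of_int q * \<sigma> (of_rat r) = of_int p" using int by simp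
    then have "\<sigma> (of_rat r) = of_int p / of_int q" using r(2) by (simp add: eq_divide_eq mult.commute)
    moreover have "(of_rat r :: real) = of_int p / of_int q" by (simp add: r(1) of_rat_divide)
    ultimately show ?thesis by simp
  qed
  show "\<sigma> (of_rat a + of_rat b * s) = of_rat a + of_rat b * \<sigma> s"
    using add[OF K_of_rat K_mult[OF K_of_rat K_s], of a b] mult[OF K_of_rat K_s, of b] rat by simp
  show "\<sigma> s * \<sigma> s = of_int d"
    using mult[OF K_s K_s] int[of d] by (simp add: s_square)
qed

lemma real_embedding_exists:
  assumes "r * r = (of_int d :: real)"
  shows "\<exists>\<sigma>. real_embedding d \<sigma> \<and> (\<forall>a b. \<sigma> (of_rat a + of_rat b * s) = of_rat a + of_rat b * r)"
proof -
  define \<sigma> where "\<sigma> z = (THE x. \<exists>a b. z = of_rat a + of_rat b * s \<and> x = of_rat a + of_rat b * r)" for z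
  have \<sigma>: "\<sigma> (of_rat a + of_rat b * s) = of_rat a + of_rat b * r" for a b
    unfolding \<sigma>_def
  proof (rule the_equality)
    fix x
    assume "\<exists>a' b'. of_rat a + of_rat b * s = of_rat a' + of_rat b' * s \<and> x = of_rat a' + of_rat b' * r"
    then show "x = of_rat a + of_rat b * r" unfolding coords_eq_iff by auto
  qed blast
  have "real_embedding d \<sigma>"
    unfolding real_embedding_def
  proof (intro conjI ballI)
    show "\<sigma> 1 = 1" using \<sigma>[of 1 0] by simp
    fix x y assume "x \<in> K" "y \<in> K"
    obtain a b where x: "x = of_rat a + of_rat b * s" using \<open>x \<in> K\<close> by (rule K_E)
    obtain a' b' where y: "y = of_rat a' + of_rat b' * s" using \<open>y \<in> K\<close> by (rule K_E)
    have "x + y = of_rat (a + a') + of_rat (b + b') * s"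
      by (simp add: x y of_rat_add algebra_simps)
    then have "\<sigma> (x + y) = of_rat (a + a') + of_rat (b + b') * r" using \<sigma> by simp
    also have "\<dots> = \<sigma> x + \<sigma> y" unfolding x y \<sigma> by (simp add: of_rat_add algebra_simps)
    finally show "\<sigma> (x + y) = \<sigma> x + \<sigma> y" .
    have "\<sigma> (x * y) = of_rat (a * a' + of_int d * (b * b')) + of_rat (a * b' + b * a') * r"
      unfolding x y coords_mult \<sigma> ..
    also have "\<dots> = of_rat a * of_rat a' + of_rat b * of_rat b' * (r * r) + (of_rat a * of_rat b' + of_rat b * of_rat a') * r"
      unfolding assms by (simp add: of_rat_add of_rat_mult algebra_simps)
    also have "\<dots> = \<sigma> x * \<sigma> y" unfolding x y \<sigma> by (simp add: algebra_simps)
    finally show "\<sigma> (x * y) = \<sigma> x * \<sigma> y" .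
  qed
  then show ?thesis using \<sigma> by blast
qed

lemma totally_positive_neg: "d < 0 \<Longrightarrow> totally_positive d z"
proof -
  assume d: "d < 0"
  have "\<not> real_embedding d \<sigma>" for \<sigma>
  proof
    assume "real_embedding d \<sigma>"
    then have "\<sigma> s * \<sigma> s = of_int d" by (rule real_embedding_coords)
    then show False using d zero_le_square[of "\<sigma> s"] by simp
  qed
  then show ?thesis by (simp add: totally_positive_def)
qed

lemma totally_positive_pos:
  assumes "d > 0"
  shows "totally_positive d (of_rat a + of_rat b * s) \<longleftrightarrow>
    of_rat a + of_rat b * sqrt (of_int d) > 0 \<and> of_rat a - of_rat b * sqrt (of_int d) > 0"
proof
  have sq: "sqrt (of_int d) * sqrt (of_int d) = of_int d" using assms by simp
  have sq': "- sqrt (of_int d) * - sqrt (of_int d) = of_int d" using assms by simp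
  {
    assume tp: "totally_positive d (of_rat a + of_rat b * s)"
    obtain \<sigma> where \<sigma>: "real_embedding d \<sigma>"
      "\<And>a b. \<sigma> (of_rat a + of_rat b * s) = of_rat a + of_rat b * sqrt (of_int d)"
      using real_embedding_exists[OF sq] by blast
    obtain \<tau> where \<tau>: "real_embedding d \<tau>"
      "\<And>a b. \<tau> (of_rat a + of_rat b * s) = of_rat a + of_rat b * - sqrt (of_int d)"
      using real_embedding_exists[OF sq'] by blast
    have "0 < \<sigma> (of_rat a + of_rat b * s)" "0 < \<tau> (of_rat a + of_rat b * s)"
      using tp \<sigma>(1) \<tau>(1) by (simp_all add: totally_positive_def)
    then show "of_rat a + of_rat b * sqrt (of_int d) > 0 \<and> of_rat a - of_rat b * sqrt (of_int d) > 0"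
      unfolding \<sigma>(2) \<tau>(2) by simp
  next
    assume pos: "of_rat a + of_rat b * sqrt (of_int d) > 0 \<and> of_rat a - of_rat b * sqrt (of_int d) > 0"
    show "totally_positive d (of_rat a + of_rat b * s)"
      unfolding totally_positive_def
    proof (intro allI impI)
      fix \<sigma> assume \<sigma>: "real_embedding d \<sigma>"
      have "\<sigma> s * \<sigma> s = sqrt (of_int d) * sqrt (of_int d)"
        using real_embedding_coords(2)[OF \<sigma>] sq by simp
      then have "\<sigma> s = sqrt (of_int d) \<or> \<sigma> s = - sqrt (of_int d)"
        by (simp only: square_eq_iff)
      then show "0 < \<sigma> (of_rat a + of_rat b * s)"
        unfolding real_embedding_coords(1)[OF \<sigma>] using pos by auto
    qed
  }
qed

lemma nrm_pos_iff:
  assumes "d > 0" "z \<in> K"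
  shows "nrm z > 0 \<longleftrightarrow> totally_positive d z \<or> totally_positive d (- z)"
proof -
  obtain a b where z: "z = of_rat a + of_rat b * s" using assms(2) by (rule K_E)
  have mz: "- z = of_rat (- a) + of_rat (- b) * s" by (simp add: z of_rat_minus)
  define r where "r = sqrt (of_int d)"
  have rr: "r * r = of_int d" using assms(1) by (simp add: r_def)
  have "(of_rat (nrm z) :: real) = of_rat a * of_rat a - r * r * (of_rat b * of_rat b)"
    unfolding rr z nrm_coords by (simp add: of_rat_diff of_rat_mult)
  also have "\<dots> = (of_rat a + of_rat b * r) * (of_rat a - of_rat b * r)"
    by (simp add: algebra_simps)
  finally have eq: "(of_rat (nrm z) :: real) = (of_rat a + of_rat b * r) * (of_rat a - of_rat b * r)" .
  have "nrm z > 0 \<longleftrightarrow> 0 < (of_rat (nrm z) :: real)" by simp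
  then have "nrm z > 0 \<longleftrightarrow> 0 < (of_rat a + of_rat b * r) * (of_rat a - of_rat b * r)"
    unfolding eq .
  then show ?thesis
    unfolding mz unfolding z totally_positive_pos[OF assms(1)] r_def[symmetric]
    by (auto simp: zero_less_mult_iff of_rat_minus)
qed

text \<open>For \<open>d < 0\<close> there are no real embeddings, so every element is totally positive, and norms of
  nonzero elements are positive. For \<open>d > 0\<close> an element of positive norm is totally positive up to
  sign, and the sign does not affect the ideal.\<close>

lemma narrow_principal_ideals_eq:
  "narrow_principal_ideals d = {(\<lambda>x. z * x) ` OK | z. z \<in> K \<and> nrm z > 0}"
proof (cases "d < 0")
  case True
  have "z \<in> K \<and> z \<noteq> 0 \<and> totally_positive d z \<longleftrightarrow> z \<in> K \<and> nrm z > 0" for z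
    using totally_positive_neg[OF True, of z] nrm_nonneg[OF True, of z] nrm_zero_iff[of z]
    by (metis order_less_le)
  then show ?thesis unfolding narrow_principal_ideals_def by simp
next
  case False
  then have d: "d > 0" using d_not_01 by auto
  show ?thesis
  proof
    show "narrow_principal_ideals d \<subseteq> {(\<lambda>x. z * x) ` OK | z. z \<in> K \<and> nrm z > 0}"
    proof
      fix I assume "I \<in> narrow_principal_ideals d"
      then obtain z where z: "I = (\<lambda>x. z * x) ` OK" "z \<in> K" "totally_positive d z"
        unfolding narrow_principal_ideals_def by blast
      then have "nrm z > 0" using nrm_pos_iff[OF d z(2)] by blast
      then show "I \<in> {(\<lambda>x. z * x) ` OK | z. z \<in> K \<and> nrm z > 0}" using z by blast
    qed
    show "{(\<lambda>x. z * x) ` OK | z. z \<in> K \<and> nrm z > 0} \<subseteq> narrow_principal_ideals d"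
    proof
      fix I assume "I \<in> {(\<lambda>x. z * x) ` OK | z. z \<in> K \<and> nrm z > 0}"
      then obtain z where I: "I = (\<lambda>x. z * x) ` OK" and z: "z \<in> K" "nrm z > 0" by blast
      have nz: "z \<noteq> 0" using z(2) nrm_zero_iff[OF z(1)] by (metis less_irrefl)
      have neg: "(\<lambda>x. - z * x) ` OK = (\<lambda>x. z * x) ` OK"
      proof -
        have minus: "- x \<in> OK" if "x \<in> OK" for x
          using OK_mult[OF OK_of_int[of "-1"] that] by simp
        have "uminus ` OK = OK"
        proof
          show "OK \<subseteq> uminus ` OK"
          proof
            fix x assume "x \<in> OK"
            then show "x \<in> uminus ` OK" by (intro image_eqI[of _ _ "- x"] minus) simp_all
          qed
        qed (use minus in blast)
        then have "(\<lambda>x. z * x) ` OK = (\<lambda>x. z * x) ` (uminus ` OK)" by simp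
        then show ?thesis by (simp add: image_image)
      qed
      from z nrm_pos_iff[OF d z(1)] consider "totally_positive d z" | "totally_positive d (- z)" by blast
      then show "I \<in> narrow_principal_ideals d"
      proof cases
        case 1
        then show ?thesis unfolding narrow_principal_ideals_def I using z nz by blast
      next
        case 2
        then show ?thesis unfolding narrow_principal_ideals_def I neg[symmetric]
          using K_uminus[OF z(1)] nz by (intro CollectI exI[of _ "- z"]) simp
      qed
    qed
  qed
qed

lemma ideal_mult_principal:
  assumes I: "I \<in> fractional_ideals d"
  shows "ideal_mult ((\<lambda>x. z * x) ` OK) I = (\<lambda>x. z * x) ` I"
proof
  note ID = fractional_idealD[OF I]
  show "(\<lambda>x. z * x) ` I \<subseteq> ideal_mult ((\<lambda>x. z * x) ` OK) I"
  proof
    fix c assume "c \<in> (\<lambda>x. z * x) ` I"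
    then obtain x where x: "c = z * x" "x \<in> I" by (rule imageE)
    have "z \<in> (\<lambda>x. z * x) ` OK" using OK_of_int[of 1] by (intro image_eqI[of _ _ 1]) simp_all
    then show "c \<in> ideal_mult ((\<lambda>x. z * x) ` OK) I"
      unfolding ideal_mult_def using x
      by (intro CollectI exI[of _ "1 :: nat"] exI[of _ "\<lambda>_. z"] exI[of _ "\<lambda>_. x"]) simp
  qed
  show "ideal_mult ((\<lambda>x. z * x) ` OK) I \<subseteq> (\<lambda>x. z * x) ` I"
  proof
    fix c assume "c \<in> ideal_mult ((\<lambda>x. z * x) ` OK) I"
    then obtain k :: nat and f g where c: "c = (\<Sum>i<k. f i * g i)"
      and fg: "\<forall>i<k. f i \<in> (\<lambda>x. z * x) ` OK \<and> g i \<in> I"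
      unfolding ideal_mult_def mem_Collect_eq by (elim exE conjE)
    have "(\<Sum>i<j. f i * g i) \<in> (\<lambda>x. z * x) ` I" if "j \<le> k" for j
      using that
    proof (induction j)
      case 0
      show ?case using ID(2) by (intro image_eqI[of _ _ 0]) simp_all
    next
      case (Suc j)
      from Suc.IH Suc.prems have "(\<Sum>i<j. f i * g i) \<in> (\<lambda>x. z * x) ` I" by simp
      then obtain x where x: "(\<Sum>i<j. f i * g i) = z * x" "x \<in> I" by (rule imageE)
      from fg Suc.prems have f: "f j \<in> (\<lambda>x. z * x) ` OK" and g: "g j \<in> I" by simp_all
      from f obtain r where r: "f j = z * r" "r \<in> OK" by (rule imageE)
      have "x + r * g j \<in> I" by (rule ID(4)[OF x(2) ID(5)[OF r(2) g]])
      moreover have "(\<Sum>i<Suc j. f i * g i) = z * (x + r * g j)"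
        by (simp add: x(1) r(1) algebra_simps)
      ultimately show ?case by (rule image_eqI[rotated])
    qed
    then show "c \<in> (\<lambda>x. z * x) ` I" unfolding c by simp
  qed
qed

text \<open>The class of a fractional ideal in the narrow class group, as a coset of the narrow principal
  ideals.\<close>

abbreviation narrow_class :: "complex set \<Rightarrow> complex set set" where
  "narrow_class I \<equiv> narrow_principal_ideals d #>\<^bsub>ideal_group d\<^esub> I"

lemma narrow_class_eq:
  assumes I: "I \<in> fractional_ideals d"
  shows "narrow_class I = {(\<lambda>x. z * x) ` I | z. z \<in> K \<and> nrm z > 0}"
  unfolding r_coset_def narrow_principal_ideals_eq ideal_group_def
  using ideal_mult_principal[OF I] by auto

lemma narrow_class_scale_subset:
  assumes I: "I \<in> fractional_ideals d" and J: "J \<in> fractional_ideals d"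
    and z: "z \<in> K" "nrm z > 0" "J = (\<lambda>x. z * x) ` I"
  shows "narrow_class J \<subseteq> narrow_class I"
proof
  fix C assume "C \<in> narrow_class J"
  then obtain u where u: "u \<in> K" "nrm u > 0" "C = (\<lambda>x. u * x) ` J"
    unfolding narrow_class_eq[OF J] by blast
  have "C = (\<lambda>x. (u * z) * x) ` I" unfolding u(3) z(3) image_image by (simp only: mult.assoc)
  moreover have "u * z \<in> K" by (intro K_mult u z)
  moreover have "nrm (u * z) > 0" using u z by (simp add: nrm_mult)
  ultimately show "C \<in> narrow_class I" unfolding narrow_class_eq[OF I] by blast
qed

lemma narrow_class_eq_iff:
  assumes I: "I \<in> fractional_ideals d" and J: "J \<in> fractional_ideals d"
  shows "narrow_class I = narrow_class J \<longleftrightarrow> (\<exists>z\<in>K. nrm z > 0 \<and> J = (\<lambda>x. z * x) ` I)"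
proof
  assume eq: "narrow_class I = narrow_class J"
  have "J = (\<lambda>x. 1 * x) ` J" by simp
  moreover have "1 \<in> K" "nrm 1 > 0" using K_of_int[of 1] nrm_of_int[of 1] by simp_all
  ultimately have "J \<in> narrow_class J" unfolding narrow_class_eq[OF J] by blast
  then show "\<exists>z\<in>K. nrm z > 0 \<and> J = (\<lambda>x. z * x) ` I"
    unfolding eq[symmetric] narrow_class_eq[OF I] by blast
next
  assume "\<exists>z\<in>K. nrm z > 0 \<and> J = (\<lambda>x. z * x) ` I"
  then obtain z where z: "z \<in> K" "nrm z > 0" and J_eq: "J = (\<lambda>x. z * x) ` I" by blast
  have nz: "z \<noteq> 0" using z(2) nrm_zero_iff[OF z(1)] by (metis less_irrefl)
  have "nrm z * nrm (inverse z) = 1"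
    using nrm_mult[OF z(1) K_inverse[OF z(1)]] nrm_of_int[of 1] nz by simp
  then have "nrm z * nrm (inverse z) > 0" by simp
  then have inv: "nrm (inverse z) > 0" by (rule zero_less_mult_pos) (rule z(2))
  have "(\<lambda>x. inverse z * x) ` J = (\<lambda>x. (inverse z * z) * x) ` I"
    unfolding J_eq image_image by (simp only: mult.assoc)
  then have I_eq: "I = (\<lambda>x. inverse z * x) ` J" using nz by simp
  show "narrow_class I = narrow_class J"
    using narrow_class_scale_subset[OF J I K_inverse[OF z(1)] inv I_eq]
      narrow_class_scale_subset[OF I J z J_eq] by (rule subset_antisym)
qed

lemma carrier_narrow_class_group:
  "carrier (narrow_class_group d) = narrow_class ` fractional_ideals d"
  by (auto simp: narrow_class_group_def FactGroup_def RCOSETS_def ideal_group_def)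

text \<open>The correspondence between forms and pairs of a sign and an ideal.\<close>

definition corresponds :: "int form \<Rightarrow> int \<times> complex set \<Rightarrow> bool" where
  "corresponds q y \<longleftrightarrow> (\<exists>\<alpha> \<beta>. adapted (fst y) q \<alpha> \<beta> \<and> zspan \<alpha> \<beta> = snd y)"

lemma proper_equiv_iff_narrow_class_eq:
  assumes cor: "corresponds q (\<epsilon>, I)" "corresponds q' (\<epsilon>', I')"
    and \<epsilon>: "\<epsilon> \<in> signs" "\<epsilon>' \<in> signs"
  shows "(q, q') \<in> proper_equiv \<longleftrightarrow> \<epsilon> = \<epsilon>' \<and> narrow_class I = narrow_class I'"
proof -
  obtain \<alpha> \<beta> \<alpha>' \<beta>' where ad: "adapted \<epsilon> q \<alpha> \<beta>" "adapted \<epsilon>' q' \<alpha>' \<beta>'"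
    and lat: "I = zspan \<alpha> \<beta>" "I' = zspan \<alpha>' \<beta>'"
    using cor by (auto simp: corresponds_def)
  have I: "I \<in> fractional_ideals d" "I' \<in> fractional_ideals d"
    unfolding lat using ad zspan_fractional_ideal by blast+
  show ?thesis
    unfolding narrow_class_eq_iff[OF I]
  proof
    assume "(q, q') \<in> proper_equiv"
    then obtain \<gamma> \<delta> where ad': "adapted \<epsilon> q' \<gamma> \<delta>" "zspan \<gamma> \<delta> = I"
      using adapted_properly_equivalent[OF ad(1)] lat by blast
    have "\<epsilon> = \<epsilon>'"
    proof (cases "d < 0")
      case True
      have pos: "0 < of_int \<epsilon> * (of_int (fst q') * nrm \<gamma>)" "0 < of_int \<epsilon>' * (of_int (fst q') * nrm \<alpha>')"
        using ad'(1) ad(2) by (simp_all add: adapted_def mult.assoc)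
      have "nrm \<gamma> \<ge> 0" "nrm \<alpha>' \<ge> 0"
        using ad'(1) ad(2) nrm_nonneg[OF True] by (simp_all add: adapted_def)
      then show ?thesis
        using pos signs_cases[OF \<epsilon>(1)] signs_cases[OF \<epsilon>(2)]
        by (auto simp: zero_less_mult_iff mult_less_0_iff)
    qed (use \<epsilon> in \<open>simp add: signs_def\<close>)
    moreover from this have "\<exists>z\<in>K. nrm z > 0 \<and> I' = (\<lambda>x. z * x) ` I"
      using adapted_same_form[OF ad'(1), of \<alpha>' \<beta>'] ad(2) unfolding ad'(2) lat(2) by simp
    ultimately show "\<epsilon> = \<epsilon>' \<and> (\<exists>z\<in>K. nrm z > 0 \<and> I' = (\<lambda>x. z * x) ` I)" ..
  next
    assume "\<epsilon> = \<epsilon>' \<and> (\<exists>z\<in>K. nrm z > 0 \<and> I' = (\<lambda>x. z * x) ` I)"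
    then obtain z where z: "z \<in> K" "nrm z > 0" "I' = (\<lambda>x. z * x) ` I" and e: "\<epsilon> = \<epsilon>'" by blast
    have "adapted \<epsilon> q (z * \<alpha>) (z * \<beta>)" by (rule adapted_scale[OF ad(1) z(1,2)])
    moreover have "zspan (z * \<alpha>) (z * \<beta>) = zspan \<alpha>' \<beta>'"
      using z(3) lat by (simp add: zspan_scale)
    ultimately show "(q, q') \<in> proper_equiv"
      using properly_equivalent_if_same_zspan ad(2) unfolding e by blast
  qed
qed

lemma bij_betw_cl_plus:
  "\<exists>f. bij_betw f (cl_plus D)
     (({..<mu d} \<rightarrow>\<^sub>E {1, -1 :: int}) \<times> carrier (narrow_class_group d))"
proof -
  \<comment> \<open>A sign is encoded as a constant function on an index set with one element if \<open>d < 0\<close> and none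
    if \<open>d > 0\<close>.\<close>
  define \<kappa> where "\<kappa> = (\<lambda>(\<epsilon> :: int, I). (\<lambda>i\<in>{..<mu d}. \<epsilon>, narrow_class I))"
  define Y where "Y = signs \<times> fractional_ideals d"
  have sign_inj: "(\<lambda>i\<in>{..<mu d}. \<epsilon>) = (\<lambda>i\<in>{..<mu d}. \<epsilon>') \<longleftrightarrow> \<epsilon> = \<epsilon>'"
    if e: "\<epsilon> \<in> signs" "\<epsilon>' \<in> signs" for \<epsilon> \<epsilon>'
  proof
    assume eq: "(\<lambda>i\<in>{..<mu d}. \<epsilon>) = (\<lambda>i\<in>{..<mu d}. \<epsilon>')"
    show "\<epsilon> = \<epsilon>'"
    proof (cases "d < 0")
      case True
      then show ?thesis using fun_cong[OF eq, of 0] by (simp add: mu_def)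
    qed (use e in \<open>simp add: signs_def\<close>)
  qed simp
  have "\<exists>f. bij_betw f ({q. disc q = D} // proper_equiv) (\<kappa> ` Y)"
  proof (rule bij_betw_quotient[where rel = corresponds])
    show "equiv UNIV proper_equiv" by (rule equiv_proper_equiv)
  next
    fix q :: "int form" assume q: "q \<in> {q. disc q = D}"
    obtain a b c where abc: "q = (a, b, c)" by (metis prod_cases3)
    then obtain \<epsilon> \<alpha> \<beta> where "\<epsilon> \<in> signs" "adapted \<epsilon> q \<alpha> \<beta>"
      using form_has_adapted_basis[of a b c] q by auto
    then show "\<exists>y\<in>Y. corresponds q y"
      using zspan_fractional_ideal
      by (intro bexI[of _ "(\<epsilon>, zspan \<alpha> \<beta>)"]) (auto simp: corresponds_def Y_def)
  next
    fix y assume "y \<in> Y"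
    then obtain \<epsilon> I where y: "y = (\<epsilon>, I)" "\<epsilon> \<in> signs" "I \<in> fractional_ideals d" by (auto simp: Y_def)
    then obtain q \<alpha> \<beta> where ad: "adapted \<epsilon> q \<alpha> \<beta>" "zspan \<alpha> \<beta> = I"
      using fractional_ideal_has_adapted_basis by blast
    obtain a b c where "q = (a, b, c)" by (metis prod_cases3)
    then have "disc q = D" using adapted_disc ad(1) by simp
    then show "\<exists>q\<in>{q. disc q = D}. corresponds q y"
      using ad y(1) by (intro bexI[of _ q]) (auto simp: corresponds_def)
  next
    fix q q' y y'
    assume "y \<in> Y" "y' \<in> Y" and cor: "corresponds q y" "corresponds q' y'"
    then obtain \<epsilon> I \<epsilon>' I' where y: "y = (\<epsilon>, I)" "y' = (\<epsilon>', I')" "\<epsilon> \<in> signs" "\<epsilon>' \<in> signs"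
      by (auto simp: Y_def)
    show "(q, q') \<in> proper_equiv \<longleftrightarrow> \<kappa> y = \<kappa> y'"
      using proper_equiv_iff_narrow_class_eq[OF cor[unfolded y(1,2)] y(3,4)] sign_inj[OF y(3,4)]
      by (simp add: \<kappa>_def y)
  qed
  moreover have "\<kappa> ` Y = ({..<mu d} \<rightarrow>\<^sub>E {1, -1 :: int}) \<times> carrier (narrow_class_group d)"
  proof -
    have signs: "(\<lambda>\<epsilon>. \<lambda>i\<in>{..<mu d}. \<epsilon>) ` signs = ({..<mu d} \<rightarrow>\<^sub>E {1, -1 :: int})"
    proof (cases "d < 0")
      case True
      then have m: "{..<mu d} = {0}" by (auto simp: mu_def)
      show ?thesis
      proof
        show "(\<lambda>\<epsilon>. \<lambda>i\<in>{..<mu d}. \<epsilon>) ` signs \<subseteq> ({..<mu d} \<rightarrow>\<^sub>E {1, -1 :: int})"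
          using True by (auto simp: signs_def)
        show "({..<mu d} \<rightarrow>\<^sub>E {1, -1 :: int}) \<subseteq> (\<lambda>\<epsilon>. \<lambda>i\<in>{..<mu d}. \<epsilon>) ` signs"
        proof
          fix g assume g: "g \<in> {..<mu d} \<rightarrow>\<^sub>E {1, -1 :: int}"
          then have "g = (\<lambda>i\<in>{..<mu d}. g 0)" unfolding m by (auto simp: fun_eq_iff PiE_def extensional_def)
          moreover have "g 0 \<in> signs" using g True unfolding m by (auto simp: signs_def)
          ultimately show "g \<in> (\<lambda>\<epsilon>. \<lambda>i\<in>{..<mu d}. \<epsilon>) ` signs" by blast
        qed
      qed
    next
      case False
      then show ?thesis by (simp add: mu_def signs_def restrict_def)
    qed
    have "\<kappa> ` Y = ((\<lambda>\<epsilon>. \<lambda>i\<in>{..<mu d}. \<epsilon>) ` signs) \<times> (narrow_class ` fractional_ideals d)"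
      by (auto simp: \<kappa>_def Y_def)
    then show ?thesis unfolding signs carrier_narrow_class_group .
  qed
  ultimately show ?thesis unfolding cl_plus_def by simp
qed

lemma locally_properly_isomorphic_norm_form_iff:
  "locally_properly_isomorphic q (norm_form d) \<longleftrightarrow> disc q = disc (norm_form d)"
proof
  assume disc: "disc q = disc (norm_form d)"
  obtain a b c where q: "q = (a, b, c)" by (metis prod_cases3)
  have "disc (a, b, c) = D" using disc by (simp only: q disc_norm_form)
  from locally_properly_isomorphic_if_disc_eq[OF disc_D_primitive[OF this]] disc
  show "locally_properly_isomorphic q (norm_form d)"
    unfolding q norm_form_eq by blast
qed (rule disc_eq_if_locally_properly_isomorphic)

lemma cl_plus_eq_H1: "cl_plus (disc (norm_form d)) = H1_fl_O_plus d"
  unfolding cl_plus_def H1_fl_O_plus_def locally_properly_isomorphic_norm_form_iff ..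

end

theorem theorem5p19:
  fixes d :: int
  assumes "d \<notin> {0, 1}" and "squarefree d"
  shows "cl_plus (disc (norm_form d)) = H1_fl_O_plus d \<and>
    (\<exists>f. bij_betw f (H1_fl_O_plus d)
       (({..<mu d} \<rightarrow>\<^sub>E {1, -1 :: int}) \<times> carrier (narrow_class_group d)))"
proof -
  interpret squarefree_radicand d using assms by unfold_locales
  show ?thesis
    using cl_plus_eq_H1 bij_betw_cl_plus disc_norm_form by simp
qed

end
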